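(* Let $\Sigma\subset\mathbb{C}$ be compact and let $\mu\in\mathcal{B}_\Sigma$ be a H\"older probability measure. Let $n\ge1$ and let $\lambda_0\le\lambda_1\le\dots\le\lambda_n$ be the successive minima of $K_n$ on the lattice $\Gamma_n$. Then for every $1\le m\le n+1$, $$\prod_{i=0}^{m-1}\lambda_i\geq\frac{1}{m!}\,e^{\left(-nm+\frac{(m-1)m}{2}\right)I(\mu)}.$$
   Context: $\mathcal{B}_\Sigma$ is the set of Borel probability measures $\mu$ supported on $\Sigma$ that are invariant under complex conjugation and satisfy $\int\log|Q(x)|\,d\mu(x)\ge0$ for every non-zero $Q\in\mathbb{Z}[x]$. $\mu$ is H\"older if there are $\delta,A>0$ such that $\mu([a,b]\times[c,d])\le A\max(|b-a|,|c-d|)^\delta$ for every $a<b$, $c<d$ (with $[a,b]\times[c,d]\subset\mathbb{C}$ the set of $z$ with $\Re z\in[a,b]$, $\Im z\in[c,d]$). $U_\mu(z):=\int\log|z-w|\,d\mu(w)$ and $I(\mu):=\int\int\log|z_1-z_2|\,d\mu(z_1)d\mu(z_2)$. $K_n:=\{p\in\mathbb{R}[x]:\deg p\le n,\ \frac{\log|p(z)|}{n}\le U_\mu(z)\text{ for every }z\in\mathbb{C}\}$, a symmetric convex subset of the space of real polynomials of degree at most $n$, identified with $\mathbb{R}^{n+1}$ via coefficients. $\Gamma_n\subset\mathbb{R}^{n+1}$ is the lattice of integral polynomials of degree at most $n$. The $k$-th successive minimum $\lambda_k$ ($0\le k\le n$) is the infimum of the $\lambda>0$ such that $\lambda K_n$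 contains $k+1$ linearly independent vectors of $\Gamma_n$. *)

theory Defs
  imports "HOL-Analysis.Analysis" "HOL-Probability.Probability_Measure"
    "HOL-Computational_Algebra.Polynomial"
begin

text \<open>Logarithm on the nonnegative reals with \<open>log 0 = -\<infinity>\<close> (in the library \<open>ln 0 = 0\<close>).\<close>

definition elog :: "real \<Rightarrow> ereal" where
  "elog x = (if x = 0 then -\<infinity> else ereal (ln x))"

text \<open>Integral of an extended-real function, as the difference of the integrals of its positive
  and negative parts (\<open>e2ennreal\<close> sends negative numbers to \<open>0\<close>). It is meaningful whenever one
  of the two is finite. The functions integrated below are bounded above on a compact set carrying
  the measure, so they always have an integral in \<open>[-\<infinity>, \<infinity>)\<close>; in contrast, the Bochner integral
  would be \<open>0\<close> where the value should be \<open>-\<infinity>\<close>.\<close>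

definition eintegral :: "'a measure \<Rightarrow> ('a \<Rightarrow> ereal) \<Rightarrow> ereal" where
  "eintegral M f =
     enn2ereal (\<integral>\<^sup>+x. e2ennreal (f x) \<partial>M) - enn2ereal (\<integral>\<^sup>+x. e2ennreal (- f x) \<partial>M)"

lemma eintegral_ereal:
  assumes "integrable M f"
  shows "eintegral M (\<lambda>x. ereal (f x)) = ereal (integral\<^sup>L M f)"
proof -
  let ?P = "\<integral>\<^sup>+x. ennreal (f x) \<partial>M" and ?N = "\<integral>\<^sup>+x. ennreal (- f x) \<partial>M"
  have fin: "?P \<noteq> \<infinity>" "?N \<noteq> \<infinity>"
    using assms by (auto simp: real_integrable_def)
  have *: "enn2ereal a = ereal (enn2real a)" if "a \<noteq> \<infinity>" for a
    using that by (cases a) (simp_all add: enn2ereal_ennreal)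
  have "eintegral M (\<lambda>x. ereal (f x)) = enn2ereal ?P - enn2ereal ?N"
    by (simp add: eintegral_def ennreal_def)
  also have "\<dots> = ereal (enn2real ?P - enn2real ?N)"
    unfolding *[OF fin(1)] *[OF fin(2)] by simp
  finally show ?thesis
    unfolding real_lebesgue_integral_def[OF assms] .
qed

definition B_Sigma :: "complex set \<Rightarrow> complex measure set" where
  "B_Sigma \<Sigma> = {\<mu>. sets \<mu> = sets borel \<and> prob_space \<mu> \<and> emeasure \<mu> (- \<Sigma>) = 0 \<and>
     distr \<mu> borel cnj = \<mu> \<and>
     (\<forall>Q :: int poly. Q \<noteq> 0 \<longrightarrow>
        0 \<le> eintegral \<mu> (\<lambda>x. elog (cmod (poly (map_poly of_int Q) x))))}"

definition holder_measure :: "complex measure \<Rightarrow> bool" where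
  "holder_measure \<mu> \<longleftrightarrow> (\<exists>\<delta>>0. \<exists>A>0. \<forall>a b c d. a < b \<longrightarrow> c < d \<longrightarrow>
     measure \<mu> {z. Re z \<in> {a..b} \<and> Im z \<in> {c..d}} \<le> A * max \<bar>b - a\<bar> \<bar>c - d\<bar> powr \<delta>)"

definition potential :: "complex measure \<Rightarrow> complex \<Rightarrow> ereal" where
  "potential \<mu> z = eintegral \<mu> (\<lambda>w. elog (cmod (z - w)))"

text \<open>For a compactly supported Hoelder measure this is finite.\<close>

definition energy :: "complex measure \<Rightarrow> ereal" where
  "energy \<mu> = eintegral \<mu> (\<lambda>z\<^sub>1. eintegral \<mu> (\<lambda>z\<^sub>2. elog (cmod (z\<^sub>1 - z\<^sub>2))))"

text \<open>Real polynomials of degree at most \<open>n\<close> are used directly in place of their coefficient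
  vectors; linear independence is that of the real vector space of polynomials under \<open>smult\<close>.\<close>

definition K_body :: "complex measure \<Rightarrow> nat \<Rightarrow> real poly set" where
  "K_body \<mu> n = {p. degree p \<le> n \<and>
     (\<forall>z. elog (cmod (poly (map_poly complex_of_real p) z)) / ereal (real n) \<le> potential \<mu> z)}"

definition Gamma_lattice :: "nat \<Rightarrow> real poly set" where
  "Gamma_lattice n = {p. degree p \<le> n \<and> (\<forall>i. coeff p i \<in> \<int>)}"

lemma vector_space_smult: "vector_space (smult :: real \<Rightarrow> real poly \<Rightarrow> real poly)"
  by unfold_locales (simp_all add: smult_add_right smult_add_left)

definition successive_min :: "real poly set \<Rightarrow> real poly set \<Rightarrow> nat \<Rightarrow> real" where
  "successive_min K L k = Inf {l. l > 0 \<and>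
     (\<exists>S. S \<subseteq> smult l ` K \<inter> L \<and> card S = k + 1 \<and> \<not> module.dependent smult S)}"

end

theory Submission
  imports Defs "HOL-Probability.Infinite_Product_Measure"
    "HOL-Computational_Algebra.Fundamental_Theorem_Algebra"
    "HOL-Real_Asymp.Real_Asymp" "Jordan_Normal_Form.Char_Poly"
begin

text \<open>
  Let \<open>p\<^sub>0, \<dots>, p\<^sub>m\<^sub>-\<^sub>1\<close> be linearly independent integer polynomials with \<open>p\<^sub>i \<in> l\<^sub>i K\<^sub>n\<close>, that is
  \<open>|p\<^sub>i| \<le> l\<^sub>i exp (n U)\<close> for the potential \<open>U\<close> of \<open>\<mu>\<close>, and let \<open>D(z) = det (p\<^sub>i(z\<^sub>k))\<close>. Leibniz' formula
  bounds \<open>|D(z)|\<close> by \<open>m!\<close> times the product of all \<open>l\<^sub>i\<close> and all \<open>exp (n U(z\<^sub>k))\<close>. On the other hand,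
  \<open>D\<close> is the Vandermonde product times an integer polynomial \<open>Q(z\<^sub>0, \<dots>, z\<^sub>m\<^sub>-\<^sub>1)\<close>, a determinant of
  divided differences (\<open>det_eval_div_diff\<close>). Integrating the logarithms against \<open>m\<close> independent
  copies of \<open>\<mu>\<close> gives
    \<open>\<integral> log|Q| + m(m - 1)/2 I(\<mu>) \<le> log m! + \<Sum> log l\<^sub>i + n m I(\<mu>)\<close>,
  and the claim follows when \<open>l\<^sub>i\<close> tends to the \<open>i\<close>-th successive minimum, provided that
  \<open>\<integral> log|Q| \<ge> 0\<close>.

  So what has to be shown is that the defining inequality of \<open>\<B>\<^sub>\<Sigma>\<close>, which concerns integer polynomials
  in one variable, extends to integer polynomials in several variables (\<open>nonneg_mean\<close>). The proof is by
  induction on the number of variables. Suppose that for every \<open>\<epsilon> > 0\<close> there is a nonzero integer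
  polynomial \<open>P\<close> of degree at most \<open>N\<close> with \<open>|P| \<le> exp (N (U + \<epsilon>))\<close> on the whole plane
  (\<open>small_int_poly\<close>). The resultant of \<open>Q(x, _)\<close> and \<open>P\<close> is an integer polynomial in the remaining
  variables \<open>x\<close>; its modulus is \<open>|c(x)|\<^sup>N \<Prod> |P(\<zeta>)|\<close>, where \<open>c(x)\<close> is the leading coefficient and \<open>\<zeta>\<close>
  runs over the roots of \<open>Q(x, _)\<close>. Hence its logarithm is at most \<open>N\<close> times
  \<open>log|c(x)| + \<Sum> U(\<zeta>) = \<integral> log|Q(x, y)| d\<mu>(y)\<close>, up to a multiple of \<open>N \<epsilon>\<close>, and the induction hypothesis
  for the resultant yields the claim for \<open>Q\<close>. The resultant must not vanish identically. This is
  arranged by first splitting off from \<open>Q\<close> the largest factor that depends on \<open>y\<close> only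
  (\<open>polyfam_content_factor\<close>, a form of Gauss' lemma); that factor is covered by the hypothesis
  on \<open>\<mu>\<close>.

  The polynomial \<open>P\<close> comes from the pigeonhole principle. In the Newton basis
  \<open>\<Prod>\<^sub>i\<^sub><\<^sub>k (x - z\<^sub>i)\<close> the change of coordinates is unitriangular, so that one can prescribe bounds on the
  Newton coordinates of a nonzero polynomial over the Gaussian integers as long as the product of these
  bounds exceeds 1, up to a factor 2 in each (\<open>minkowski_newton\<close>). If the \<open>z\<^sub>k\<close> are Leja points for the weight \<open>exp (- N U)\<close>, bounds
  on the Newton coordinates are bounds on the polynomial relative to \<open>exp (N U)\<close>, and all that is needed
  is an upper bound for the Vandermonde determinant of the points. That bound says that the
  energy of the neutral charge formed by the points and \<open>- N \<mu>\<close> has the right sign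
  (\<open>vandermonde_energy_bound\<close>). It holds because, up to functions of one variable that cancel, a smoothed
  logarithmic kernel is half of \<open>log (1 - B)\<close> for a positive semidefinite kernel \<open>B\<close> given by stereographic
  projection, and all powers of \<open>B\<close> are positive semidefinite too. The result is a polynomial
  bounded by \<open>exp (N (U - I(\<mu>)/2 + \<epsilon>))\<close>; multiplied by its complex conjugate it has integer
  coefficients. Integrating this bound against \<open>\<mu>\<close> shows \<open>I(\<mu>) \<ge> 0\<close>, after which the term \<open>I(\<mu>)/2\<close> can
  be dropped.

  The Hoelder condition enters through two consequences: for some \<open>a > 0\<close> the integrals
  \<open>\<integral> |z - w| powr (-a) d\<mu>(w)\<close> are bounded uniformly in \<open>z\<close>, and \<open>\<mu>\<close> has no atoms
  (\<open>holder_measure_moment\<close>).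
\<close>

text \<open>Determinants are those of matrices whose size is a number, not a type: the size \<open>m\<close> varies within
  proofs.\<close>
hide_const (open) module.smult Determinants.det Finite_Cartesian_Product.mat

section \<open>Hoelder measures have bounded negative moments\<close>

lemma holder_measure_cball:
  assumes "sets \<mu> = sets borel" "prob_space \<mu>" "holder_measure \<mu>"
  obtains A \<delta> where "A > 0" "\<delta> > 0"
    "\<And>z r. r > 0 \<Longrightarrow> measure \<mu> (cball z r) \<le> A * (2 * r) powr \<delta>"
proof -
  interpret prob_space \<mu> by fact
  obtain \<delta> A where A: "\<delta> > 0" "A > 0" and H: "\<And>a b c d. a < b \<Longrightarrow> c < d \<Longrightarrow>
     measure \<mu> {z. Re z \<in> {a..b} \<and> Im z \<in> {c..d}} \<le> A * max \<bar>b - a\<bar> \<bar>c - d\<bar> powr \<delta>"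
    using assms(3) unfolding holder_measure_def by blast
  have "measure \<mu> (cball z r) \<le> A * (2 * r) powr \<delta>" if "r > 0" for z r
  proof -
    let ?B = "{w. Re w \<in> {Re z - r..Re z + r} \<and> Im w \<in> {Im z - r..Im z + r}}"
    have cl: "closed ?B"
    proof -
      have "?B = (Re -` {Re z - r..Re z + r}) \<inter> (Im -` {Im z - r..Im z + r})" by auto
      then show ?thesis
        by (auto intro!: closed_Int continuous_closed_vimage continuous_intros)
    qed
    have "cball z r \<subseteq> ?B"
    proof
      fix w assume "w \<in> cball z r"
      then have "cmod (z - w) \<le> r" by (simp add: dist_norm)
      then have "\<bar>Re (z - w)\<bar> \<le> r" "\<bar>Im (z - w)\<bar> \<le> r"
        using abs_Re_le_cmod[of "z - w"] abs_Im_le_cmod[of "z - w"] by linarith+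
      then show "w \<in> ?B" by auto
    qed
    then have "measure \<mu> (cball z r) \<le> measure \<mu> ?B"
      using cl assms(1) by (intro finite_measure_mono) auto
    also have "\<dots> \<le> A * max \<bar>(Re z + r) - (Re z - r)\<bar> \<bar>(Im z - r) - (Im z + r)\<bar> powr \<delta>"
      using H[of "Re z - r" "Re z + r" "Im z - r" "Im z + r"] that by simp
    also have "\<dots> = A * (2 * r) powr \<delta>" using that by simp
    finally show ?thesis .
  qed
  with A that show ?thesis by blast
qed

lemma dyadic_powr_bound:
  fixes r a :: real
  assumes "0 < r" "r < 1" "0 < a"
  obtains k :: nat where "r \<le> 2 powr (- real k)" "r powr (-a) \<le> 2 powr (a * (real k + 1))"
proof -
  define k where "k = nat \<lfloor>- log 2 r\<rfloor>"
  have pos: "- log 2 r > 0" using assms by simp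
  then have k: "real k \<le> - log 2 r" "- log 2 r < real k + 1"
    unfolding k_def by linarith+
  have r: "r = 2 powr (log 2 r)" using assms by simp
  have 1: "r \<le> 2 powr (- real k)"
    by (subst r) (use k in \<open>intro powr_mono, auto\<close>)
  have "r powr (-a) = 2 powr (- log 2 r * a)"
    by (subst r) (simp add: powr_powr)
  also have "\<dots> \<le> 2 powr (a * (real k + 1))"
  proof (intro powr_mono)
    show "- log 2 r * a \<le> a * (real k + 1)"
      using mult_left_mono[OF less_imp_le[OF k(2)], of a] assms(3) by (simp add: mult.commute)
  qed simp
  finally show ?thesis using 1 that by blast
qed

text \<open>Around \<open>z\<close> the function \<open>|z - w| powr (-a)\<close> is at most \<open>2 powr (a (k + 1))\<close> on the \<open>k\<close>-th dyadic
  annulus, whose mass is \<open>O(2 powr (-\<delta> k))\<close> by the Hoelder condition. The resulting geometric series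
  converges for every \<open>a < \<delta>\<close>, with a sum that does not depend on \<open>z\<close>.\<close>
lemma holder_measure_moment:
  assumes "sets \<mu> = sets borel" "prob_space \<mu>" "holder_measure \<mu>"
  obtains a C where "0 < a" "a \<le> 1" "0 \<le> C"
    "\<And>z. (\<integral>\<^sup>+w. ennreal (cmod (z - w) powr (-a)) \<partial>\<mu>) \<le> ennreal C"
    "\<And>z. measure \<mu> {z} = 0"
proof -
  interpret prob_space \<mu> by fact
  obtain A \<delta> where A: "A > 0" "\<delta> > 0"
    and ball: "\<And>z r. r > 0 \<Longrightarrow> measure \<mu> (cball z r) \<le> A * (2 * r) powr \<delta>"
    using holder_measure_cball[OF assms] by blast
  note [measurable_cong] = assms(1)
  define a where "a = min 1 (\<delta> / 2)"
  have a: "0 < a" "a \<le> 1" "a < \<delta>" using A by (auto simp: a_def)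
  \<comment> \<open>Ratio of the geometric series that bounds the dyadic sum.\<close>
  define q :: real where "q = 2 powr (a - \<delta>)"
  have q: "0 < q" "q < 1" using a by (auto simp: q_def powr_less_one)
  define K where "K = 2 powr a * A * 2 powr \<delta>"
  have K: "K \<ge> 0" using A by (simp add: K_def)
  have term_eq: "2 powr (a * (real k + 1)) * (A * (2 * 2 powr (- real k)) powr \<delta>) = K * q ^ k" for k
  proof -
    have qk: "q ^ k = 2 powr ((a - \<delta>) * real k)"
      unfolding q_def by (simp add: powr_powr flip: powr_realpow)
    have D: "(2 * 2 powr (- real k)) powr \<delta> = 2 powr \<delta> * 2 powr (- real k * \<delta>)"
      by (simp add: powr_mult powr_powr)
    have E: "2 powr (a * (real k + 1)) * 2 powr (- real k * \<delta>) = 2 powr a * q ^ k"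
      unfolding qk powr_add[symmetric]
      by (rule arg_cong[where f = "\<lambda>t. 2 powr t"]) (simp add: algebra_simps)
    have "2 powr (a * (real k + 1)) * (A * (2 * 2 powr (- real k)) powr \<delta>)
        = A * 2 powr \<delta> * (2 powr (a * (real k + 1)) * 2 powr (- real k * \<delta>))"
      unfolding D by (simp only: ac_simps)
    also have "\<dots> = K * q ^ k"
      unfolding E K_def by (simp only: ac_simps)
    finally show ?thesis .
  qed
  have bound: "(\<integral>\<^sup>+w. ennreal (cmod (z - w) powr (-a)) \<partial>\<mu>) \<le> ennreal (1 + K / (1 - q))" for z
  proof -
    let ?f = "\<lambda>k w. ennreal (2 powr (a * (real k + 1))) * indicator (cball z (2 powr (- real k))) w"
    have "(\<integral>\<^sup>+w. ennreal (cmod (z - w) powr (-a)) \<partial>\<mu>) \<le> (\<integral>\<^sup>+w. 1 + (\<Sum>k. ?f k w) \<partial>\<mu>)"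
    proof (rule nn_integral_mono)
      fix w
      show "ennreal (cmod (z - w) powr (-a)) \<le> 1 + (\<Sum>k. ?f k w)"
      proof (cases "0 < cmod (z - w) \<and> cmod (z - w) < 1")
        case True
        obtain k :: nat where k: "cmod (z - w) \<le> 2 powr (- real k)"
          "cmod (z - w) powr (-a) \<le> 2 powr (a * (real k + 1))"
          using dyadic_powr_bound[of "cmod (z - w)" a] True a by blast
        have "ennreal (cmod (z - w) powr (-a)) \<le> ?f k w"
          using k by (auto simp: dist_norm intro!: ennreal_leI)
        also have "\<dots> = (\<Sum>i\<in>{k}. ?f i w)"
          by (simp only: sum.insert[OF finite.emptyI] empty_iff not_False_eq_True sum.empty add_0_right)
        also have "\<dots> \<le> (\<Sum>k. ?f k w)"
          by (rule sum_le_suminf) auto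
        finally show ?thesis by (simp add: add_increasing)
      next
        case False
        have "cmod (z - w) powr (-a) \<le> 1"
        proof (cases "cmod (z - w) = 0")
          case False
          then have "1 \<le> cmod (z - w)" using \<open>\<not> (0 < cmod (z - w) \<and> cmod (z - w) < 1)\<close>
            by (smt (verit) norm_ge_zero)
          then have "cmod (z - w) powr (-a) \<le> cmod (z - w) powr 0"
            using a by (intro powr_mono) auto
          then show ?thesis using False by simp
        qed simp
        then have "ennreal (cmod (z - w) powr (-a)) \<le> 1"
          by (metis ennreal_1 ennreal_leI)
        then show ?thesis by (meson add_increasing2 order_trans zero_le)
      qed
    qed
    also have "\<dots> = 1 + (\<Sum>k. \<integral>\<^sup>+w. ?f k w \<partial>\<mu>)"
    proof -
      have "cball z r \<in> sets \<mu>" for r using assms(1) by simp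
      then have f: "?f k \<in> borel_measurable \<mu>" for k
        by (intro borel_measurable_times_ennreal borel_measurable_const borel_measurable_indicator)
      have "(\<integral>\<^sup>+w. 1 + (\<Sum>k. ?f k w) \<partial>\<mu>) = (\<integral>\<^sup>+w. 1 \<partial>\<mu>) + (\<integral>\<^sup>+w. (\<Sum>k. ?f k w) \<partial>\<mu>)"
        by (intro nn_integral_add borel_measurable_suminf_order borel_measurable_const f)
      also have "(\<integral>\<^sup>+w. (\<Sum>k. ?f k w) \<partial>\<mu>) = (\<Sum>k. \<integral>\<^sup>+w. ?f k w \<partial>\<mu>)"
        using f by (rule nn_integral_suminf)
      finally show ?thesis by (simp only: nn_integral_const emeasure_space_1 mult_1)
    qed
    also have "(\<Sum>k. \<integral>\<^sup>+w. ?f k w \<partial>\<mu>) \<le> (\<Sum>k. ennreal (K * q ^ k))"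
    proof (intro suminf_le)
      fix k
      have "(\<integral>\<^sup>+w. ?f k w \<partial>\<mu>) = ennreal (2 powr (a * (real k + 1))) * emeasure \<mu> (cball z (2 powr (- real k)))"
        by (subst nn_integral_cmult_indicator) (auto simp: assms(1))
      also have "\<dots> \<le> ennreal (2 powr (a * (real k + 1))) * ennreal (A * (2 * 2 powr (- real k)) powr \<delta>)"
        using ball[of "2 powr (- real k)" z]
        by (intro mult_left_mono) (auto simp: emeasure_eq_measure intro!: ennreal_leI)
      also have "\<dots> = ennreal (K * q ^ k)"
        using term_eq[of k] A by (simp flip: ennreal_mult)
      finally show "(\<integral>\<^sup>+w. ?f k w \<partial>\<mu>) \<le> ennreal (K * q ^ k)" .
    qed auto
    also have "(\<Sum>k. ennreal (K * q ^ k)) = ennreal (\<Sum>k. K * q ^ k)"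
      using K q by (intro suminf_ennreal2) (auto intro!: summable_mult summable_geometric)
    also have "(\<Sum>k. K * q ^ k) = K / (1 - q)"
      using q by (subst suminf_mult) (auto intro!: summable_geometric simp: suminf_geometric)
    also have "1 + ennreal (K / (1 - q)) = ennreal (1 + K / (1 - q))"
      using K q by (simp add: ennreal_plus)
    finally show ?thesis by (simp add: add_left_mono)
  qed
  have atom: "measure \<mu> {z} = 0" for z
  proof (rule ccontr)
    assume "measure \<mu> {z} \<noteq> 0"
    then have m: "measure \<mu> {z} > 0" using measure_nonneg[of \<mu> "{z}"] by linarith
    (* the radius for which the Hoelder bound is half the mass of the atom *)
    define r where "r = (measure \<mu> {z} / (2 * A)) powr (1 / \<delta>) / 2"
    have r: "r > 0" using m A by (simp add: r_def)
    have "measure \<mu> {z} \<le> measure \<mu> (cball z r)"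
      using r assms(1) by (intro finite_measure_mono) auto
    also have "\<dots> \<le> A * (2 * r) powr \<delta>" by (rule ball[OF r])
    also have "\<dots> = measure \<mu> {z} / 2" using m A by (simp add: r_def powr_powr)
    finally show False using m by linarith
  qed
  show ?thesis
    using that[of a "1 + K / (1 - q)"] a bound atom K q by auto
qed

section \<open>The logarithmic potential and its smoothing\<close>

lemma abs_ln_le_powr:
  fixes r a :: real
  assumes "0 < r" "0 < a"
  shows "- ln r \<le> r powr (-a) / a" "\<bar>ln r\<bar> \<le> r powr (-a) / a + r"
proof -
  have "a * (- ln r) = ln (r powr (-a))" using assms by (simp add: ln_powr)
  also have "\<dots> \<le> r powr (-a)" using assms ln_le_minus_one[of "r powr (-a)"] by simp
  finally show 1: "- ln r \<le> r powr (-a) / a" using assms by (simp add: field_simps)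
  have "ln r \<le> r" using ln_le_minus_one[of r] assms by simp
  moreover have "0 \<le> r powr (-a) / a" using assms by simp
  ultimately show "\<bar>ln r\<bar> \<le> r powr (-a) / a + r" using 1 assms by linarith
qed

text \<open>For \<open>x = \<surd>s / |z - w|\<close> the left-hand side is the difference between the smoothed and the genuine
  logarithmic kernel, so this turns the moment bound into a rate for the smoothing error.\<close>
lemma half_ln_one_plus_square_le:
  fixes x a :: real
  assumes "0 \<le> x" "0 < a" "a \<le> 1"
  shows "ln (1 + x\<^sup>2) / 2 \<le> (1 + 1 / a) * x powr a"
proof (cases "x \<le> 1")
  case True
  show ?thesis
  proof (cases "x = 0")
    case False
    with assms have x: "0 < x" by simp
    have "ln (1 + x\<^sup>2) \<le> x\<^sup>2" by (rule ln_add_one_self_le_self) simp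
    also have "x\<^sup>2 = x powr 2" using x by simp
    also have "\<dots> \<le> x powr a" using x True assms by (intro powr_mono') auto
    finally have "ln (1 + x\<^sup>2) / 2 \<le> x powr a / 2" by simp
    also have "\<dots> \<le> 1 * x powr a" by simp
    also have "\<dots> \<le> (1 + 1 / a) * x powr a" using assms by (intro mult_right_mono) auto
    finally show ?thesis .
  qed simp
next
  case False
  then have x: "1 < x" by simp
  have "ln (1 + x\<^sup>2) \<le> ln (exp 1 * x\<^sup>2)"
  proof (subst ln_le_cancel_iff)
    have "(2::real) \<le> exp 1" using exp_ge_add_one_self[of 1] by simp
    then have "2 * x\<^sup>2 \<le> exp 1 * x\<^sup>2" by (intro mult_right_mono) auto
    moreover have "1 \<le> x\<^sup>2" using x by simp
    ultimately show "1 + x\<^sup>2 \<le> exp 1 * x\<^sup>2" by linarith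
  qed (use x in \<open>auto simp: add_pos_pos\<close>)
  also have "\<dots> = 1 + 2 * ln x" using x by (simp add: ln_mult ln_realpow)
  finally have "ln (1 + x\<^sup>2) / 2 \<le> 1/2 + ln x" by simp
  also have "1/2 \<le> x powr a" using ge_one_powr_ge_zero[of x a] x assms by linarith
  also have "ln x \<le> x powr a / a"
    using abs_ln_le_powr(1)[of "1/x" a] x assms by (simp add: ln_div powr_minus_divide powr_divide)
  finally show ?thesis using assms by (simp add: algebra_simps)
qed

text \<open>The logarithmic kernel with its singularity removed: it decreases to \<open>ln |z - w|\<close> as \<open>s\<close> tends
  to \<open>0\<close>, and it is finite on the diagonal.\<close>
definition smooth_log :: "real \<Rightarrow> complex \<Rightarrow> complex \<Rightarrow> real" where
  "smooth_log s z w = ln ((cmod (z - w))\<^sup>2 + s) / 2"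

lemma smooth_log_measurable [measurable]:
  "(\<lambda>(z, w). smooth_log s z w) \<in> borel_measurable (borel \<Otimes>\<^sub>M borel)"
  unfolding smooth_log_def by measurable

text \<open>The setting for potential theory: a compactly supported probability measure whose negative moments
  of order \<open>a\<close> are bounded uniformly in the base point. Atoms have to be excluded separately,
  because \<open>0 powr (-a) = 0\<close> hides the diagonal from the moment.\<close>
locale log_measure = prob_space \<mu> for \<mu> :: "complex measure" +
  fixes a C R :: real
  assumes sets_mu: "sets \<mu> = sets borel"
    and a: "0 < a" "a \<le> 1"
    and C: "0 \<le> C"
    and R: "1 \<le> R"
    and AE_bound: "AE w in \<mu>. cmod w \<le> R"
    and moment: "\<And>z. (\<integral>\<^sup>+w. ennreal (cmod (z - w) powr (-a)) \<partial>\<mu>) \<le> ennreal C"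
    and no_atom: "\<And>z. measure \<mu> {z} = 0"
begin

declare sets_mu [measurable_cong]

lemma space_mu [simp]: "space \<mu> = UNIV"
  using sets_eq_imp_space_eq[OF sets_mu] by simp

lemma prob_UNIV [simp]: "prob UNIV = 1"
  using prob_space by simp

definition U :: "complex \<Rightarrow> real" where "U z = (\<integral>w. ln (cmod (z - w)) \<partial>\<mu>)"

definition log_energy :: real where "log_energy = (\<integral>z. U z \<partial>\<mu>)"

lemma AE_neq: "AE w in \<mu>. w \<noteq> z"
proof -
  have "emeasure \<mu> {z} = 0" using no_atom[of z] by (simp add: emeasure_eq_measure)
  moreover have "{z} \<in> sets \<mu>" using sets_mu by simp
  ultimately have "{z} \<in> null_sets \<mu>" by (simp add: null_setsI)
  then show ?thesis by (rule AE_I') auto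
qed

lemma AE_finite: "finite A \<Longrightarrow> AE w in \<mu>. w \<notin> A"
proof (induction A rule: finite_induct)
  case (insert x F)
  with AE_neq[of x] show ?case by auto
qed simp

lemma integrable_moment: "integrable \<mu> (\<lambda>w. cmod (z - w) powr (-a))"
  using moment[of z] by (intro integrableI_bounded) (auto intro: le_less_trans)

lemma integral_moment_le: "(\<integral>w. cmod (z - w) powr (-a) \<partial>\<mu>) \<le> C"
proof -
  have "ennreal (\<integral>w. cmod (z - w) powr (-a) \<partial>\<mu>) = (\<integral>\<^sup>+w. ennreal (cmod (z - w) powr (-a)) \<partial>\<mu>)"
    by (intro nn_integral_eq_integral[symmetric] integrable_moment) auto
  with moment[of z] show ?thesis by (metis ennreal_le_iff[OF C])
qed

lemma integrable_ln_dist: "integrable \<mu> (\<lambda>w. ln (cmod (z - w)))"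
proof (rule Bochner_Integration.integrable_bound)
  show "integrable \<mu> (\<lambda>w. cmod (z - w) powr (-a) / a + (cmod z + R))"
    by (intro Bochner_Integration.integrable_add integrable_divide integrable_moment) auto
  show "AE w in \<mu>. norm (ln (cmod (z - w))) \<le> norm (cmod (z - w) powr (-a) / a + (cmod z + R))"
    using AE_neq[of z] AE_bound
  proof eventually_elim
    case (elim w)
    have "\<bar>ln (cmod (z - w))\<bar> \<le> cmod (z - w) powr (-a) / a + cmod (z - w)"
      using elim a by (intro abs_ln_le_powr) auto
    moreover have "cmod (z - w) \<le> cmod z + R" using norm_triangle_ineq4[of z w] elim by linarith
    ultimately show ?case unfolding real_norm_def by linarith
  qed
qed auto

lemma U_ge: "U z \<ge> - C / a"
proof -
  have "- C / a \<le> (\<integral>w. - (cmod (z - w) powr (-a) / a) \<partial>\<mu>)"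
    using integral_moment_le[of z] a by (simp add: divide_right_mono)
  also have "\<dots> \<le> U z" unfolding U_def
  proof (rule integral_mono_AE)
    show "AE w in \<mu>. - (cmod (z - w) powr - a / a) \<le> ln (cmod (z - w))"
      using AE_neq[of z]
    proof eventually_elim
      case (elim w)
      then show ?case using abs_ln_le_powr(1)[of "cmod (z - w)" a] a by simp
    qed
  qed (intro integrable_minus integrable_divide integrable_moment integrable_ln_dist)+
  finally show ?thesis .
qed

lemma U_ge_far:
  assumes "cmod z \<ge> 2 * R"
  shows "U z \<ge> ln (cmod z / 2)"
proof -
  have "ln (cmod z / 2) = (\<integral>w. ln (cmod z / 2) \<partial>\<mu>)" by (simp add: prob_space)
  also have "\<dots> \<le> U z" unfolding U_def
  proof (rule integral_mono_AE)
    show "AE w in \<mu>. ln (cmod z / 2) \<le> ln (cmod (z - w))"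
      using AE_bound
    proof eventually_elim
      case (elim w)
      have "cmod z / 2 \<le> cmod (z - w)" using norm_triangle_ineq2[of z w] assms elim by linarith
      moreover have "0 < cmod z / 2" using assms R by linarith
      ultimately show ?case by (intro ln_mono) auto
    qed
  qed (auto intro: integrable_ln_dist)
  finally show ?thesis .
qed

text \<open>Far from the support \<open>U z\<close> behaves like \<open>ln |z|\<close>, and nearby it is bounded below by \<open>U_ge\<close>. Therefore
  \<open>exp (n U)\<close> dominates a multiple of every polynomial of degree at most \<open>n\<close>. This makes \<open>K_body\<close> a
  neighbourhood of the origin and keeps the weighted products in the choice of Leja points bounded.\<close>
lemma exp_U_ge: obtains c where "c > 0" "\<And>z. exp (U z) \<ge> c * (1 + cmod z)"
proof
  define c where "c = min (1/4) (exp (- C / a) / (1 + 2 * R))"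
  show "c > 0" using R by (simp add: c_def)
  fix z
  show "exp (U z) \<ge> c * (1 + cmod z)"
  proof (cases "cmod z \<ge> 2 * R")
    case True
    have "c * (1 + cmod z) \<le> 1/4 * (1 + cmod z)"
      unfolding c_def by (intro mult_right_mono min.cobounded1) auto
    also have "\<dots> \<le> cmod z / 2" using True R by simp
    also have "\<dots> = exp (ln (cmod z / 2))"
    proof -
      have "cmod z / 2 > 0" using True R by linarith
      then show ?thesis by simp
    qed
    also have "\<dots> \<le> exp (U z)" using U_ge_far[OF True] by simp
    finally show ?thesis .
  next
    case False
    have "c * (1 + cmod z) \<le> (exp (- C / a) / (1 + 2 * R)) * (1 + cmod z)"
      unfolding c_def by (intro mult_right_mono min.cobounded2) auto
    also have "\<dots> \<le> (exp (- C / a) / (1 + 2 * R)) * (1 + 2 * R)"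
      using False R by (intro mult_left_mono) auto
    also have "\<dots> = exp (- C / a)" using R by simp
    also have "\<dots> \<le> exp (U z)" using U_ge[of z] by simp
    finally show ?thesis .
  qed
qed

lemma U_le: "U z \<le> cmod z + R"
proof -
  have "U z \<le> (\<integral>w. cmod z + R \<partial>\<mu>)" unfolding U_def
  proof (rule integral_mono_AE)
    show "AE w in \<mu>. ln (cmod (z - w)) \<le> cmod z + R"
      using AE_neq[of z] AE_bound
    proof eventually_elim
      case (elim w)
      then have "ln (cmod (z - w)) \<le> cmod (z - w)"
        using ln_le_minus_one[of "cmod (z - w)"] by simp
      then show ?case using norm_triangle_ineq4[of z w] elim by linarith
    qed
  qed (auto intro: integrable_ln_dist)
  then show ?thesis by (simp add: prob_space)
qed

lemma U_measurable [measurable]: "U \<in> borel_measurable borel"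
  unfolding U_def[abs_def] by measurable

lemma integrable_U: "integrable \<mu> U"
proof (rule integrable_const_bound)
  show "AE z in \<mu>. norm (U z) \<le> 2 * R + C / a"
    using AE_bound
  proof eventually_elim
    case (elim z)
    then show ?case using U_le[of z] U_ge[of z] C a R
      by (smt (verit) divide_nonneg_pos minus_divide_left real_norm_def)
  qed
qed measurable

lemma smooth_log_ge:
  assumes "s > 0" "z \<noteq> w" shows "ln (cmod (z - w)) \<le> smooth_log s z w"
proof -
  have "ln (cmod (z - w)) = ln ((cmod (z - w))\<^sup>2) / 2" using assms by (simp add: ln_realpow)
  also have "\<dots> \<le> smooth_log s z w"
    unfolding smooth_log_def using assms by (intro divide_right_mono) (auto simp: add_pos_pos)
  finally show ?thesis .
qed

lemma smooth_log_le:
  assumes "s > 0" "z \<noteq> w"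
  shows "smooth_log s z w \<le> ln (cmod (z - w)) + (1 + 1 / a) * s powr (a / 2) * cmod (z - w) powr (-a)"
proof -
  let ?r = "cmod (z - w)"
  have r: "?r > 0" using assms by simp
  have "?r\<^sup>2 + s = ?r\<^sup>2 * (1 + (sqrt s / ?r)\<^sup>2)"
    using assms r by (simp add: field_simps power2_eq_square)
  then have "smooth_log s z w = ln (?r\<^sup>2 * (1 + (sqrt s / ?r)\<^sup>2)) / 2"
    by (simp add: smooth_log_def)
  also have "\<dots> = ln ?r + ln (1 + (sqrt s / ?r)\<^sup>2) / 2"
  proof -
    have "1 + (sqrt s / ?r)\<^sup>2 > 0" by (simp add: add_pos_nonneg)
    then show ?thesis using r by (simp only: ln_mult_pos zero_less_power ln_realpow) simp
  qed
  also have "ln (1 + (sqrt s / ?r)\<^sup>2) / 2 \<le> (1 + 1 / a) * (sqrt s / ?r) powr a"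
    using assms r a by (intro half_ln_one_plus_square_le) auto
  also have "(sqrt s / ?r) powr a = s powr (a / 2) * ?r powr (-a)"
    using assms r by (simp add: powr_divide powr_minus_divide powr_powr flip: powr_half_sqrt)
  finally show ?thesis by (simp add: mult.assoc)
qed

lemma integrable_smooth_log:
  assumes "s > 0" shows "integrable \<mu> (smooth_log s z)"
proof (rule Bochner_Integration.integrable_bound)
  let ?g = "\<lambda>w. \<bar>ln (cmod (z - w))\<bar> + (1 + 1 / a) * s powr (a / 2) * cmod (z - w) powr (-a)"
  show "integrable \<mu> ?g"
    by (intro Bochner_Integration.integrable_add integrable_mult_right integrable_moment
        integrable_abs integrable_ln_dist)
  show "AE w in \<mu>. norm (smooth_log s z w) \<le> norm (?g w)"
    using AE_neq[of z]
  proof eventually_elim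
    case (elim w)
    have "0 \<le> (1 + 1 / a) * s powr (a / 2) * cmod (z - w) powr (-a)" using a by simp
    then show ?case
      using smooth_log_le[OF assms, of z w] smooth_log_ge[OF assms, of z w] elim
      unfolding real_norm_def by fastforce
  qed
qed measurable

lemma integral_smooth_log_le:
  assumes "s > 0"
  shows "(\<integral>w. smooth_log s z w \<partial>\<mu>) \<le> U z + (1 + 1 / a) * s powr (a / 2) * C"
proof -
  have "(\<integral>w. smooth_log s z w \<partial>\<mu>) \<le>
      (\<integral>w. ln (cmod (z - w)) + (1 + 1 / a) * s powr (a / 2) * cmod (z - w) powr (-a) \<partial>\<mu>)"
    using AE_neq[of z]
    by (intro integral_mono_AE Bochner_Integration.integrable_add integrable_mult_right
        integrable_moment integrable_ln_dist integrable_smooth_log assms)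
      (auto elim!: eventually_mono intro!: smooth_log_le assms)
  also have "\<dots> = U z + (1 + 1 / a) * s powr (a / 2) * (\<integral>w. cmod (z - w) powr (-a) \<partial>\<mu>)"
    unfolding U_def
    by (subst Bochner_Integration.integral_add)
      (auto intro!: integrable_mult_right integrable_moment integrable_ln_dist)
  also have "\<dots> \<le> U z + (1 + 1 / a) * s powr (a / 2) * C"
    using a by (intro add_left_mono mult_left_mono integral_moment_le) auto
  finally show ?thesis .
qed

lemma integral_smooth_log_ge:
  assumes "s > 0" shows "U z \<le> (\<integral>w. smooth_log s z w \<partial>\<mu>)"
  unfolding U_def using AE_neq[of z]
  by (intro integral_mono_AE integrable_ln_dist integrable_smooth_log assms)
    (auto elim!: eventually_mono intro!: smooth_log_ge assms)

lemma smooth_log_energy: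
  assumes "s > 0"
  shows "integrable \<mu> (\<lambda>z. \<integral>w. smooth_log s z w \<partial>\<mu>)"
    "log_energy \<le> (\<integral>z. (\<integral>w. smooth_log s z w \<partial>\<mu>) \<partial>\<mu>)"
proof -
  show *: "integrable \<mu> (\<lambda>z. \<integral>w. smooth_log s z w \<partial>\<mu>)"
  proof (rule Bochner_Integration.integrable_bound)
    show "integrable \<mu> (\<lambda>z. \<bar>U z\<bar> + (1 + 1 / a) * s powr (a / 2) * C)"
      by (intro Bochner_Integration.integrable_add integrable_abs integrable_U) auto
    show "AE z in \<mu>. norm (\<integral>w. smooth_log s z w \<partial>\<mu>) \<le> norm (\<bar>U z\<bar> + (1 + 1 / a) * s powr (a / 2) * C)"
    proof (rule AE_I2)
      fix z
      have "0 \<le> (1 + 1 / a) * s powr (a / 2) * C" using a C by simp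
      then show "norm (\<integral>w. smooth_log s z w \<partial>\<mu>) \<le> norm (\<bar>U z\<bar> + (1 + 1 / a) * s powr (a / 2) * C)"
        using integral_smooth_log_le[OF assms, of z] integral_smooth_log_ge[OF assms, of z]
        unfolding real_norm_def by linarith
    qed
  qed measurable
  show "log_energy \<le> (\<integral>z. (\<integral>w. smooth_log s z w \<partial>\<mu>) \<partial>\<mu>)"
    unfolding log_energy_def
    by (intro integral_mono integrable_U * integral_smooth_log_ge assms)
qed

text \<open>With the uniform measure on the unit circle in place of \<open>\<mu>\<close> this would be the logarithmic Mahler
  measure, and \<open>mean_log_factor\<close> below is the analogue of Jensen's formula.\<close>
definition mean_log :: "complex poly \<Rightarrow> real" where
  "mean_log p = (\<integral>w. ln (cmod (poly p w)) \<partial>\<mu>)"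

lemma AE_poly_nonzero: "p \<noteq> 0 \<Longrightarrow> AE w in \<mu>. poly p w \<noteq> 0"
  using AE_finite[OF poly_roots_finite[of p]] by simp

lemma poly_measurable [measurable]: "poly p \<in> borel_measurable (borel :: complex measure)"
  by (intro borel_measurable_continuous_onI continuous_intros)

lemma integrable_ln_prod_linear:
  assumes "c \<noteq> 0"
  shows "integrable \<mu> (\<lambda>w. ln (cmod (poly (smult c (\<Prod>\<zeta>\<leftarrow>zs. [:-\<zeta>, 1:])) w))) \<and>
    mean_log (smult c (\<Prod>\<zeta>\<leftarrow>zs. [:-\<zeta>, 1:])) = ln (cmod c) + (\<Sum>\<zeta>\<leftarrow>zs. U \<zeta>)"
proof (induction zs)
  case Nil
  then show ?case by (simp add: mean_log_def prob_space)
next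
  case (Cons \<zeta> zs)
  let ?q = "smult c (\<Prod>\<zeta>\<leftarrow>zs. [:-\<zeta>, 1:])"
  let ?p = "smult c (\<Prod>\<zeta>\<leftarrow>\<zeta> # zs. [:-\<zeta>, 1:])"
  have pq: "?p = [:-\<zeta>, 1:] * ?q" by simp
  have q0: "?q \<noteq> 0" using assms by (auto simp: prod_list_zero_iff)
  have eq: "AE w in \<mu>. ln (cmod (poly ?p w)) = ln (cmod (\<zeta> - w)) + ln (cmod (poly ?q w))"
    using AE_neq[of \<zeta>] AE_poly_nonzero[OF q0]
  proof eventually_elim
    case (elim w)
    have "cmod (poly ?p w) = cmod (\<zeta> - w) * cmod (poly ?q w)"
      by (simp only: pq poly_mult norm_mult) (simp add: norm_minus_commute)
    then show ?case using elim by (simp add: ln_mult)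
  qed
  have int: "integrable \<mu> (\<lambda>w. ln (cmod (\<zeta> - w)) + ln (cmod (poly ?q w)))"
    by (intro Bochner_Integration.integrable_add integrable_ln_dist conjunct1[OF Cons.IH])
  have "integrable \<mu> (\<lambda>w. ln (cmod (poly ?p w)))"
    using eq int by (subst integrable_cong_AE[OF _ _ eq]) measurable
  moreover have "mean_log ?p = U \<zeta> + mean_log ?q"
    unfolding mean_log_def U_def
    using eq Cons.IH by (subst integral_cong_AE[OF _ _ eq])
      (auto intro!: Bochner_Integration.integral_add integrable_ln_dist)
  ultimately show ?case using Cons.IH by simp
qed

end

lemma complex_poly_factor_list:
  fixes p :: "complex poly"
  obtains zs where "length zs = degree p" "p = smult (lead_coeff p) (\<Prod>\<zeta>\<leftarrow>zs. [:-\<zeta>, 1:])"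
proof (cases "p = 0")
  case False
  obtain A where A: "size A = degree p" "p = smult (lead_coeff p) (\<Prod>x\<in>#A. [:-x, 1:])"
    using alg_closed_imp_factorization[OF False] by metis
  obtain zs where zs: "mset zs = A" using ex_mset by blast
  have "(\<Prod>x\<in>#A. [:-x, 1:]) = (\<Prod>\<zeta>\<leftarrow>zs. [:-\<zeta>, 1:])"
    unfolding zs[symmetric] by (simp flip: prod_mset_prod_list)
  with A zs that[of zs] show ?thesis by (metis size_mset)
qed (use that[of "[]"] in auto)

context log_measure begin

lemma integrable_ln_poly: "p \<noteq> 0 \<Longrightarrow> integrable \<mu> (\<lambda>w. ln (cmod (poly p w)))"
  by (metis complex_poly_factor_list integrable_ln_prod_linear leading_coeff_0_iff)

lemma mean_log_factor:
  assumes "p = smult c (\<Prod>\<zeta>\<leftarrow>zs. [:-\<zeta>, 1:])" "c \<noteq> 0"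
  shows "mean_log p = ln (cmod c) + (\<Sum>\<zeta>\<leftarrow>zs. U \<zeta>)"
  using integrable_ln_prod_linear assms by blast

lemma mean_log_mult:
  assumes "p \<noteq> 0" "q \<noteq> 0"
  shows "mean_log (p * q) = mean_log p + mean_log q"
proof -
  have "mean_log (p * q) = (\<integral>w. ln (cmod (poly p w)) + ln (cmod (poly q w)) \<partial>\<mu>)"
    unfolding mean_log_def using AE_poly_nonzero[OF assms(1)] AE_poly_nonzero[OF assms(2)]
    by (intro integral_cong_AE) (auto simp: norm_mult ln_mult)
  then show ?thesis
    unfolding mean_log_def using assms by (simp add: integrable_ln_poly)
qed

text \<open>The potential is bounded below on the whole plane, so the bound involves the leading coefficient but
  not the location of the roots. For a polynomial whose coefficients depend on further variables this
  reduces integrability of the mean to that of the leading coefficient.\<close>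
lemma mean_log_ge:
  assumes "p \<noteq> 0"
  shows "mean_log p \<ge> ln (cmod (lead_coeff p)) - real (degree p) * (C / a)"
proof -
  obtain zs where zs: "length zs = degree p" "p = smult (lead_coeff p) (\<Prod>\<zeta>\<leftarrow>zs. [:-\<zeta>, 1:])"
    by (rule complex_poly_factor_list)
  have "- real (length zs) * (C / a) \<le> (\<Sum>\<zeta>\<leftarrow>zs. U \<zeta>)"
  proof (induction zs)
    case (Cons z zs)
    then show ?case using U_ge[of z] by (simp add: algebra_simps)
  qed simp
  then show ?thesis using mean_log_factor[OF zs(2)] assms zs(1) by simp
qed

end

section \<open>Negative definiteness of the logarithmic kernel\<close>

text \<open>The Gram kernel of the map given by \<open>sphere_coord\<close>, which up to an affine change of coordinates is
  inverse stereographic projection from the plane to a sphere in three-space.\<close>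
definition sphere_kernel :: "real \<Rightarrow> complex \<Rightarrow> complex \<Rightarrow> real" where
  "sphere_kernel s z w =
     ((cmod z)\<^sup>2 * (cmod w)\<^sup>2 + 2 * s * Re (z * cnj w)) / (((cmod z)\<^sup>2 + s) * ((cmod w)\<^sup>2 + s))"

definition sphere_coord :: "real \<Rightarrow> nat \<Rightarrow> complex \<Rightarrow> real" where
  "sphere_coord s t z =
     (if t = 0 then (cmod z)\<^sup>2 else if t = 1 then sqrt (2 * s) * Re z else sqrt (2 * s) * Im z)
     / ((cmod z)\<^sup>2 + s)"

lemma sphere_kernel_eq_sum:
  assumes "s > 0"
  shows "sphere_kernel s z w = (\<Sum>t<3. sphere_coord s t z * sphere_coord s t w)"
proof -
  have "sqrt (2 * s) * sqrt (2 * s) = 2 * s" using assms by simp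
  then have *: "sqrt (2 * s) * x * (sqrt (2 * s) * y) = 2 * s * (x * y)" for x y
    by (metis (no_types, lifting) mult.assoc mult.left_commute)
  show ?thesis
    by (simp add: sphere_kernel_def sphere_coord_def numeral_3_eq_3 * add_divide_distrib[symmetric]
        distrib_left)
qed

text \<open>The smoothed squared distance differs from the right-hand side by a factor that is a product of a
  function of \<open>z\<close> and a function of \<open>w\<close>. After taking logarithms this factor becomes a sum of
  functions of one variable, which a neutral charge does not see.\<close>
lemma one_minus_sphere_kernel:
  assumes "s > 0"
  shows "1 - sphere_kernel s z w = s * ((cmod (z - w))\<^sup>2 + s) / (((cmod z)\<^sup>2 + s) * ((cmod w)\<^sup>2 + s))"
proof -
  have "(cmod z)\<^sup>2 + s > 0" "(cmod w)\<^sup>2 + s > 0" using assms by (auto simp: add_nonneg_pos)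
  then have "1 - sphere_kernel s z w = (((cmod z)\<^sup>2 + s) * ((cmod w)\<^sup>2 + s)
      - ((cmod z)\<^sup>2 * (cmod w)\<^sup>2 + 2 * s * Re (z * cnj w))) / (((cmod z)\<^sup>2 + s) * ((cmod w)\<^sup>2 + s))"
    unfolding sphere_kernel_def by (simp add: diff_divide_distrib)
  also have "((cmod z)\<^sup>2 + s) * ((cmod w)\<^sup>2 + s) - ((cmod z)\<^sup>2 * (cmod w)\<^sup>2 + 2 * s * Re (z * cnj w))
      = s * ((cmod (z - w))\<^sup>2 + s)"
    unfolding cmod_power2 by (simp add: algebra_simps power2_eq_square)
  finally show ?thesis .
qed

lemma abs_sphere_kernel_less:
  assumes "s > 0"
  shows "\<bar>sphere_kernel s z w\<bar> < 1"
proof -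
  have pos: "(cmod z)\<^sup>2 + s > 0" "(cmod w)\<^sup>2 + s > 0" "(cmod (z - w))\<^sup>2 + s > 0"
    using assms by (auto simp: add_nonneg_pos)
  have "1 - sphere_kernel s z w > 0"
    unfolding one_minus_sphere_kernel[OF assms] using pos assms by simp
  moreover have "1 + sphere_kernel s z w > 0"
  proof -
    have "1 + sphere_kernel s z w = (((cmod z)\<^sup>2 + s) * ((cmod w)\<^sup>2 + s)
        + ((cmod z)\<^sup>2 * (cmod w)\<^sup>2 + 2 * s * Re (z * cnj w))) / (((cmod z)\<^sup>2 + s) * ((cmod w)\<^sup>2 + s))"
      unfolding sphere_kernel_def using pos by (simp add: add_divide_distrib)
    also have "((cmod z)\<^sup>2 + s) * ((cmod w)\<^sup>2 + s) + ((cmod z)\<^sup>2 * (cmod w)\<^sup>2 + 2 * s * Re (z * cnj w))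
        = 2 * ((cmod z)\<^sup>2 * (cmod w)\<^sup>2) + s * (cmod (z + w))\<^sup>2 + s\<^sup>2"
      unfolding cmod_power2 by (simp add: algebra_simps power2_eq_square)
    also have "\<dots> / (((cmod z)\<^sup>2 + s) * ((cmod w)\<^sup>2 + s)) > 0"
      using pos assms by (intro divide_pos_pos add_nonneg_pos mult_pos_pos) auto
    finally show ?thesis .
  qed
  ultimately show ?thesis by linarith
qed

text \<open>The quadratic form of the kernel \<open>F\<close> evaluated on the neutral charge with mass \<open>1\<close> at each \<open>z i\<close> and
  mass \<open>-1\<close> at each \<open>w i\<close>.\<close>
definition cross_sum :: "(nat \<Rightarrow> 'a) \<Rightarrow> (nat \<Rightarrow> 'a) \<Rightarrow> nat \<Rightarrow> ('a \<Rightarrow> 'a \<Rightarrow> real) \<Rightarrow> real" where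
  "cross_sum z w N F = (\<Sum>i<N. \<Sum>j<N. F (z i) (z j) - F (z i) (w j) - F (w i) (z j) + F (w i) (w j))"

lemma cross_sum_add: "cross_sum z w N (\<lambda>u v. F u v + G u v) = cross_sum z w N F + cross_sum z w N G"
  unfolding cross_sum_def sum.distrib[symmetric] by (intro sum.cong refl) simp

lemma cross_sum_sum:
  "finite T \<Longrightarrow> cross_sum z w N (\<lambda>u v. \<Sum>t\<in>T. F t u v) = (\<Sum>t\<in>T. cross_sum z w N (F t))"
proof (induction T rule: finite_induct)
  case empty
  then show ?case by (simp add: cross_sum_def)
next
  case (insert x T)
  then show ?case using cross_sum_add[of z w N "F x" "\<lambda>u v. \<Sum>t\<in>T. F t u v"] by simp
qed

lemma cross_sum_cmult: "cross_sum z w N (\<lambda>u v. c * F u v) = c * cross_sum z w N F"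
  unfolding cross_sum_def sum_distrib_left by (intro sum.cong refl) (simp add: algebra_simps)

lemma cross_sum_separable: "cross_sum z w N (\<lambda>u v. h u + h v + c) = 0"
  unfolding cross_sum_def by (intro sum.neutral ballI) simp

lemma cross_sum_sums:
  assumes "\<And>u v. (\<lambda>k. F k u v) sums G u v"
  shows "(\<lambda>k. cross_sum z w N (F k)) sums cross_sum z w N G"
  unfolding cross_sum_def by (intro sums_sum sums_add sums_diff assms)

text \<open>Powers of a positive semidefinite kernel are positive semidefinite (Schur). Since the kernel is a
  Gram kernel in three coordinates, one factor can be expanded and its coordinates absorbed into the
  weight \<open>g\<close>; this is why the weight is part of the statement.\<close>
lemma cross_sum_power_nonneg:
  assumes "s > 0"
  shows "cross_sum z w N (\<lambda>u v. g u * g v * sphere_kernel s u v ^ k) \<ge> 0"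
proof (induction k arbitrary: g)
  case 0
  have "cross_sum z w N (\<lambda>u v. g u * g v * sphere_kernel s u v ^ 0) = (\<Sum>i<N. g (z i) - g (w i))\<^sup>2"
    unfolding cross_sum_def power2_eq_square sum_product
    by (intro sum.cong refl) (simp add: algebra_simps)
  then show ?case by simp
next
  case (Suc k)
  have "g u * g v * sphere_kernel s u v ^ Suc k =
      (\<Sum>t<3. (g u * sphere_coord s t u) * (g v * sphere_coord s t v) * sphere_kernel s u v ^ k)" for u v
  proof -
    have "g u * g v * sphere_kernel s u v ^ Suc k
        = (\<Sum>t<3. sphere_coord s t u * sphere_coord s t v) * (g u * g v * sphere_kernel s u v ^ k)"
      by (simp add: sphere_kernel_eq_sum[OF assms, symmetric])
    then show ?thesis
      unfolding sum_distrib_right by (simp only: mult_ac)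
  qed
  then have "cross_sum z w N (\<lambda>u v. g u * g v * sphere_kernel s u v ^ Suc k) =
      (\<Sum>t<3. cross_sum z w N (\<lambda>u v. (g u * sphere_coord s t u) * (g v * sphere_coord s t v) * sphere_kernel s u v ^ k))"
    by (subst cross_sum_sum[symmetric]) auto
  also have "\<dots> \<ge> 0" by (intro sum_nonneg Suc.IH)
  finally show ?case .
qed

text \<open>Expand \<open>ln (1 - B) = - \<Sum> B^k / k\<close> for the sphere kernel \<open>B\<close>: every term contributes a nonpositive
  amount, and the difference between \<open>smooth_log\<close> and \<open>ln (1 - B) / 2\<close> cancels.\<close>
lemma cross_sum_smooth_log_nonpos:
  assumes "s > 0"
  shows "cross_sum z w N (smooth_log s) \<le> 0"
proof -
  let ?h = "\<lambda>u. ln ((cmod u)\<^sup>2 + s) / 2"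
  have eq: "smooth_log s u v = (?h u + ?h v + - ln s / 2) + 1 / 2 * ln (1 - sphere_kernel s u v)" for u v
  proof -
    have "(cmod u)\<^sup>2 + s > 0" "(cmod v)\<^sup>2 + s > 0" "(cmod (u - v))\<^sup>2 + s > 0"
      using assms by (auto simp: add_nonneg_pos)
    then have "ln (1 - sphere_kernel s u v) = ln s + ln ((cmod (u - v))\<^sup>2 + s)
        - (ln ((cmod u)\<^sup>2 + s) + ln ((cmod v)\<^sup>2 + s))"
      using assms by (simp add: one_minus_sphere_kernel ln_div ln_mult_pos)
    then show ?thesis unfolding smooth_log_def by linarith
  qed
  have S: "(\<lambda>k. cross_sum z w N (\<lambda>u v. - (1 / real k) * sphere_kernel s u v ^ k))
      sums cross_sum z w N (\<lambda>u v. ln (1 - sphere_kernel s u v))"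
  proof (rule cross_sum_sums)
    fix u v
    have "(\<lambda>k. - ((- (- sphere_kernel s u v)) ^ k) / of_nat k) sums ln (1 + - sphere_kernel s u v)"
      using abs_sphere_kernel_less[OF assms, of u v] by (intro ln_series') auto
    then show "(\<lambda>k. - (1 / real k) * sphere_kernel s u v ^ k) sums ln (1 - sphere_kernel s u v)"
      by simp
  qed
  have T: "cross_sum z w N (\<lambda>u v. - (1 / real k) * sphere_kernel s u v ^ k) \<le> 0" for k
  proof -
    have "0 \<le> 1 / real k * cross_sum z w N (\<lambda>u v. 1 * 1 * sphere_kernel s u v ^ k)"
      by (intro mult_nonneg_nonneg cross_sum_power_nonneg assms) auto
    then show ?thesis unfolding cross_sum_cmult by simp
  qed
  have "cross_sum z w N (\<lambda>u v. ln (1 - sphere_kernel s u v)) \<le> 0"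
    by (rule sums_le[OF T S sums_zero])
  moreover have "smooth_log s = (\<lambda>u v. (?h u + ?h v + - ln s / 2) + 1 / 2 * ln (1 - sphere_kernel s u v))"
    by (intro ext eq)
  then have "cross_sum z w N (smooth_log s) = cross_sum z w N (\<lambda>u v. ?h u + ?h v + - ln s / 2)
      + cross_sum z w N (\<lambda>u v. 1 / 2 * ln (1 - sphere_kernel s u v))"
    by (simp only: cross_sum_add)
  ultimately show ?thesis
    using cross_sum_separable[of z w N ?h "- ln s / 2"]
      cross_sum_cmult[of z w N "1 / 2" "\<lambda>u v. ln (1 - sphere_kernel s u v)"] by linarith
qed

context log_measure
begin

lemma product_prob_space_mu: "product_prob_space (\<lambda>_::nat. \<mu>)"
  by unfold_locales

abbreviation PM :: "nat \<Rightarrow> (nat \<Rightarrow> complex) measure" where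
  "PM n \<equiv> PiM {..<n} (\<lambda>_. \<mu>)"

lemma distr_PM_component: "i < n \<Longrightarrow> distr (PM n) \<mu> (\<lambda>x. x i) = \<mu>"
  by (rule distr_PiM_component) (auto intro: prob_space_axioms)

lemma integral_PM_component:
  fixes f :: "complex \<Rightarrow> real"
  assumes "i < n" "integrable \<mu> f"
  shows "integrable (PM n) (\<lambda>x. f (x i))" "(\<integral>x. f (x i) \<partial>PM n) = (\<integral>w. f w \<partial>\<mu>)"
proof -
  have m: "(\<lambda>x. x i) \<in> measurable (PM n) \<mu>" using assms by simp
  have f: "f \<in> borel_measurable \<mu>" using assms by simp
  show "integrable (PM n) (\<lambda>x. f (x i))"
    using integrable_distr_eq[OF m f] assms distr_PM_component by simp
  show "(\<integral>x. f (x i) \<partial>PM n) = (\<integral>w. f w \<partial>\<mu>)"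
    using integral_distr[OF m f] assms distr_PM_component by simp
qed

lemma distr_PM_pair:
  assumes "i < n" "j < n" "i \<noteq> j"
  shows "distr (PM n) (\<mu> \<Otimes>\<^sub>M \<mu>) (\<lambda>x. (x i, x j)) = \<mu> \<Otimes>\<^sub>M \<mu>"
proof (rule pair_measure_eqI[symmetric])
  have m: "(\<lambda>x. (x i, x j)) \<in> measurable (PM n) (\<mu> \<Otimes>\<^sub>M \<mu>)" using assms by simp
  fix A B assume AB: "A \<in> sets \<mu>" "B \<in> sets \<mu>"
  let ?X = "\<lambda>k. if k = i then A else B"
  have "emeasure (distr (PM n) (\<mu> \<Otimes>\<^sub>M \<mu>) (\<lambda>x. (x i, x j))) (A \<times> B)
      = emeasure (PM n) {x\<in>space (PM n). \<forall>k\<in>{i, j}. x k \<in> ?X k}"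
    using m AB assms by (subst emeasure_distr) (auto intro!: arg_cong[where f = "emeasure (PM n)"])
  also have "\<dots> = (\<Prod>k\<in>{i, j}. emeasure \<mu> (?X k))"
    using AB assms
    by (intro product_prob_space.emeasure_PiM_Collect[OF product_prob_space_mu]) auto
  also have "\<dots> = emeasure \<mu> A * emeasure \<mu> B" using assms by simp
  finally show "emeasure \<mu> A * emeasure \<mu> B
      = emeasure (distr (PM n) (\<mu> \<Otimes>\<^sub>M \<mu>) (\<lambda>x. (x i, x j))) (A \<times> B)" ..
qed (auto intro: sigma_finite_measure_axioms)

lemma integral_PM_pair:
  fixes f :: "complex \<Rightarrow> complex \<Rightarrow> real"
  assumes "i < n" "j < n" "i \<noteq> j" and int: "integrable (\<mu> \<Otimes>\<^sub>M \<mu>) (\<lambda>(z, w). f z w)"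
  shows "integrable (PM n) (\<lambda>x. f (x i) (x j))"
    "(\<integral>x. f (x i) (x j) \<partial>PM n) = (\<integral>z. (\<integral>w. f z w \<partial>\<mu>) \<partial>\<mu>)"
proof -
  interpret P: pair_sigma_finite \<mu> \<mu> by unfold_locales
  have m: "(\<lambda>x. (x i, x j)) \<in> measurable (PM n) (\<mu> \<Otimes>\<^sub>M \<mu>)" using assms by simp
  have f: "(\<lambda>(z, w). f z w) \<in> borel_measurable (\<mu> \<Otimes>\<^sub>M \<mu>)" using int by simp
  show "integrable (PM n) (\<lambda>x. f (x i) (x j))"
    using integrable_distr_eq[OF m f] int distr_PM_pair[OF assms(1-3)] by simp
  have "(\<integral>x. f (x i) (x j) \<partial>PM n) = (\<integral>p. (case p of (z, w) \<Rightarrow> f z w) \<partial>(\<mu> \<Otimes>\<^sub>M \<mu>))"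
    using integral_distr[OF m f] distr_PM_pair[OF assms(1-3)] by simp
  also have "\<dots> = (\<integral>z. (\<integral>w. f z w \<partial>\<mu>) \<partial>\<mu>)" using P.integral_fst'[OF int] by simp
  finally show "(\<integral>x. f (x i) (x j) \<partial>PM n) = (\<integral>z. (\<integral>w. f z w \<partial>\<mu>) \<partial>\<mu>)" .
qed

text \<open>The integrals over \<open>w\<close> need to be controlled for \<open>z\<close> in the disc of radius \<open>R\<close> only, since \<open>\<mu>\<close> gives
  no mass to its complement.\<close>
lemma integrable_pair_bound:
  fixes f :: "complex \<Rightarrow> complex \<Rightarrow> real"
  assumes meas [measurable]: "(\<lambda>(z, w). f z w) \<in> borel_measurable (borel \<Otimes>\<^sub>M borel)"
    and int: "\<And>z. integrable \<mu> (f z)"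
    and bd: "\<And>z. cmod z \<le> R \<Longrightarrow> (\<integral>w. \<bar>f z w\<bar> \<partial>\<mu>) \<le> K"
  shows "integrable (\<mu> \<Otimes>\<^sub>M \<mu>) (\<lambda>(z, w). f z w)"
proof -
  interpret P: pair_sigma_finite \<mu> \<mu> by unfold_locales
  have m [measurable]: "(\<lambda>(z, w). f z w) \<in> borel_measurable (\<mu> \<Otimes>\<^sub>M \<mu>)"
    using meas measurable_cong_sets[OF sets_pair_measure_cong[OF sets_mu sets_mu] refl] by blast
  have m2: "(\<lambda>z. \<integral>w. \<bar>f z w\<bar> \<partial>\<mu>) \<in> borel_measurable \<mu>" by measurable
  show ?thesis
  proof (rule P.Fubini_integrable)
    show "integrable \<mu> (\<lambda>x. \<integral>y. norm (case (x, y) of (z, w) \<Rightarrow> f z w) \<partial>\<mu>)"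
      using AE_bound m2
      by (intro integrable_const_bound[where B = K]) (auto elim!: eventually_mono intro: bd)
    show "AE x in \<mu>. integrable \<mu> (\<lambda>y. case (x, y) of (z, w) \<Rightarrow> f z w)" using int by simp
  qed (rule m)
qed

lemma integral_abs_ln_le:
  assumes "cmod z \<le> R"
  shows "(\<integral>w. \<bar>ln (cmod (z - w))\<bar> \<partial>\<mu>) \<le> C / a + 2 * R"
proof -
  have "(\<integral>w. \<bar>ln (cmod (z - w))\<bar> \<partial>\<mu>) \<le> (\<integral>w. cmod (z - w) powr (-a) / a + 2 * R \<partial>\<mu>)"
  proof (rule integral_mono_AE)
    show "AE w in \<mu>. \<bar>ln (cmod (z - w))\<bar> \<le> cmod (z - w) powr (-a) / a + 2 * R"
      using AE_neq[of z] AE_bound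
    proof eventually_elim
      case (elim w)
      have "\<bar>ln (cmod (z - w))\<bar> \<le> cmod (z - w) powr (-a) / a + cmod (z - w)"
        using elim a by (intro abs_ln_le_powr) auto
      moreover have "cmod (z - w) \<le> 2 * R" using norm_triangle_ineq4[of z w] elim assms by linarith
      ultimately show ?case by linarith
    qed
  qed (auto intro!: integrable_abs integrable_ln_dist integrable_divide integrable_moment)
  also have "\<dots> = (\<integral>w. cmod (z - w) powr (-a) \<partial>\<mu>) / a + 2 * R"
    by (subst Bochner_Integration.integral_add) (auto intro!: integrable_divide integrable_moment)
  also have "\<dots> \<le> C / a + 2 * R" using integral_moment_le[of z] a by (simp add: divide_right_mono)
  finally show ?thesis .
qed

lemma integrable_pair_ln: "integrable (\<mu> \<Otimes>\<^sub>M \<mu>) (\<lambda>(z, w). ln (cmod (z - w)))"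
  by (rule integrable_pair_bound[where K = "C / a + 2 * R"])
    (use integral_abs_ln_le integrable_ln_dist in auto)

lemma integrable_pair_smooth_log:
  assumes "s > 0"
  shows "integrable (\<mu> \<Otimes>\<^sub>M \<mu>) (\<lambda>(z, w). smooth_log s z w)"
proof (rule integrable_pair_bound[where K = "C / a + 2 * R + (1 + 1 / a) * s powr (a / 2) * C"])
  fix z assume z: "cmod z \<le> R"
  have "(\<integral>w. \<bar>smooth_log s z w\<bar> \<partial>\<mu>) \<le>
      (\<integral>w. \<bar>ln (cmod (z - w))\<bar> + (1 + 1 / a) * s powr (a / 2) * cmod (z - w) powr (-a) \<partial>\<mu>)"
  proof (rule integral_mono_AE)
    show "AE w in \<mu>. \<bar>smooth_log s z w\<bar>
        \<le> \<bar>ln (cmod (z - w))\<bar> + (1 + 1 / a) * s powr (a / 2) * cmod (z - w) powr (-a)"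
      using AE_neq[of z]
    proof eventually_elim
      case (elim w)
      have "0 \<le> (1 + 1 / a) * s powr (a / 2) * cmod (z - w) powr (-a)" using a by simp
      then show ?case
        using smooth_log_le[OF assms, of z w] smooth_log_ge[OF assms, of z w] elim by fastforce
    qed
  qed (intro integrable_abs integrable_smooth_log assms Bochner_Integration.integrable_add
      integrable_mult_right integrable_moment integrable_ln_dist)+
  also have "\<dots> = (\<integral>w. \<bar>ln (cmod (z - w))\<bar> \<partial>\<mu>)
      + (1 + 1 / a) * s powr (a / 2) * (\<integral>w. cmod (z - w) powr (-a) \<partial>\<mu>)"
    by (subst Bochner_Integration.integral_add)
      (auto intro!: integrable_mult_right integrable_moment integrable_ln_dist integrable_abs)
  also have "\<dots> \<le> C / a + 2 * R + (1 + 1 / a) * s powr (a / 2) * C"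
    using a by (intro add_mono mult_left_mono integral_moment_le integral_abs_ln_le z) auto
  finally show "(\<integral>w. \<bar>smooth_log s z w\<bar> \<partial>\<mu>) \<le> C / a + 2 * R + (1 + 1 / a) * s powr (a / 2) * C" .
qed (use integrable_smooth_log[OF assms] in auto)

text \<open>Average the inequality for the points \<open>z i\<close> and \<open>w i\<close> over independent \<open>w i\<close> with law \<open>\<mu>\<close>. The \<open>N\<close>
  diagonal pairs of the \<open>w i\<close> contribute \<open>ln s / 2\<close> each, and the other pairs the smoothed energy.\<close>
lemma sum_smooth_log_le:
  assumes s: "s > 0"
  shows "(\<Sum>i<N. \<Sum>j<N. smooth_log s (z i) (z j))
    \<le> 2 * real N * (\<Sum>i<N. \<integral>w. smooth_log s (z i) w \<partial>\<mu>)
      - real N * (real N - 1) * (\<integral>u. (\<integral>v. smooth_log s u v \<partial>\<mu>) \<partial>\<mu>) - real N * (ln s / 2)"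
proof -
  let ?L = "smooth_log s" and ?J = "\<integral>u. (\<integral>v. smooth_log s u v \<partial>\<mu>) \<partial>\<mu>"
  interpret PN: prob_space "PM N" by (rule prob_space_PiM) (rule prob_space_axioms)
  have sym: "?L u v = ?L v u" for u v by (simp add: smooth_log_def norm_minus_commute)
  have diag: "?L u u = ln s / 2" for u by (simp add: smooth_log_def)
  have A: "integrable (PM N) (\<lambda>x. ?L (z i) (x j))" "(\<integral>x. ?L (z i) (x j) \<partial>PM N) = (\<integral>w. ?L (z i) w \<partial>\<mu>)"
    if "j < N" for i j
    using integral_PM_component[OF that integrable_smooth_log[OF s]] by auto
  have B: "integrable (PM N) (\<lambda>x. ?L (x i) (x j)) \<and>
      (\<integral>x. ?L (x i) (x j) \<partial>PM N) = (if i = j then ln s / 2 else ?J)" if "i < N" "j < N" for i j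
    using integral_PM_pair[OF that _ integrable_pair_smooth_log[OF s]]
    by (cases "i = j") (auto simp: diag PN.prob_space)
  have "0 \<le> (\<integral>x. - cross_sum z x N ?L \<partial>PM N)"
    using cross_sum_smooth_log_nonpos[OF s] by (intro Bochner_Integration.integral_nonneg) auto
  then have "0 \<ge> (\<integral>x. cross_sum z x N ?L \<partial>PM N)" by simp
  also have "(\<integral>x. cross_sum z x N ?L \<partial>PM N) = (\<Sum>i<N. \<Sum>j<N. ?L (z i) (z j)
      - (\<integral>w. ?L (z i) w \<partial>\<mu>) - (\<integral>w. ?L (z j) w \<partial>\<mu>) + (if i = j then ln s / 2 else ?J))"
  proof -
    have *: "integrable (PM N) (\<lambda>x. ?L (z i) (z j) - ?L (z i) (x j) - ?L (x i) (z j) + ?L (x i) (x j)) \<and>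
      (\<integral>x. ?L (z i) (z j) - ?L (z i) (x j) - ?L (x i) (z j) + ?L (x i) (x j) \<partial>PM N) =
       ?L (z i) (z j) - (\<integral>w. ?L (z i) w \<partial>\<mu>) - (\<integral>w. ?L (z j) w \<partial>\<mu>) + (if i = j then ln s / 2 else ?J)"
      if "i < N" "j < N" for i j
      unfolding sym[of _ "z j"] using A(1)[OF that(2), of i] A(1)[OF that(1), of j] B[OF that]
        A(2)[OF that(2), of i] A(2)[OF that(1), of j]
      by (auto simp: PN.prob_space simp del: split_paired_All)
    have int: "integrable (PM N) (\<lambda>x. \<Sum>j<N. ?L (z i) (z j) - ?L (z i) (x j) - ?L (x i) (z j) + ?L (x i) (x j))"
      if "i < N" for i using * that by (intro Bochner_Integration.integrable_sum) auto
    show ?thesis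
      unfolding cross_sum_def using int *
      by (subst Bochner_Integration.integral_sum, force)
        (auto intro!: sum.cong simp: Bochner_Integration.integral_sum)
  qed
  also have "\<dots> = (\<Sum>i<N. \<Sum>j<N. ?L (z i) (z j)) - 2 * real N * (\<Sum>i<N. \<integral>w. ?L (z i) w \<partial>\<mu>)
      + (\<Sum>i<N. \<Sum>j<N. if i = j then ln s / 2 else ?J)"
    by (simp add: sum.distrib sum_subtractf sum_distrib_left[symmetric])
  also have "(\<Sum>i<N. \<Sum>j<N. if i = j then ln s / 2 else ?J) = real N * (ln s / 2) + real N * (real N - 1) * ?J"
  proof -
    have "(\<Sum>j<N. if i = j then ln s / 2 else ?J) = ln s / 2 + (real N - 1) * ?J" if "i < N" for i
    proof -
      have "(\<Sum>j<N. if i = j then ln s / 2 else ?J) = ln s / 2 + (\<Sum>j\<in>{..<N} - {i}. ?J)"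
        using that by (subst sum.remove[of _ i]) (auto intro!: sum.cong)
      then show ?thesis using that by (simp add: of_nat_diff)
    qed
    then have "(\<Sum>i<N. \<Sum>j<N. if i = j then ln s / 2 else ?J) = (\<Sum>i<N. ln s / 2 + (real N - 1) * ?J)"
      by (intro sum.cong) auto
    then show ?thesis by (simp add: algebra_simps)
  qed
  finally show ?thesis by linarith
qed

text \<open>Among all configurations of \<open>N\<close> points, the Vandermonde product weighted by \<open>exp (- N U)\<close> at each
  point is asymptotically no larger than for points distributed like \<open>\<mu>\<close>. Replacing the kernel by
  \<open>smooth_log s\<close> costs \<open>O(N\<^sup>2 s powr (a/2))\<close>, and the diagonal terms then cost \<open>O(N |ln s|)\<close>, so one fixes
  \<open>s\<close> first and takes \<open>N\<close> large afterwards. The bound is uniform over all configurations in the plane.\<close>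
lemma vandermonde_energy_bound:
  assumes "\<epsilon> > 0"
  obtains N0 where "\<And>N z. N \<ge> N0 \<Longrightarrow> inj_on z {..<N} \<Longrightarrow>
    (\<Sum>j<N. \<Sum>i<j. ln (cmod (z j - z i))) \<le> real N * (\<Sum>i<N. U (z i)) - (real N)\<^sup>2 * log_energy / 2 + \<epsilon> * (real N)\<^sup>2"
proof -
  (* s makes the smoothing error at most eps / 4 for each pair *)
  define D where "D = (1 + 1 / a) * C"
  have D: "D \<ge> 0" using a C by (simp add: D_def)
  define s where "s = (\<epsilon> / (4 * (D + 1))) powr (2 / a)"
  have s: "s > 0" using assms D by (simp add: s_def)
  have sD: "s powr (a / 2) * D \<le> \<epsilon> / 4"
  proof -
    have "s powr (a / 2) * D = \<epsilon> / 4 * (D / (D + 1))"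
      using assms D a by (simp add: s_def powr_powr field_simps)
    also have "\<dots> \<le> \<epsilon> / 4 * 1" using D assms by (intro mult_left_mono) auto
    finally show ?thesis by simp
  qed
  obtain N0 :: nat where N0: "real N0 \<ge> (\<bar>log_energy\<bar> + 2 * \<bar>ln s\<bar>) / \<epsilon>" using real_arch_simple by blast
  show thesis
  proof (rule that)
    fix N and z :: "nat \<Rightarrow> complex" assume N: "N \<ge> N0" and inj: "inj_on z {..<N}"
    let ?L = "smooth_log s"
    have "2 * (\<Sum>j<N. \<Sum>i<j. ln (cmod (z j - z i))) \<le> 2 * (\<Sum>j<N. \<Sum>i<j. ?L (z j) (z i))"
    proof (intro mult_left_mono sum_mono smooth_log_ge s)
      fix j i assume "j \<in> {..<N}" "i \<in> {..<j}"
      then show "z j \<noteq> z i" using inj_onD[OF inj, of j i] by fastforce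
    qed simp
    also have "\<dots> = (\<Sum>i<N. \<Sum>j<N. ?L (z i) (z j)) - real N * (ln s / 2)"
    proof (induction N)
      case (Suc N)
      have "(\<Sum>i<Suc N. \<Sum>j<Suc N. ?L (z i) (z j)) = (\<Sum>i<N. \<Sum>j<N. ?L (z i) (z j))
          + (\<Sum>i<N. ?L (z i) (z N)) + (\<Sum>j<N. ?L (z N) (z j)) + ?L (z N) (z N)"
        by (simp add: sum.distrib)
      also have "(\<Sum>i<N. ?L (z i) (z N)) = (\<Sum>j<N. ?L (z N) (z j))"
        by (simp add: smooth_log_def norm_minus_commute)
      also have "?L (z N) (z N) = ln s / 2" by (simp add: smooth_log_def)
      finally show ?case using Suc.IH by (simp add: algebra_simps add_divide_distrib)
    qed simp
    also have "\<dots> \<le> 2 * real N * (\<Sum>i<N. \<integral>w. ?L (z i) w \<partial>\<mu>)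
      - real N * (real N - 1) * (\<integral>u. (\<integral>v. ?L u v \<partial>\<mu>) \<partial>\<mu>) - 2 * (real N * (ln s / 2))"
      using sum_smooth_log_le[OF s, of z N] by linarith
    also have "\<dots> \<le> 2 * real N * (\<Sum>i<N. U (z i) + \<epsilon> / 4) - real N * (real N - 1) * log_energy + real N * \<bar>ln s\<bar>"
    proof -
      have "(\<integral>w. ?L (z i) w \<partial>\<mu>) \<le> U (z i) + \<epsilon> / 4" for i
      proof -
        have "(1 + 1 / a) * s powr (a / 2) * C = s powr (a / 2) * D" by (simp add: D_def)
        then show ?thesis using integral_smooth_log_le[OF s, of "z i"] sD by linarith
      qed
      then have "2 * real N * (\<Sum>i<N. \<integral>w. ?L (z i) w \<partial>\<mu>) \<le> 2 * real N * (\<Sum>i<N. U (z i) + \<epsilon> / 4)"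
        by (intro mult_left_mono sum_mono) auto
      moreover have "real N * (real N - 1) * log_energy \<le> real N * (real N - 1) * (\<integral>u. (\<integral>v. ?L u v \<partial>\<mu>) \<partial>\<mu>)"
        using smooth_log_energy(2)[OF s] by (cases "N = 0") (auto intro!: mult_left_mono)
      moreover have "real N * (- ln s) \<le> real N * \<bar>ln s\<bar>" by (intro mult_left_mono) auto
      ultimately show ?thesis by simp
    qed
    also have "\<dots> = 2 * real N * (\<Sum>i<N. U (z i)) - (real N)\<^sup>2 * log_energy + (real N)\<^sup>2 * \<epsilon> / 2 + real N * (log_energy + \<bar>ln s\<bar>)"
      by (simp add: sum.distrib algebra_simps power2_eq_square)
    also have "real N * (log_energy + \<bar>ln s\<bar>) \<le> real N * (\<epsilon> * real N)"
    proof (intro mult_left_mono)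
      have "(\<bar>log_energy\<bar> + 2 * \<bar>ln s\<bar>) / \<epsilon> \<le> real N" using N0 N by linarith
      then have "\<bar>log_energy\<bar> + 2 * \<bar>ln s\<bar> \<le> \<epsilon> * real N" using assms by (simp add: field_simps)
      then show "log_energy + \<bar>ln s\<bar> \<le> \<epsilon> * real N" by linarith
    qed simp
    finally have "2 * (\<Sum>j<N. \<Sum>i<j. ln (cmod (z j - z i))) \<le> 2 * (real N * (\<Sum>i<N. U (z i)))
        - (real N)\<^sup>2 * log_energy + 3 / 2 * (\<epsilon> * (real N)\<^sup>2)"
      by (simp add: power2_eq_square algebra_simps)
    moreover have "0 \<le> \<epsilon> * (real N)\<^sup>2" using assms by simp
    ultimately show "(\<Sum>j<N. \<Sum>i<j. ln (cmod (z j - z i)))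
        \<le> real N * (\<Sum>i<N. U (z i)) - (real N)\<^sup>2 * log_energy / 2 + \<epsilon> * (real N)\<^sup>2"
      by linarith
  qed
qed

end

section \<open>Small integer polynomials\<close>

definition gaussian :: "complex \<Rightarrow> bool" where
  "gaussian z \<longleftrightarrow> Re z \<in> \<int> \<and> Im z \<in> \<int>"

lemma gaussian_diff: "gaussian x \<Longrightarrow> gaussian y \<Longrightarrow> gaussian (x - y)"
  by (auto simp: gaussian_def)

text \<open>The corrections are chosen from the highest index downwards: \<open>e N\<close> makes the coefficient of \<open>x^N\<close>
  a Gaussian integer, and the remaining terms have lower degree and leave that coefficient alone.\<close>
lemma rounding_newton:
  fixes b :: "nat \<Rightarrow> complex poly"
  assumes deg: "\<And>k. degree (b k) = k" and monic: "\<And>k. coeff (b k) k = 1"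
  shows "\<exists>e. (\<forall>k<N. 0 \<le> Re (e k) \<and> Re (e k) < 1 \<and> 0 \<le> Im (e k) \<and> Im (e k) < 1) \<and>
    (\<forall>k<N. gaussian (coeff (H + (\<Sum>k<N. smult (u k + e k) (b k))) k))"
proof (induction N arbitrary: H)
  case (Suc N)
  define w where "w = coeff H N + u N"
  define d where "d = Complex (frac (- Re w)) (frac (- Im w))"
  define H' where "H' = H + smult (u N + d) (b N)"
  have fr: "x + frac (- x) \<in> \<int>" for x :: real
    by (simp add: frac_def)
  have "coeff H' N = w + d" by (simp add: H'_def w_def monic)
  then have gN: "gaussian (coeff H' N)" by (simp add: gaussian_def d_def fr)
  obtain e where e: "\<forall>k<N. 0 \<le> Re (e k) \<and> Re (e k) < 1 \<and> 0 \<le> Im (e k) \<and> Im (e k) < 1"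
    "\<forall>k<N. gaussian (coeff (H' + (\<Sum>k<N. smult (u k + e k) (b k))) k)"
    using Suc.IH[of H'] by blast
  let ?e = "e(N := d)"
  have eq: "H + (\<Sum>k<Suc N. smult (u k + ?e k) (b k)) = H' + (\<Sum>k<N. smult (u k + e k) (b k))"
    by (simp add: H'_def)
  have "coeff (\<Sum>k<N. smult (u k + e k) (b k)) N = 0"
    unfolding coeff_sum by (intro sum.neutral ballI) (simp add: coeff_eq_0 deg)
  then have "gaussian (coeff (H' + (\<Sum>k<N. smult (u k + e k) (b k))) N)" using gN by simp
  then have "\<forall>k<Suc N. gaussian (coeff (H + (\<Sum>k<Suc N. smult (u k + ?e k) (b k))) k)"
    unfolding eq using e(2) by (auto simp: less_Suc_eq)
  moreover have "\<forall>k<Suc N. 0 \<le> Re (?e k) \<and> Re (?e k) < 1 \<and> 0 \<le> Im (?e k) \<and> Im (?e k) < 1"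
    using e(1) by (auto simp: less_Suc_eq d_def frac_ge_0 frac_lt_1)
  ultimately show ?case by blast
qed simp

lemma newton_combination_zero:
  fixes b :: "nat \<Rightarrow> complex poly"
  assumes deg: "\<And>k. degree (b k) = k" and monic: "\<And>k. coeff (b k) k = 1"
  shows "(\<Sum>k<N. smult (d k) (b k)) = 0 \<Longrightarrow> k < N \<Longrightarrow> d k = 0"
proof (induction N arbitrary: k)
  case (Suc N)
  have "coeff (\<Sum>k<N. smult (d k) (b k)) N = 0"
    unfolding coeff_sum by (intro sum.neutral ballI) (simp add: coeff_eq_0 deg)
  then have "d N = coeff (\<Sum>k<Suc N. smult (d k) (b k)) N" by (simp add: monic)
  also have "\<dots> = 0" unfolding Suc.prems(1) by simp
  finally have "d N = 0" .
  with Suc show ?case by (auto simp: less_Suc_eq)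
qed simp

lemma floor_cell:
  fixes x y r :: real
  assumes "r > 0" "0 \<le> x" "0 \<le> y" "nat \<lfloor>x / r\<rfloor> = nat \<lfloor>y / r\<rfloor>"
  shows "\<bar>x - y\<bar> \<le> r"
proof -
  have "\<lfloor>x / r\<rfloor> \<ge> 0" "\<lfloor>y / r\<rfloor> \<ge> 0" using assms by auto
  then have "\<lfloor>x / r\<rfloor> = \<lfloor>y / r\<rfloor>" using assms(4) by linarith
  then have "\<bar>x / r - y / r\<bar> \<le> 1" by linarith
  then have "\<bar>(x - y) / r\<bar> \<le> 1" by (simp only: diff_divide_distrib)
  then have "\<bar>x - y\<bar> / r \<le> 1" using assms(1) by (simp only: abs_divide abs_of_pos)
  then show ?thesis using assms(1) by simp
qed

text \<open>The two counts of the pigeonhole argument: boxes of side \<open>B\<close> against cells of sides \<open>\<rho> k\<close>. As \<open>B\<close>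
  grows, the rounding error in the number of cells becomes negligible.\<close>
lemma box_grid_count:
  fixes \<rho> :: "nat \<Rightarrow> real"
  assumes "\<And>k. k < N \<Longrightarrow> \<rho> k > 0" "(\<Prod>k<N. \<rho> k) > 1"
  obtains B :: nat where "B > 0" "(\<Prod>k<N. nat \<lceil>real B / \<rho> k\<rceil>) < B ^ N"
proof -
  have "((\<lambda>B::nat. \<Prod>k<N. 1 / \<rho> k + 1 / real B) \<longlonglongrightarrow> (\<Prod>k<N. 1 / \<rho> k + 0))"
    by (intro tendsto_prod tendsto_add tendsto_const lim_1_over_n)
  moreover have "(\<Prod>k<N. 1 / \<rho> k + 0) < 1"
    using assms(2) by (simp add: prod_dividef)
  ultimately have "\<forall>\<^sub>F B in sequentially. (\<Prod>k<N. 1 / \<rho> k + 1 / real B) < 1"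
    by (rule order_tendstoD)
  then have "\<forall>\<^sub>F B in sequentially. (\<Prod>k<N. 1 / \<rho> k + 1 / real B) < 1 \<and> B > 0"
    using eventually_gt_at_top[of 0] by eventually_elim auto
  then obtain B :: nat where B: "(\<Prod>k<N. 1 / \<rho> k + 1 / real B) < 1" "B > 0"
    using eventually_happens' sequentially_bot by blast
  have "real (\<Prod>k<N. nat \<lceil>real B / \<rho> k\<rceil>) \<le> (\<Prod>k<N. real B * (1 / \<rho> k + 1 / real B))"
    unfolding of_nat_prod
  proof (intro prod_mono conjI)
    fix k assume "k \<in> {..<N}"
    then have "0 \<le> real B / \<rho> k" using assms(1)[of k] by simp
    then have "real (nat \<lceil>real B / \<rho> k\<rceil>) \<le> real B / \<rho> k + 1" by linarith
    also have "\<dots> = real B * (1 / \<rho> k + 1 / real B)" using B by (simp add: field_simps)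
    finally show "real (nat \<lceil>real B / \<rho> k\<rceil>) \<le> real B * (1 / \<rho> k + 1 / real B)" .
  qed simp
  also have "\<dots> = real B ^ N * (\<Prod>k<N. 1 / \<rho> k + 1 / real B)" by (simp add: prod.distrib)
  also have "\<dots> < real B ^ N" using B by simp
  finally have "(\<Prod>k<N. nat \<lceil>real B / \<rho> k\<rceil>) < B ^ N"
    by (metis of_nat_less_iff of_nat_power)
  with B that show ?thesis by blast
qed

text \<open>Minkowski's theorem on linear forms for a unitriangular system over the Gaussian integers. By
  \<open>rounding_newton\<close> there is a Gaussian integer polynomial for each integer point of a large box of
  Newton coordinates; two of them fall into the same cell of the grid with sides \<open>\<rho> k\<close>, and their
  difference is the required polynomial.\<close>
lemma minkowski_newton:
  fixes b :: "nat \<Rightarrow> complex poly"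
  assumes deg: "\<And>k. degree (b k) = k" and monic: "\<And>k. coeff (b k) k = 1"
    and \<rho>: "\<And>k. k < N \<Longrightarrow> \<rho> k > 0" "(\<Prod>k<N. \<rho> k) > 1"
  shows "\<exists>P c. P \<noteq> 0 \<and> P = (\<Sum>k<N. smult (c k) (b k)) \<and> (\<forall>k. gaussian (coeff P k)) \<and>
    (\<forall>k<N. cmod (c k) \<le> 2 * \<rho> k) \<and> degree P < N"
proof -
  obtain B :: nat where B: "B > 0" "(\<Prod>k<N. nat \<lceil>real B / \<rho> k\<rceil>) < B ^ N"
    using box_grid_count[of N \<rho>] \<rho> by blast
  define v :: "(nat \<Rightarrow> nat \<times> nat) \<Rightarrow> nat \<Rightarrow> complex" where
    "v u k = Complex (real (fst (u k))) (real (snd (u k)))" for u k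
  have "\<exists>e. (\<forall>k<N. 0 \<le> Re (e k) \<and> Re (e k) < 1 \<and> 0 \<le> Im (e k) \<and> Im (e k) < 1) \<and>
    (\<forall>k<N. gaussian (coeff (0 + (\<Sum>k<N. smult (v u k + e k) (b k))) k))" for u
    by (rule rounding_newton[OF deg monic])
  then obtain e where e: "\<And>u k. k < N \<Longrightarrow> 0 \<le> Re (e u k) \<and> Re (e u k) < 1 \<and> 0 \<le> Im (e u k) \<and> Im (e u k) < 1"
    and g: "\<And>u k. k < N \<Longrightarrow> gaussian (coeff (\<Sum>k<N. smult (v u k + e u k) (b k)) k)"
    by simp metis
  define c where "c u k = v u k + e u k" for u k
  define X where "X = (PiE {..<N} (\<lambda>_. {..<B} \<times> {..<B}))"
  define C where "C k = nat \<lceil>real B / \<rho> k\<rceil>" for k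
  define Y where "Y = (PiE {..<N} (\<lambda>k. {..<C k} \<times> {..<C k}))"
  define cell where "cell u = (\<lambda>k\<in>{..<N}. (nat \<lfloor>Re (c u k) / \<rho> k\<rfloor>, nat \<lfloor>Im (c u k) / \<rho> k\<rfloor>))" for u
  have rng: "0 \<le> Re (c u k) \<and> Re (c u k) < real B \<and> 0 \<le> Im (c u k) \<and> Im (c u k) < real B"
    if "u \<in> X" "k < N" for u k
  proof -
    have "u k \<in> {..<B} \<times> {..<B}" using that by (auto simp: X_def)
    then have "fst (u k) + 1 \<le> B" "snd (u k) + 1 \<le> B" by auto
    then have "real (fst (u k)) + 1 \<le> real B" "real (snd (u k)) + 1 \<le> real B" by linarith+
    then show ?thesis using e[OF that(2), of u] by (simp add: c_def v_def)
  qed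
  have idx: "nat \<lfloor>x / \<rho> k\<rfloor> < C k" if "0 \<le> x" "x < real B" "k < N" for x k
  proof -
    have "x / \<rho> k < real B / \<rho> k" using that \<rho>(1) by (simp add: divide_strict_right_mono)
    moreover have "0 \<le> x / \<rho> k" using that \<rho>(1)[of k] by simp
    ultimately show ?thesis unfolding C_def by linarith
  qed
  have maps: "cell ` X \<subseteq> Y"
  proof (intro image_subsetI)
    fix u assume u: "u \<in> X"
    have "(nat \<lfloor>Re (c u k) / \<rho> k\<rfloor>, nat \<lfloor>Im (c u k) / \<rho> k\<rfloor>) \<in> {..<C k} \<times> {..<C k}" if "k < N" for k
      using rng[OF u that] idx that by simp
    then show "cell u \<in> Y" unfolding cell_def Y_def by (intro restrict_PiE_iff[THEN iffD2] ballI) simp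
  qed
  have finY: "finite Y" by (auto simp: Y_def intro!: finite_PiE)
  have "card Y = (\<Prod>k<N. C k) ^ 2"
    unfolding Y_def by (subst card_PiE) (auto simp: card_cartesian_product power2_eq_square prod.distrib)
  also have "\<dots> < (B ^ N) ^ 2" using B by (intro power_strict_mono) (auto simp: C_def)
  also have "\<dots> = card X"
    unfolding X_def by (subst card_PiE) (auto simp: card_cartesian_product power2_eq_square power_mult_distrib)
  finally have lt: "card Y < card X" .
  have "\<not> inj_on cell X"
    using card_inj_on_le[OF _ maps finY] lt by auto
  then obtain u u' where u: "u \<in> X" "u' \<in> X" "u \<noteq> u'" "cell u = cell u'"
    by (auto simp: inj_on_def)
  define d where "d k = c u k - c u' k" for k
  define P where "P = (\<Sum>k<N. smult (d k) (b k))"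
  have PP: "P = (\<Sum>k<N. smult (c u k) (b k)) - (\<Sum>k<N. smult (c u' k) (b k))"
    unfolding P_def d_def by (simp add: smult_diff_left sum_subtractf)
  have "P \<noteq> 0"
  proof
    assume P0: "P = 0"
    have "u k = u' k" if k: "k < N" for k
    proof -
      have "d k = 0" using newton_combination_zero[OF deg monic] P0 k unfolding P_def by blast
      then have "Re (c u k) = Re (c u' k)" "Im (c u k) = Im (c u' k)" by (auto simp: d_def)
      then have "real (fst (u k)) + Re (e u k) = real (fst (u' k)) + Re (e u' k)"
        "real (snd (u k)) + Im (e u k) = real (snd (u' k)) + Im (e u' k)"
        by (auto simp: c_def v_def)
      then have "fst (u k) = fst (u' k)" "snd (u k) = snd (u' k)"
        using e[OF k, of u] e[OF k, of u'] by linarith+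
      then show ?thesis by (simp add: prod_eq_iff)
    qed
    then have "u = u'" using u(1,2) unfolding X_def by (intro PiE_ext) auto
    with u(3) show False by simp
  qed
  moreover have small: "cmod (d k) \<le> 2 * \<rho> k" if k: "k < N" for k
  proof -
    have "cell u k = cell u' k" using u(4) by simp
    then have "nat \<lfloor>Re (c u k) / \<rho> k\<rfloor> = nat \<lfloor>Re (c u' k) / \<rho> k\<rfloor>"
      "nat \<lfloor>Im (c u k) / \<rho> k\<rfloor> = nat \<lfloor>Im (c u' k) / \<rho> k\<rfloor>" using k by (auto simp: cell_def)
    then have "\<bar>Re (d k)\<bar> \<le> \<rho> k" "\<bar>Im (d k)\<bar> \<le> \<rho> k"
      using floor_cell[OF \<rho>(1)[OF k]] rng[OF u(1) k] rng[OF u(2) k] by (auto simp: d_def)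
    then show ?thesis using cmod_le[of "d k"] by linarith
  qed
  moreover have degP: "degree P < N"
  proof -
    have "N \<noteq> 0" using \<rho>(2) by (intro notI) simp
    then have "degree P \<le> N - 1"
      unfolding P_def by (intro degree_sum_le) (auto simp: deg intro: order_trans[OF degree_smult_le])
    then show ?thesis using \<open>N \<noteq> 0\<close> by simp
  qed
  moreover have "gaussian (coeff P k)" for k
  proof (cases "k < N")
    case True
    then show ?thesis unfolding PP coeff_diff c_def by (intro gaussian_diff g)
  next
    case False
    then show ?thesis using degP by (simp add: coeff_eq_0 gaussian_def)
  qed
  ultimately show ?thesis using P_def by blast
qed

definition newton_poly :: "(nat \<Rightarrow> 'a::comm_ring_1) \<Rightarrow> nat \<Rightarrow> 'a poly" where
  "newton_poly \<zeta> k = (\<Prod>t<k. [:- \<zeta> t, 1:])"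

lemma newton_poly_degree:
  fixes \<zeta> :: "nat \<Rightarrow> 'a::idom"
  shows "degree (newton_poly \<zeta> k) = k"
  unfolding newton_poly_def by (subst degree_prod_eq_sum_degree) auto

lemma newton_poly_monic:
  fixes \<zeta> :: "nat \<Rightarrow> 'a::idom"
  shows "coeff (newton_poly \<zeta> k) k = 1"
proof -
  have "lead_coeff (newton_poly \<zeta> k) = 1"
    unfolding newton_poly_def by (simp add: lead_coeff_prod)
  then show ?thesis by (simp add: newton_poly_degree)
qed

lemma poly_newton_poly: "poly (newton_poly \<zeta> k) x = (\<Prod>t<k. x - \<zeta> t)"
  by (simp add: newton_poly_def poly_prod)

lemma gaussian_poly_split:
  assumes "\<And>k. gaussian (coeff P k)"
  obtains A B :: "int poly" where
    "P = of_int_poly A + smult \<i> (of_int_poly B)" "degree A \<le> degree P" "degree B \<le> degree P"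
proof
  let ?A = "map_poly (\<lambda>c. \<lfloor>Re c\<rfloor>) P" and ?B = "map_poly (\<lambda>c. \<lfloor>Im c\<rfloor>) P"
  show "P = of_int_poly ?A + smult \<i> (of_int_poly ?B)"
  proof (rule poly_eqI)
    fix n
    have "gaussian (coeff P n)" by (rule assms)
    then have "of_int \<lfloor>Re (coeff P n)\<rfloor> = Re (coeff P n)" "of_int \<lfloor>Im (coeff P n)\<rfloor> = Im (coeff P n)"
      by (metis gaussian_def Ints_cases floor_of_int)+
    then have "coeff P n = of_int \<lfloor>Re (coeff P n)\<rfloor> + \<i> * of_int \<lfloor>Im (coeff P n)\<rfloor>"
      by (intro complex_eqI) (simp_all del: of_int_floor_cancel)
    then show "coeff P n = coeff (of_int_poly ?A + smult \<i> (of_int_poly ?B)) n"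
      by (simp add: coeff_map_poly)
  qed
qed (auto intro: degree_map_poly_le)

context log_measure
begin

text \<open>The \<open>k\<close>-th Leja point \<open>z k\<close> is chosen to make this function of \<open>w\<close> large. The product over all \<open>k\<close> of
  the values at \<open>z k\<close> is the Vandermonde product weighted by \<open>exp (- N U)\<close> at each point.\<close>
definition leja_product :: "nat \<Rightarrow> (nat \<Rightarrow> complex) \<Rightarrow> nat \<Rightarrow> complex \<Rightarrow> real" where
  "leja_product N z k w = (\<Prod>i<k. cmod (w - z i)) * exp (- real N * U w)"

text \<open>Weighted Leja points maximise the weighted product of the distances to their predecessors. A point
  that comes within a factor \<open>2\<close> of the supremum serves equally well.\<close>
lemma leja_step:
  assumes k: "k \<le> N"
  shows "\<exists>x. leja_product N z k x > 0 \<and> (\<forall>w. leja_product N z k w \<le> 2 * leja_product N z k x)"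
proof -
  let ?f = "leja_product N z k"
  obtain c where c: "c > 0" "\<And>z. exp (U z) \<ge> c * (1 + cmod z)" using exp_U_ge by blast
  have fb: "?f w \<le> (\<Prod>i<k. 1 + cmod (z i)) / c ^ N" for w
  proof -
    have "(\<Prod>i<k. cmod (w - z i)) \<le> (\<Prod>i<k. (1 + cmod (z i)) * (1 + cmod w))"
    proof (intro prod_mono conjI)
      fix i
      have "cmod (w - z i) \<le> cmod w + cmod (z i)" by (rule norm_triangle_ineq4)
      also have "\<dots> \<le> (1 + cmod (z i)) * (1 + cmod w)" by (simp add: algebra_simps)
      finally show "cmod (w - z i) \<le> (1 + cmod (z i)) * (1 + cmod w)" .
    qed simp
    also have "\<dots> = (\<Prod>i<k. 1 + cmod (z i)) * (1 + cmod w) ^ k" by (simp add: prod.distrib)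
    also have "\<dots> \<le> (\<Prod>i<k. 1 + cmod (z i)) * (1 + cmod w) ^ N"
      using k by (intro mult_left_mono power_increasing prod_nonneg) auto
    finally have 1: "(\<Prod>i<k. cmod (w - z i)) \<le> (\<Prod>i<k. 1 + cmod (z i)) * (1 + cmod w) ^ N" .
    have "(c * (1 + cmod w)) ^ N \<le> exp (U w) ^ N"
      using c(1) c(2)[of w] by (intro power_mono) auto
    also have "\<dots> = exp (real N * U w)" by (simp add: exp_of_nat_mult)
    finally have "exp (- real N * U w) \<le> 1 / (c * (1 + cmod w)) ^ N"
    proof -
      assume *: "(c * (1 + cmod w)) ^ N \<le> exp (real N * U w)"
      have "(c * (1 + cmod w)) ^ N > 0" using c(1) by (simp add: add_pos_nonneg)
      then have "1 / exp (real N * U w) \<le> 1 / (c * (1 + cmod w)) ^ N"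
        using * by (intro divide_left_mono) auto
      then show ?thesis by (simp add: exp_minus divide_inverse)
    qed
    then have "?f w \<le> ((\<Prod>i<k. 1 + cmod (z i)) * (1 + cmod w) ^ N) * (1 / (c * (1 + cmod w)) ^ N)"
      unfolding leja_product_def using 1 by (intro mult_mono mult_nonneg_nonneg prod_nonneg) auto
    also have "\<dots> = (\<Prod>i<k. 1 + cmod (z i)) / c ^ N"
    proof -
      have "1 + cmod w \<noteq> 0" by (smt (verit) norm_ge_zero)
      then show ?thesis by (simp add: power_mult_distrib)
    qed
    finally show ?thesis .
  qed
  then have bdd: "bdd_above (range ?f)" by (auto intro!: bdd_aboveI)
  have "infinite (UNIV :: complex set)" by (rule infinite_UNIV_char_0)
  then obtain w0 where w0: "w0 \<notin> z ` {..<k}"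
    by (metis finite_imageI finite_lessThan ex_new_if_finite)
  have "?f w0 > 0" unfolding leja_product_def using w0 by (intro mult_pos_pos prod_pos) auto
  moreover have "?f w0 \<le> (SUP w. ?f w)" using bdd by (intro cSUP_upper) auto
  ultimately have S: "(SUP w. ?f w) > 0" by linarith
  then have "(SUP w. ?f w) / 2 < (SUP w. ?f w)" by simp
  then have "\<exists>x\<in>UNIV. (SUP w. ?f w) / 2 < ?f x"
    using less_cSUP_iff[OF UNIV_not_empty bdd] by blast
  then obtain x where x: "(SUP w. ?f w) / 2 < ?f x" by blast
  have "?f w \<le> 2 * ?f x" for w
    using cSUP_upper[OF _ bdd, of w] x by simp
  moreover have "?f x > 0" using S x by linarith
  ultimately show ?thesis unfolding leja_product_def by blast
qed

lemma leja_points: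
  "\<exists>z. \<forall>k<N. leja_product N z k (z k) > 0 \<and> (\<forall>w. leja_product N z k w \<le> 2 * leja_product N z k (z k))"
proof -
  let ?P = "\<lambda>z k. leja_product N z k (z k) > 0 \<and> (\<forall>w. leja_product N z k w \<le> 2 * leja_product N z k (z k))"
  have "\<exists>z. \<forall>k<K. ?P z k" if "K \<le> N" for K
    using that
  proof (induction K)
    case (Suc K)
    then obtain z where z: "\<forall>k<K. ?P z k" by auto
    obtain x where x: "leja_product N z K x > 0" "\<And>w. leja_product N z K w \<le> 2 * leja_product N z K x"
      using leja_step[of K N z] Suc.prems by auto
    have pr: "leja_product N (z(K := x)) k y = leja_product N z k y" if "k \<le> K" for k y
      using that unfolding leja_product_def by (intro arg_cong2[where f = "(*)"] prod.cong) auto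
    show ?case
    proof (intro exI[of _ "z(K := x)"] allI impI)
      fix k assume "k < Suc K"
      then consider "k < K" | "k = K" by linarith
      then show "?P (z(K := x)) k" using z x by cases (simp_all add: pr)
    qed
  qed simp
  then show ?thesis by blast
qed

text \<open>Let \<open>L k = leja_product N z k (z k)\<close> for Leja points \<open>z k\<close>. The \<open>k\<close>-th Newton polynomial is at most
  \<open>2 L k exp (N U)\<close>, so a polynomial whose \<open>k\<close>-th Newton coordinate is \<open>O(\<tau> / L k)\<close> is
  \<open>O(N \<tau> exp (N U))\<close>. The product of the \<open>L k\<close> is the weighted Vandermonde product, and \<open>vandermonde_energy_bound\<close> shows that the coordinates
  can be bounded like this already for \<open>\<tau>\<close> near \<open>exp (- N I(\<mu>) / 2)\<close>.\<close>
lemma small_gaussian_poly: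
  assumes "\<epsilon> > 0"
  obtains N P where "N \<ge> 1" "P \<noteq> 0" "\<And>k. gaussian (coeff P k)" "degree P < N"
    "\<And>z. cmod (poly P z) \<le> exp (real N * (U z - log_energy / 2 + \<epsilon>))"
proof -
  define \<delta> where "\<delta> = \<epsilon> / 3"
  have \<delta>: "\<delta> > 0" using assms by (simp add: \<delta>_def)
  obtain N0 where N0: "\<And>N z. N \<ge> N0 \<Longrightarrow> inj_on z {..<N} \<Longrightarrow>
    (\<Sum>j<N. \<Sum>i<j. ln (cmod (z j - z i))) \<le> real N * (\<Sum>i<N. U (z i)) - (real N)\<^sup>2 * log_energy / 2 + \<delta> * (real N)\<^sup>2"
    using vandermonde_energy_bound[OF \<delta>] by blast
  have "\<forall>\<^sub>F N in sequentially. 4 * real N \<le> exp (\<delta> * real N)"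
    using \<delta> by real_asymp
  then have "\<forall>\<^sub>F N in sequentially. 4 * real N \<le> exp (\<delta> * real N) \<and> N \<ge> N0 \<and> N \<ge> 1"
    using eventually_ge_at_top[of N0] eventually_ge_at_top[of 1] by eventually_elim auto
  then obtain N where N: "4 * real N \<le> exp (\<delta> * real N)" "N \<ge> N0" "N \<ge> 1"
    using eventually_happens' sequentially_bot by blast
  obtain z where z: "\<forall>k<N. leja_product N z k (z k) > 0 \<and>
      (\<forall>w. leja_product N z k w \<le> 2 * leja_product N z k (z k))"
    using leja_points by blast
  define f where "f = leja_product N z"
  have f_def': "f k w = (\<Prod>i<k. cmod (w - z i)) * exp (- real N * U w)" for k w
    by (simp add: f_def leja_product_def)
  have f: "f k (z k) > 0" "f k w \<le> 2 * f k (z k)" if "k < N" for k w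
    using z that by (auto simp: f_def)
  have ne: "z i \<noteq> z k" if "i < k" "k < N" for i k
  proof
    assume "z i = z k"
    then have "(\<Prod>i<k. cmod (z k - z i)) = 0" using that by (intro prod_zero bexI[of _ i]) auto
    then show False using f(1)[OF that(2)] unfolding f_def' by (metis mult_zero_left less_irrefl)
  qed
  then have inj: "inj_on z {..<N}"
    by (intro inj_onI) (metis lessThan_iff linorder_neqE_nat)
  \<comment> \<open>The summand \<open>2 \<delta> N\<close> beats the error \<open>\<delta> N\<^sup>2\<close> of the energy bound, spread over \<open>N\<close> coordinates.\<close>
  define \<tau> where "\<tau> = exp (- real N * log_energy / 2 + 2 * \<delta> * real N)"
  define \<rho> where "\<rho> k = \<tau> / f k (z k)" for k
  have \<rho>: "\<rho> k > 0" if "k < N" for k using f(1)[OF that] by (simp add: \<rho>_def \<tau>_def)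
  have "(\<Prod>k<N. \<rho> k) > 1"
  proof -
    have lnf: "ln (f k (z k)) = (\<Sum>i<k. ln (cmod (z k - z i))) - real N * U (z k)" if "k < N" for k
    proof -
      have "ln (f k (z k)) = ln (\<Prod>i<k. cmod (z k - z i)) + ln (exp (- real N * U (z k)))"
        unfolding f_def'
      proof (intro ln_mult_pos prod_pos)
        fix i assume "i \<in> {..<k}"
        then show "0 < cmod (z k - z i)" using ne[of i k] that by auto
      qed simp
      also have "ln (\<Prod>i<k. cmod (z k - z i)) = (\<Sum>i<k. ln (cmod (z k - z i)))"
      proof (rule ln_prod)
        fix i assume "i \<in> {..<k}"
        then show "cmod (z k - z i) \<noteq> 0" using ne[of i k] that by auto
      qed simp
      finally show ?thesis by simp
    qed
    have "ln (\<Prod>k<N. \<rho> k) = (\<Sum>k<N. ln (\<rho> k))" using \<rho> by (intro ln_prod) (auto simp: less_imp_neq[symmetric])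
    also have "\<dots> = (\<Sum>k<N. (- real N * log_energy / 2 + 2 * \<delta> * real N) - ((\<Sum>i<k. ln (cmod (z k - z i))) - real N * U (z k)))"
    proof (intro sum.cong refl)
      fix k assume "k \<in> {..<N}"
      then have "k < N" "f k (z k) \<noteq> 0" using f(1)[of k] by auto
      then show "ln (\<rho> k) = (- real N * log_energy / 2 + 2 * \<delta> * real N)
          - ((\<Sum>i<k. ln (cmod (z k - z i))) - real N * U (z k))"
        using lnf[of k] by (simp add: \<rho>_def \<tau>_def ln_div)
    qed
    also have "\<dots> = - (real N)\<^sup>2 * log_energy / 2 + 2 * \<delta> * (real N)\<^sup>2
        - (\<Sum>k<N. \<Sum>i<k. ln (cmod (z k - z i))) + real N * (\<Sum>k<N. U (z k))"
      by (simp add: sum.distrib sum_subtractf sum_distrib_left power2_eq_square algebra_simps)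
    finally have "ln (\<Prod>k<N. \<rho> k) \<ge> \<delta> * (real N)\<^sup>2" using N0[OF N(2) inj] by linarith
    moreover have "\<delta> * (real N)\<^sup>2 > 0" using \<delta> N by simp
    ultimately have "ln (\<Prod>k<N. \<rho> k) > 0" by linarith
    moreover have "(\<Prod>k<N. \<rho> k) > 0" using \<rho> by (intro prod_pos) auto
    ultimately show ?thesis by (simp add: ln_gt_zero_iff)
  qed
  then have "\<exists>P c. P \<noteq> 0 \<and> P = (\<Sum>k<N. smult (c k) (newton_poly z k)) \<and> (\<forall>k. gaussian (coeff P k)) \<and>
      (\<forall>k<N. cmod (c k) \<le> 2 * \<rho> k) \<and> degree P < N"
    using \<rho> by (intro minkowski_newton newton_poly_degree newton_poly_monic) auto
  then obtain P c where P: "P \<noteq> 0" "P = (\<Sum>k<N. smult (c k) (newton_poly z k))"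
    "\<And>k. gaussian (coeff P k)" "\<And>k. k < N \<Longrightarrow> cmod (c k) \<le> 2 * \<rho> k" "degree P < N"
    by (elim exE conjE) simp
  have "cmod (poly P w) \<le> exp (real N * (U w - log_energy / 2 + \<epsilon>))" for w
  proof -
    have "cmod (poly P w) \<le> (\<Sum>k<N. cmod (c k) * (\<Prod>i<k. cmod (w - z i)))"
      unfolding P(2) by (simp add: poly_sum poly_newton_poly)
        (rule order_trans[OF norm_sum], simp add: norm_mult prod_norm)
    also have "\<dots> \<le> (\<Sum>k<N. 4 * \<tau> * exp (real N * U w))"
    proof (intro sum_mono)
      fix k assume "k \<in> {..<N}"
      then have k: "k < N" by simp
      have "(\<Prod>i<k. cmod (w - z i)) = f k w * exp (real N * U w)"
        by (simp add: f_def' mult.assoc flip: exp_add)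
      also have "\<dots> \<le> 2 * f k (z k) * exp (real N * U w)"
        using f(2)[OF k] by (intro mult_right_mono) auto
      finally have "cmod (c k) * (\<Prod>i<k. cmod (w - z i)) \<le> (2 * \<rho> k) * (2 * f k (z k) * exp (real N * U w))"
        using P(4)[OF k] \<rho>[OF k] by (intro mult_mono prod_nonneg) auto
      also have "\<dots> = 4 * \<tau> * exp (real N * U w)" using f(1)[OF k] by (simp add: \<rho>_def)
      finally show "cmod (c k) * (\<Prod>i<k. cmod (w - z i)) \<le> 4 * \<tau> * exp (real N * U w)" .
    qed
    also have "\<dots> = (4 * real N) * (\<tau> * exp (real N * U w))" by simp
    also have "\<dots> \<le> exp (\<delta> * real N) * (\<tau> * exp (real N * U w))"
      using N by (intro mult_right_mono) (auto simp: \<tau>_def)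
    also have "\<dots> = exp (real N * (U w - log_energy / 2 + \<epsilon>))"
      unfolding \<tau>_def exp_add[symmetric]
      by (rule arg_cong[where f = exp]) (simp add: \<delta>_def algebra_simps)
    finally show ?thesis .
  qed
  with N P that show thesis by blast
qed

end

locale arithmetic_measure = log_measure +
  assumes conj_invariant: "distr \<mu> borel cnj = \<mu>"
    and int_poly_nonneg: "\<And>Q :: int poly. Q \<noteq> 0 \<Longrightarrow> 0 \<le> mean_log (of_int_poly Q)"
begin

lemma U_cnj: "U (cnj z) = U z"
proof -
  have "U (cnj z) = (\<integral>w. ln (cmod (cnj z - w)) \<partial>distr \<mu> borel cnj)"
    unfolding U_def conj_invariant ..
  also have "\<dots> = (\<integral>w. ln (cmod (cnj z - cnj w)) \<partial>\<mu>)"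
  proof (rule integral_distr)
    have "cnj \<in> borel_measurable borel"
      by (intro borel_measurable_continuous_onI continuous_intros)
    then show "cnj \<in> \<mu> \<rightarrow>\<^sub>M borel" by (simp add: measurable_cong_sets[OF sets_mu refl])
  qed measurable
  also have "\<dots> = U z"
    unfolding U_def by (simp flip: complex_cnj_diff)
  finally show ?thesis .
qed

lemma poly_of_int_cnj: "poly (of_int_poly A) (cnj z) = cnj (poly (of_int_poly (A :: int poly)) z)"
  by (induction A) (auto simp: map_poly_pCons)

text \<open>If \<open>P = A + \<i> B\<close> with integer polynomials \<open>A\<close> and \<open>B\<close>, then \<open>A\<^sup>2 + B\<^sup>2\<close> is \<open>P\<close> times its complex
  conjugate, and it obeys the squared bound because \<open>U\<close> is invariant under conjugation.\<close>
lemma small_int_poly_energy: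
  assumes "\<epsilon> > 0"
  obtains N :: nat and Q :: "int poly" where "N \<ge> 1" "Q \<noteq> 0" "degree Q \<le> N"
    "\<And>z. cmod (poly (of_int_poly Q) z) \<le> exp (real N * (U z - log_energy / 2 + \<epsilon>))"
proof -
  obtain N P where P: "N \<ge> 1" "P \<noteq> 0" "\<And>k. gaussian (coeff P k)" "degree P < N"
    "\<And>z. cmod (poly P z) \<le> exp (real N * (U z - log_energy / 2 + \<epsilon>))"
    using small_gaussian_poly[OF assms] by metis
  obtain A B :: "int poly" where AB: "P = of_int_poly A + smult \<i> (of_int_poly B)"
    "degree A \<le> degree P" "degree B \<le> degree P" using gaussian_poly_split[OF P(3)] by blast
  define Q where "Q = A * A + B * B"
  have poly_Q: "poly (of_int_poly Q) z = poly P z * cnj (poly P (cnj z))" for z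
    unfolding AB(1) Q_def of_int_poly_hom.hom_add of_int_poly_hom.hom_mult
    by (simp add: poly_of_int_cnj algebra_simps)
  have "Q \<noteq> 0"
  proof
    assume "Q = 0"
    have "poly P z * cnj (poly P (cnj z)) = 0" for z
      using poly_Q[of z] \<open>Q = 0\<close> by simp
    then have "UNIV \<subseteq> {z. poly P z = 0} \<union> cnj ` {z. poly P z = 0}"
      by (auto simp: image_iff) (metis complex_cnj_cnj)
    moreover have "finite ({z. poly P z = 0} \<union> cnj ` {z. poly P z = 0})"
      using poly_roots_finite[OF P(2)] by auto
    ultimately show False using infinite_UNIV_char_0[where 'a=complex] finite_subset by blast
  qed
  moreover have "degree Q \<le> 2 * N"
    unfolding Q_def using AB(2,3) P(4) degree_mult_le[of A A] degree_mult_le[of B B]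
    by (intro degree_add_le) linarith+
  moreover have "cmod (poly (of_int_poly Q) z) \<le> exp (real (2 * N) * (U z - log_energy / 2 + \<epsilon>))" for z
  proof -
    have "cmod (poly (of_int_poly Q) z) = cmod (poly P z) * cmod (poly P (cnj z))"
      unfolding poly_Q by (simp add: norm_mult)
    also have "\<dots> \<le> exp (real N * (U z - log_energy / 2 + \<epsilon>)) * exp (real N * (U (cnj z) - log_energy / 2 + \<epsilon>))"
      by (intro mult_mono P(5)) auto
    also have "\<dots> = exp (real (2 * N) * (U z - log_energy / 2 + \<epsilon>))"
      unfolding U_cnj exp_add[symmetric] by (rule arg_cong[where f = exp]) simp
    finally show ?thesis .
  qed
  ultimately show thesis using that[of "2 * N" Q] P(1) by simp
qed

lemma mean_log_le_of_bound:
  assumes "p \<noteq> 0" "\<And>z. cmod (poly p z) \<le> exp (real N * (U z + t))"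
  shows "mean_log p \<le> real N * (log_energy + t)"
proof -
  have "mean_log p \<le> (\<integral>z. real N * (U z + t) \<partial>\<mu>)"
    unfolding mean_log_def
  proof (rule integral_mono_AE)
    show "AE z in \<mu>. ln (cmod (poly p z)) \<le> real N * (U z + t)"
      using AE_poly_nonzero[OF assms(1)]
    proof eventually_elim
      case (elim z)
      then have "ln (cmod (poly p z)) \<le> ln (exp (real N * (U z + t)))"
        by (intro ln_mono assms(2)) auto
      then show ?case by simp
    qed
  qed (auto intro!: integrable_ln_poly assms integrable_U)
  also have "\<dots> = real N * (log_energy + t)"
    unfolding log_energy_def by (simp add: integrable_U)
  finally show ?thesis .
qed

text \<open>With negative energy \<open>I\<close> the polynomial just constructed would have mean at most \<open>N (I/2 + \<epsilon>) < 0\<close>.\<close>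
lemma log_energy_nonneg: "log_energy \<ge> 0"
proof (rule ccontr)
  assume "\<not> log_energy \<ge> 0"
  then have neg: "log_energy < 0" by simp
  obtain N :: nat and Q :: "int poly" where Q: "N \<ge> 1" "Q \<noteq> 0" "degree Q \<le> N"
    "\<And>z. cmod (poly (of_int_poly Q) z) \<le> exp (real N * (U z - log_energy / 2 + (- log_energy / 4)))"
    using small_int_poly_energy[of "- log_energy / 4"] neg by auto
  have "0 \<le> mean_log (of_int_poly Q)" by (rule int_poly_nonneg[OF Q(2)])
  also have "\<dots> \<le> real N * (log_energy + (- log_energy / 2 - log_energy / 4))"
    using Q(2,4) by (intro mean_log_le_of_bound) (auto simp: algebra_simps)
  also have "\<dots> = real N * log_energy / 4" by simp
  also have "\<dots> < 0" using neg Q(1) by (simp add: mult_pos_neg)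
  finally show False by simp
qed

lemma small_int_poly:
  assumes "\<epsilon> > 0"
  obtains N :: nat and Q :: "int poly" where "N \<ge> 1" "Q \<noteq> 0" "degree Q \<le> N"
    "\<And>z. cmod (poly (of_int_poly Q) z) \<le> exp (real N * (U z + \<epsilon>))"
proof -
  obtain N :: nat and Q :: "int poly" where Q: "N \<ge> 1" "Q \<noteq> 0" "degree Q \<le> N"
    "\<And>z. cmod (poly (of_int_poly Q) z) \<le> exp (real N * (U z - log_energy / 2 + \<epsilon>))"
    using small_int_poly_energy[OF assms] by blast
  have "exp (real N * (U z - log_energy / 2 + \<epsilon>)) \<le> exp (real N * (U z + \<epsilon>))" for z
    using log_energy_nonneg by (auto intro!: mult_left_mono)
  with Q that show thesis by (meson order_trans)
qed

end

section \<open>Integer polynomial functions in several variables\<close>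

text \<open>Polynomials in \<open>x 0, \<dots>, x (m - 1)\<close> with coefficients in \<open>A\<close>, represented by the functions that they
  define, so that the number \<open>m\<close> of variables can vary. Points are functions on all natural numbers, so
  that one type serves for every \<open>m\<close>.\<close>
inductive_set polyfun :: "complex set \<Rightarrow> nat \<Rightarrow> ((nat \<Rightarrow> complex) \<Rightarrow> complex) set"
  for A :: "complex set" and m :: nat where
  const: "a \<in> A \<Longrightarrow> (\<lambda>_. a) \<in> polyfun A m"
| var: "i < m \<Longrightarrow> (\<lambda>x. x i) \<in> polyfun A m"
| add: "f \<in> polyfun A m \<Longrightarrow> g \<in> polyfun A m \<Longrightarrow> (\<lambda>x. f x + g x) \<in> polyfun A m"
| mult: "f \<in> polyfun A m \<Longrightarrow> g \<in> polyfun A m \<Longrightarrow> (\<lambda>x. f x * g x) \<in> polyfun A m"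

lemma polyfun_mono:
  assumes "f \<in> polyfun A m" "A \<subseteq> B" "m \<le> m'"
  shows "f \<in> polyfun B m'"
  using assms(1) by induction (use assms in \<open>auto intro: polyfun.intros\<close>)

lemma polyfun_sum:
  assumes "0 \<in> A" "\<And>i. i \<in> S \<Longrightarrow> (\<lambda>x. f i x) \<in> polyfun A m"
  shows "(\<lambda>x. \<Sum>i\<in>S. f i x) \<in> polyfun A m"
  using assms(2)
  by (induction S rule: infinite_finite_induct) (auto intro: polyfun.intros assms(1))

lemma polyfun_prod:
  assumes "1 \<in> A" "\<And>i. i \<in> S \<Longrightarrow> (\<lambda>x. f i x) \<in> polyfun A m"
  shows "(\<lambda>x. \<Prod>i\<in>S. f i x) \<in> polyfun A m"
  using assms(2)
  by (induction S rule: infinite_finite_induct) (auto intro: polyfun.intros assms(1))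

lemma polyfun_power: "1 \<in> A \<Longrightarrow> f \<in> polyfun A m \<Longrightarrow> (\<lambda>x. f x ^ k) \<in> polyfun A m"
  by (induction k) (auto intro: polyfun.intros)

lemma polyfun_diff:
  assumes "f \<in> polyfun \<int> m" "g \<in> polyfun \<int> m"
  shows "(\<lambda>x. f x - g x) \<in> polyfun \<int> m"
proof -
  have "(\<lambda>x. f x + (-1) * g x) \<in> polyfun \<int> m"
    by (intro polyfun.intros assms) auto
  then show ?thesis by simp
qed

lemma polyfun_local:
  assumes "f \<in> polyfun A m" "\<And>i. i < m \<Longrightarrow> x i = y i"
  shows "f x = f y"
  using assms by induction auto

lemma polyfun_bounded:
  assumes "f \<in> polyfun A m"
  obtains K where "K \<ge> 0" "\<And>x. (\<And>i. i < m \<Longrightarrow> cmod (x i) \<le> R) \<Longrightarrow> cmod (f x) \<le> K"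
proof -
  have "\<exists>K\<ge>0. \<forall>x. (\<forall>i<m. cmod (x i) \<le> R) \<longrightarrow> cmod (f x) \<le> K"
    using assms
  proof induction
    case (const a)
    then show ?case by (intro exI[of _ "cmod a"]) auto
  next
    case (var i)
    then show ?case by (intro exI[of _ "\<bar>R\<bar>"]) fastforce
  next
    case (add f g)
    then obtain K L where "K \<ge> 0" "\<forall>x. (\<forall>i<m. cmod (x i) \<le> R) \<longrightarrow> cmod (f x) \<le> K"
      "L \<ge> 0" "\<forall>x. (\<forall>i<m. cmod (x i) \<le> R) \<longrightarrow> cmod (g x) \<le> L" by blast
    then show ?case
      by (intro exI[of _ "K + L"]) (auto intro!: order_trans[OF norm_triangle_ineq] add_mono)
  next
    case (mult f g)
    then obtain K L where "K \<ge> 0" "\<forall>x. (\<forall>i<m. cmod (x i) \<le> R) \<longrightarrow> cmod (f x) \<le> K"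
      "L \<ge> 0" "\<forall>x. (\<forall>i<m. cmod (x i) \<le> R) \<longrightarrow> cmod (g x) \<le> L" by blast
    then show ?case
      by (intro exI[of _ "K * L"]) (auto simp: norm_mult intro!: mult_mono)
  qed
  with that show ?thesis by blast
qed

text \<open>Restriction to a line reduces statements on zeros to polynomials in one variable.\<close>
lemma polyfun_line:
  assumes "f \<in> polyfun A m"
  obtains p where "\<And>t. f (\<lambda>i. x i + t * (y i - x i)) = poly p t"
proof -
  have "\<exists>p. \<forall>t. f (\<lambda>i. x i + t * (y i - x i)) = poly p t"
    using assms
  proof induction
    case (const a)
    show ?case by (intro exI[of _ "[:a:]"]) simp
  next
    case (var i)
    show ?case by (intro exI[of _ "[:x i, y i - x i:]"]) simp
  next
    case (add f g)
    then show ?case by (metis poly_add)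
  next
    case (mult f g)
    then show ?case by (metis poly_mult)
  qed
  with that show ?thesis by blast
qed

lemma polyfun_common_nonzero:
  assumes "f \<in> polyfun A m" "g \<in> polyfun A m" "f x \<noteq> 0" "g y \<noteq> 0"
  shows "\<exists>z. f z \<noteq> 0 \<and> g z \<noteq> 0"
proof -
  obtain p where p: "\<And>t. f (\<lambda>i. x i + t * (y i - x i)) = poly p t"
    using polyfun_line[OF assms(1)] by blast
  obtain q where q: "\<And>t. g (\<lambda>i. x i + t * (y i - x i)) = poly q t"
    using polyfun_line[OF assms(2)] by blast
  have "poly p 0 \<noteq> 0" "poly q 1 \<noteq> 0" using p[of 0] q[of 1] assms(3,4) by auto
  then have "p \<noteq> 0" "q \<noteq> 0" by auto
  then have "finite ({t. poly p t = 0} \<union> {t. poly q t = 0})" by (simp add: poly_roots_finite)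
  then obtain t where "t \<notin> {t. poly p t = 0} \<union> {t. poly q t = 0}"
    using ex_new_if_finite[OF infinite_UNIV_char_0[where 'a = complex]] by blast
  then show ?thesis using p[of t] q[of t]
    by (intro exI[of _ "\<lambda>i. x i + t * (y i - x i)"]) auto
qed

lemma polyfun_prod_nonzero:
  assumes "finite S" "\<And>i. i \<in> S \<Longrightarrow> f i \<in> polyfun UNIV m" "\<And>i. i \<in> S \<Longrightarrow> \<exists>x. f i x \<noteq> 0"
  shows "\<exists>x. \<forall>i\<in>S. f i x \<noteq> 0"
  using assms
proof (induction S rule: finite_induct)
  case (insert i S)
  then obtain x where x: "\<forall>i\<in>S. f i x \<noteq> 0" by auto
  obtain y where y: "f i y \<noteq> 0" using insert.prems(2) by blast
  have "(\<lambda>x. \<Prod>i\<in>S. f i x) \<in> polyfun UNIV m"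
    using insert.prems by (intro polyfun_prod) auto
  then obtain z where "f i z \<noteq> 0" "(\<Prod>i\<in>S. f i z) \<noteq> 0"
    using polyfun_common_nonzero[of "f i" UNIV m "\<lambda>x. \<Prod>i\<in>S. f i x" y x] insert x y by auto
  then show ?case using insert.hyps(1) by auto
qed simp

lemma polyfun_int_values:
  assumes "f \<in> polyfun \<int> m" "\<And>i. x i \<in> \<int>"
  shows "f x \<in> \<int>"
  using assms by induction auto

text \<open>Integrality is released one coordinate at a time: with the others fixed, a polynomial in one
  variable that vanishes at all integers is zero.\<close>
lemma polyfun_zero_on_ints:
  assumes f: "f \<in> polyfun A m" and z: "\<And>x. (\<And>i. x i \<in> \<int>) \<Longrightarrow> f x = 0"
  shows "f x = 0"
proof -
  have "\<forall>x. (\<forall>i\<ge>k. x i \<in> \<int>) \<longrightarrow> f x = 0" for k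
  proof (induction k)
    case (Suc k)
    show ?case
    proof (intro allI impI)
      fix x :: "nat \<Rightarrow> complex" assume x: "\<forall>i\<ge>Suc k. x i \<in> \<int>"
      obtain p where p: "\<And>t. f (\<lambda>i. (x(k := 0)) i + t * ((x(k := 1)) i - (x(k := 0)) i)) = poly p t"
        using polyfun_line[OF f] by blast
      have "(\<lambda>i. (x(k := 0)) i + t * ((x(k := 1)) i - (x(k := 0)) i)) = x(k := t)" for t by auto
      then have p: "f (x(k := t)) = poly p t" for t using p by simp
      have "poly p (of_int t) = 0" for t :: int
        unfolding p[symmetric] using x by (intro Suc.IH[rule_format]) (auto simp: le_Suc_eq Suc_le_eq)
      then have "range of_int \<subseteq> {t. poly p t = 0}" by auto
      moreover have "infinite (range (of_int :: int \<Rightarrow> complex))"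
      using finite_imageD[of "of_int :: int \<Rightarrow> complex" UNIV] infinite_UNIV_int
      by (auto simp: inj_on_def)
      ultimately have "p = 0" using poly_roots_finite[of p] finite_subset by blast
      then show "f x = 0" using p[of "x k"] by simp
    qed
  qed (use z in auto)
  from this[of m] have "f (\<lambda>i. if i < m then x i else 0) = 0" by auto
  moreover have "f (\<lambda>i. if i < m then x i else 0) = f x"
    by (rule polyfun_local[OF f]) auto
  ultimately show ?thesis by simp
qed

text \<open>Polynomials in one further variable over the ring \<open>polyfun \<int> m\<close>, represented by the family of their
  specialisations to complex polynomials. Leading coefficients may vanish at some points, so
  only a uniform bound on the degrees is part of the definition.\<close>
definition polyfam :: "nat \<Rightarrow> ((nat \<Rightarrow> complex) \<Rightarrow> complex poly) set" where
  "polyfam m = {F. (\<exists>d. \<forall>x. degree (F x) \<le> d) \<and> (\<forall>j. (\<lambda>x. coeff (F x) j) \<in> polyfun \<int> m)}"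

lemma polyfam_coeff: "F \<in> polyfam m \<Longrightarrow> (\<lambda>x. coeff (F x) j) \<in> polyfun \<int> m"
  by (simp add: polyfam_def)

lemma polyfamI:
  assumes "\<And>x. degree (F x) \<le> d" "\<And>j. (\<lambda>x. coeff (F x) j) \<in> polyfun \<int> m"
  shows "F \<in> polyfam m"
  using assms by (auto simp: polyfam_def)

lemma polyfam_const: "(\<lambda>_. of_int_poly (g :: int poly)) \<in> polyfam m"
  by (rule polyfamI[of _ "degree g"]) (auto intro: polyfun.const degree_map_poly_le simp: coeff_map_poly)

lemma polyfam_add:
  assumes "F \<in> polyfam m" "G \<in> polyfam m"
  shows "(\<lambda>x. F x + G x) \<in> polyfam m"
proof -
  obtain d e where "\<And>x. degree (F x) \<le> d" "\<And>x. degree (G x) \<le> e"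
    using assms by (auto simp: polyfam_def)
  then show ?thesis
    by (intro polyfamI[of _ "max d e"])
      (auto intro!: polyfun.add polyfam_coeff assms intro: order_trans[OF degree_add_le_max] max.mono)
qed

lemma polyfam_mult:
  assumes "F \<in> polyfam m" "G \<in> polyfam m"
  shows "(\<lambda>x. F x * G x) \<in> polyfam m"
proof -
  obtain d e where de: "\<And>x. degree (F x) \<le> d" "\<And>x. degree (G x) \<le> e"
    using assms by (auto simp: polyfam_def)
  show ?thesis
  proof (rule polyfamI[of _ "d + e"])
    fix x show "degree (F x * G x) \<le> d + e"
      using degree_mult_le[of "F x" "G x"] de[of x] by linarith
  qed (auto simp: coeff_mult intro!: polyfun_sum polyfun.mult polyfam_coeff assms)
qed

lemma polyfam_smult:
  assumes "f \<in> polyfun \<int> m" "F \<in> polyfam m"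
  shows "(\<lambda>x. smult (f x) (F x)) \<in> polyfam m"
proof -
  obtain d where "\<And>x. degree (F x) \<le> d" using assms by (auto simp: polyfam_def)
  then show ?thesis
    by (intro polyfamI[of _ d]) (auto intro!: polyfun.mult polyfam_coeff assms
        intro: order_trans[OF degree_smult_le])
qed

lemma polyfam_sum:
  assumes "\<And>i. i \<in> S \<Longrightarrow> (\<lambda>x. F i x) \<in> polyfam m"
  shows "(\<lambda>x. \<Sum>i\<in>S. F i x) \<in> polyfam m"
  using assms
proof (induction S rule: infinite_finite_induct)
  case empty
  then show ?case using polyfam_const[of 0 m] by simp
next
  case (infinite S)
  then show ?case using polyfam_const[of 0 m] by simp
qed (auto intro: polyfam_add)

lemma poly_eq_sum_bound:
  fixes p :: "'a :: comm_semiring_1 poly"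
  assumes "degree p \<le> d"
  shows "poly p x = (\<Sum>i\<le>d. coeff p i * x ^ i)"
  unfolding poly_altdef by (intro sum.mono_neutral_left) (use assms in \<open>auto simp: coeff_eq_0\<close>)

lemma polyfam_eval:
  assumes "F \<in> polyfam m" "j < m'" "m \<le> m'"
  shows "(\<lambda>x. poly (F x) (x j)) \<in> polyfun \<int> m'"
proof -
  obtain d where d: "\<And>x. degree (F x) \<le> d" using assms by (auto simp: polyfam_def)
  have "(\<lambda>x. \<Sum>i\<le>d. coeff (F x) i * x j ^ i) \<in> polyfun \<int> m'"
    by (intro polyfun_sum polyfun.mult polyfun_power polyfun.var assms
        polyfun_mono[OF polyfam_coeff[OF assms(1)]]) (use assms in auto)
  then show ?thesis using poly_eq_sum_bound[OF d] by simp
qed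

lemma polyfun_Suc_polyfam:
  assumes "f \<in> polyfun \<int> (Suc m)"
  obtains F where "F \<in> polyfam m" "\<And>x. f x = poly (F x) (x m)"
proof -
  have "\<exists>F\<in>polyfam m. \<forall>x. f x = poly (F x) (x m)"
    using assms
  proof induction
    case (const a)
    then obtain c where "a = of_int c" by (auto elim: Ints_cases)
    then show ?case by (intro bexI[OF _ polyfam_const[of "[:c:]"]]) (cases "c = 0"; simp add: map_poly_pCons)
  next
    case (var i)
    show ?case
    proof (cases "i < m")
      case True
      have "(\<lambda>x. [:x i:]) \<in> polyfam m"
      proof (rule polyfamI[of _ 0])
        fix j show "(\<lambda>x. coeff [:x i:] j) \<in> polyfun \<int> m"
          using True by (cases j) (auto intro: polyfun.intros)
      qed simp
      then show ?thesis by (rule bexI[rotated]) simp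
    next
      case False
      then have "i = m" using var by simp
      then show ?thesis by (intro bexI[OF _ polyfam_const[of "[:0, 1:]"]]) (simp add: map_poly_pCons)
    qed
  next
    case (add f g)
    then obtain F G where "F \<in> polyfam m" "G \<in> polyfam m" "\<forall>x. f x = poly (F x) (x m)"
      "\<forall>x. g x = poly (G x) (x m)" by blast
    then show ?case by (intro bexI[OF _ polyfam_add[of F m G]]) auto
  next
    case (mult f g)
    then obtain F G where "F \<in> polyfam m" "G \<in> polyfam m" "\<forall>x. f x = poly (F x) (x m)"
      "\<forall>x. g x = poly (G x) (x m)" by blast
    then show ?case by (intro bexI[OF _ polyfam_mult[of F m G]]) auto
  qed
  with that show ?thesis by blast
qed

lemma polyfam_eval_const:
  assumes "F \<in> polyfam m"
  shows "(\<lambda>x. poly (F x) \<beta>) \<in> polyfun UNIV m"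
proof -
  obtain d where d: "\<And>x. degree (F x) \<le> d" using assms by (auto simp: polyfam_def)
  have "(\<lambda>x. \<Sum>i\<le>d. coeff (F x) i * \<beta> ^ i) \<in> polyfun UNIV m"
    by (intro polyfun_sum polyfun.mult polyfun.const
        polyfun_mono[OF polyfam_coeff[OF assms]]) auto
  then show ?thesis using poly_eq_sum_bound[OF d] by simp
qed

text \<open>A Bezout identity for \<open>p\<close> and \<open>c\<close> exhibits \<open>f / p\<close> as a combination of \<open>c f / p\<close> and \<open>f\<close>.\<close>
lemma polyfun_divide_cancel:
  assumes f: "f \<in> polyfun \<int> m" and p: "prime (p :: int)" "\<not> p dvd c"
    and cf: "(\<lambda>x. of_int c * f x / of_int p) \<in> polyfun \<int> m"
  shows "(\<lambda>x. f x / of_int p) \<in> polyfun \<int> m"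
proof -
  have "coprime p c" using p prime_imp_coprime by blast
  then obtain u v where uv: "u * p + v * c = 1" using bezout_int[of p c] by auto
  have "(\<lambda>x. of_int v * (of_int c * f x / of_int p) + of_int u * f x) \<in> polyfun \<int> m"
    by (intro polyfun.intros cf f) auto
  moreover have "of_int v * (of_int c * f x / of_int p) + of_int u * f x = f x / of_int p" for x
  proof -
    have p0: "(of_int p :: complex) \<noteq> 0" using p(1) by auto
    have "of_int v * (of_int c * f x / of_int p) + of_int u * f x
        = of_int (u * p + v * c) * f x / (of_int p :: complex)"
      using p0 by (simp add: field_simps)
    then show ?thesis unfolding uv by simp
  qed
  ultimately show ?thesis by simp
qed

text \<open>Gauss' lemma. If \<open>j0\<close> is the first index for which \<open>p\<close> does not divide the coefficient of \<open>h\<close>, then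
  the coefficient of index \<open>i + j0\<close> of the product is \<open>coeff h j0\<close> times the \<open>i\<close>-th coefficient of \<open>Q\<close>,
  up to terms that are divisible by \<open>p\<close> by the choice of \<open>j0\<close> or by induction.\<close>
lemma polyfam_gauss:
  assumes Q: "Q \<in> polyfam m" and F: "F \<in> polyfam m" and p: "prime (p :: int)"
    and h: "\<not> p dvd content h"
    and eq: "\<And>x. of_int_poly h * Q x = smult (of_int p) (F x)"
  shows "(\<lambda>x. smult (1 / of_int p) (Q x)) \<in> polyfam m"
proof -
  have p0: "(of_int p :: complex) \<noteq> 0" using p by auto
  have "\<exists>j. \<not> p dvd coeff h j"
    using h by (simp flip: const_poly_dvd_iff_dvd_content add: const_poly_dvd_iff)
  define j0 where "j0 = (LEAST j. \<not> p dvd coeff h j)"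
  have j0: "\<not> p dvd coeff h j0" "\<And>j. j < j0 \<Longrightarrow> p dvd coeff h j"
    using LeastI_ex[OF \<open>\<exists>j. \<not> p dvd coeff h j\<close>] not_less_Least unfolding j0_def by blast+
  have "(\<lambda>x. coeff (Q x) i / of_int p) \<in> polyfun \<int> m" for i
  proof (induction i rule: less_induct)
    case (less i)
    let ?n = "i + j0"
    have t: "(\<lambda>x. of_int (coeff h k) * coeff (Q x) (?n - k) / of_int p) \<in> polyfun \<int> m"
      if k: "k \<in> {..?n} - {j0}" for k
    proof (cases "k < j0")
      case True
      then obtain c where c: "coeff h k = p * c" using j0(2) by blast
      have "(\<lambda>x. of_int c * coeff (Q x) (?n - k)) \<in> polyfun \<int> m"
        by (intro polyfun.intros polyfam_coeff Q) auto
      then show ?thesis using p0 by (simp add: c)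
    next
      case False
      then have "?n - k < i" using k by auto
      then have "(\<lambda>x. of_int (coeff h k) * (coeff (Q x) (?n - k) / of_int p)) \<in> polyfun \<int> m"
        by (intro polyfun.intros less.IH) auto
      then show ?thesis by simp
    qed
    have "of_int (coeff h j0) * coeff (Q x) i / of_int p =
        coeff (F x) ?n - (\<Sum>k\<in>{..?n} - {j0}. of_int (coeff h k) * coeff (Q x) (?n - k) / of_int p)" for x
    proof -
      have "of_int p * coeff (F x) ?n = coeff (of_int_poly h * Q x) ?n"
        unfolding eq by simp
      also have "\<dots> = (\<Sum>k\<le>?n. of_int (coeff h k) * coeff (Q x) (?n - k))"
        by (simp add: coeff_mult coeff_map_poly)
      also have "\<dots> = of_int (coeff h j0) * coeff (Q x) i
          + (\<Sum>k\<in>{..?n} - {j0}. of_int (coeff h k) * coeff (Q x) (?n - k))"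
        by (subst sum.remove[of _ j0]) auto
      finally have "coeff (F x) ?n = (of_int (coeff h j0) * coeff (Q x) i
          + (\<Sum>k\<in>{..?n} - {j0}. of_int (coeff h k) * coeff (Q x) (?n - k))) / of_int p"
        using p0 by (simp add: field_simps)
      then show ?thesis by (simp add: add_divide_distrib sum_divide_distrib)
    qed
    moreover have "(\<lambda>x. coeff (F x) ?n - (\<Sum>k\<in>{..?n} - {j0}. of_int (coeff h k) * coeff (Q x) (?n - k) / of_int p)) \<in> polyfun \<int> m"
      by (intro polyfun_diff polyfam_coeff F polyfun_sum t) auto
    ultimately have "(\<lambda>x. of_int (coeff h j0) * coeff (Q x) i / of_int p) \<in> polyfun \<int> m" by simp
    then show ?case by (rule polyfun_divide_cancel[OF polyfam_coeff[OF Q] p j0(1)])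
  qed
  moreover obtain d where "\<And>x. degree (Q x) \<le> d" using Q by (auto simp: polyfam_def)
  ultimately show ?thesis
    using p0 by (intro polyfamI[of _ d]) auto
qed

text \<open>The prime factors of the denominator \<open>L\<close> are cancelled one after another.\<close>
lemma polyfam_divide_primitive:
  assumes F: "F \<in> polyfam m" and h: "content h = 1" and L: "L > (0::nat)"
    and Q: "Q \<in> polyfam m" and eq: "\<And>x. smult (of_nat L) (F x) = of_int_poly h * Q x"
  shows "\<exists>G\<in>polyfam m. \<forall>x. F x = of_int_poly h * G x"
  using L Q eq
proof (induction L arbitrary: Q rule: less_induct)
  case (less L)
  show ?case
  proof (cases "L = 1")
    case True
    then show ?thesis using less.prems by (intro bexI[of _ Q]) auto
  next
    case False
    then obtain q where q: "prime q" "q dvd L" using prime_factor_nat by blast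
    then obtain L' where L': "L = q * L'" by blast
    have q0: "(of_int (int q) :: complex) \<noteq> 0" using q(1) by auto
    have pr: "prime (int q)" using q(1) by simp
    have LF: "(\<lambda>x. smult (of_nat L') (F x)) \<in> polyfam m"
      by (intro polyfam_smult polyfun.const F) auto
    have "of_int_poly h * Q x = smult (of_int (int q)) (smult (of_nat L') (F x))" for x
      using less.prems(3)[of x] by (simp add: L')
    then have Q': "(\<lambda>x. smult (1 / of_int (int q)) (Q x)) \<in> polyfam m"
      using pr h not_prime_unit[of "int q"] by (intro polyfam_gauss[OF less.prems(2) LF pr]) auto
    have "smult (of_nat L') (F x) = of_int_poly h * smult (1 / of_int (int q)) (Q x)" for x
    proof -
      have "of_int_poly h * smult (1 / of_int (int q)) (Q x) = smult (1 / of_int (int q)) (smult (of_nat L) (F x))"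
        using less.prems(3)[of x] by (simp add: mult_smult_right)
      also have "\<dots> = smult (of_nat L') (F x)" using q0 by (simp add: L')
      finally show ?thesis ..
    qed
    moreover have "L' < L" "0 < L'" using less.prems(1) q(1) prime_gt_1_nat[OF q(1)] by (auto simp: L')
    ultimately show ?thesis using less.IH[of L'] Q' by blast
  qed
qed

lemma pseudo_divide_monom:
  fixes h :: "int poly"
  assumes "degree h > 0" "j \<le> d"
  shows "\<exists>q r. smult (lead_coeff h ^ Suc d) (monom 1 j) = h * q + r \<and> degree r < degree h"
proof -
  have h0: "h \<noteq> 0" using assms by auto
  obtain q r where qr: "pseudo_divmod (monom 1 j) h = (q, r)" by (cases "pseudo_divmod (monom 1 j) h") auto
  define e where "e = Suc (degree (monom (1::int) j)) - degree h"
  have eq: "smult (lead_coeff h ^ e) (monom 1 j) = h * q + r" and r: "r = 0 \<or> degree r < degree h"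
    using pseudo_divmod[OF h0 qr] unfolding e_def by auto
  have e: "e \<le> Suc d" using assms by (simp add: e_def degree_monom_eq)
  let ?c = "lead_coeff h ^ (Suc d - e)"
  have "smult (lead_coeff h ^ Suc d) (monom 1 j) = smult ?c (smult (lead_coeff h ^ e) (monom 1 j))"
    using e by (simp flip: power_add)
  also have "\<dots> = h * smult ?c q + smult ?c r" unfolding eq by (simp add: smult_add_right)
  finally show ?thesis
    using r assms(1) degree_smult_le[of ?c r] by (intro exI[of _ "smult ?c q"] exI[of _ "smult ?c r"]) auto
qed

text \<open>Pseudo-division by \<open>h\<close> leaves a remainder of smaller degree that still has the root \<open>\<beta>\<close>. At integer
  points it is an integer polynomial and vanishes by minimality of \<open>h\<close>, hence it vanishes everywhere.
  This gives divisibility up to an integer factor, which \<open>polyfam_divide_primitive\<close> removes.\<close>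
lemma polyfam_divide_min_poly:
  assumes F: "F \<in> polyfam m" and root: "\<And>x. poly (F x) \<beta> = 0"
    and h: "content h = 1" "degree h > 0" "poly (of_int_poly h) \<beta> = 0"
    and min: "\<And>r :: int poly. degree r < degree h \<Longrightarrow> poly (of_int_poly r) \<beta> = 0 \<Longrightarrow> r = 0"
  shows "\<exists>G\<in>polyfam m. \<forall>x. F x = of_int_poly h * G x"
proof -
  obtain d where d: "\<And>x. degree (F x) \<le> d" using F by (auto simp: polyfam_def)
  define c where "c = lead_coeff h ^ Suc d"
  have c0: "c \<noteq> 0" using h(2) by (auto simp: c_def)
  have "\<forall>j\<in>{..d}. \<exists>q r. smult c (monom 1 j) = h * q + r \<and> degree r < degree h"
    unfolding c_def using pseudo_divide_monom[OF h(2)] by blast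
  then obtain q r where qr: "\<And>j. j \<le> d \<Longrightarrow> smult c (monom 1 j) = h * q j + r j \<and> degree (r j) < degree h"
    by (metis atMost_iff)
  define Q where "Q x = (\<Sum>j\<le>d. smult (coeff (F x) j) (of_int_poly (q j)))" for x
  define T where "T x = (\<Sum>j\<le>d. smult (coeff (F x) j) (of_int_poly (r j)))" for x
  have Q: "Q \<in> polyfam m" unfolding Q_def
    by (intro polyfam_sum polyfam_smult polyfam_coeff F polyfam_const)
  have T: "T \<in> polyfam m" unfolding T_def
    by (intro polyfam_sum polyfam_smult polyfam_coeff F polyfam_const)
  have eq: "smult (of_int c) (F x) = of_int_poly h * Q x + T x" for x
  proof -
    have "F x = (\<Sum>j\<le>d. monom (coeff (F x) j) j)"
      using d by (intro poly_as_sum_of_monoms'[symmetric])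
    then have "smult (of_int c) (F x) = (\<Sum>j\<le>d. smult (coeff (F x) j) (of_int_poly (smult c (monom 1 j))))"
      by (metis (no_types, lifting) Polynomial.smult_monom mult.commute mult.right_neutral of_int_1
          map_poly_monom of_int_hom.map_poly_hom_smult of_int_0 smult_smult smult_sum2 sum.cong)
    also have "\<dots> = (\<Sum>j\<le>d. of_int_poly h * smult (coeff (F x) j) (of_int_poly (q j))
        + smult (coeff (F x) j) (of_int_poly (r j)))"
      using qr by (intro sum.cong refl) (simp add: of_int_poly_hom.hom_add of_int_poly_hom.hom_mult smult_add_right)
    also have "\<dots> = of_int_poly h * Q x + T x"
      by (simp add: Q_def T_def sum.distrib sum_distrib_left)
    finally show ?thesis .
  qed
  have T0_int: "T x = 0" if x: "\<And>i. x i \<in> \<int>" for x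
  proof -
    have "\<exists>k. coeff (F x) j = of_int k" for j
    proof -
      have "coeff (F x) j \<in> \<int>" by (rule polyfun_int_values[OF polyfam_coeff[OF F] x])
      then show ?thesis by (auto elim: Ints_cases)
    qed
    then obtain k where k: "\<And>j. coeff (F x) j = of_int (k j)" by metis
    define t where "t = (\<Sum>j\<le>d. smult (k j) (r j))"
    have Tt: "T x = of_int_poly t"
      unfolding T_def t_def k by (simp add: of_int_poly_hom.hom_sum of_int_hom.map_poly_hom_smult)
    have "degree t \<le> degree h - 1"
      unfolding t_def
    proof (intro degree_sum_le)
      fix j assume "j \<in> {..d}"
      then have "degree (r j) < degree h" using qr[of j] by blast
      then show "degree (smult (k j) (r j)) \<le> degree h - 1"
        using degree_smult_le[of "k j" "r j"] by linarith
    qed simp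
    then have "degree t < degree h" using h(2) by simp
    moreover have "poly (T x) \<beta> = 0"
      using arg_cong[OF eq[of x], of "\<lambda>p. poly p \<beta>"] root[of x] h(3) by simp
    ultimately have "t = 0" using min Tt by simp
    then show ?thesis using Tt by simp
  qed
  have "T x = 0" for x
  proof (rule poly_eqI)
    fix i show "coeff (T x) i = coeff 0 i"
      using polyfun_zero_on_ints[OF polyfam_coeff[OF T], of i x] T0_int by simp
  qed
  then have eq': "smult (of_int c) (F x) = of_int_poly h * Q x" for x using eq by simp
  have Qs: "(\<lambda>x. smult (of_int (sgn c)) (Q x)) \<in> polyfam m"
    by (intro polyfam_smult polyfun.const Q) auto
  have eqs: "smult (of_nat (nat \<bar>c\<bar>)) (F x) = of_int_poly h * smult (of_int (sgn c)) (Q x)" for x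
  proof -
    have "of_int_poly h * smult (of_int (sgn c)) (Q x) = smult (of_int (sgn c)) (smult (of_int c) (F x))"
      unfolding eq' by (simp add: mult_smult_right)
    also have "\<dots> = smult (of_int (\<bar>c\<bar>)) (F x)"
      by (simp add: abs_sgn mult.commute flip: of_int_mult)
    finally show ?thesis by simp
  qed
  show ?thesis
    by (rule polyfam_divide_primitive[OF F h(1) _ Qs eqs]) (use c0 in simp)
qed

lemma min_int_poly_exists:
  assumes "h \<noteq> (0 :: int poly)" "poly (of_int_poly h) \<beta> = (0 :: complex)"
  obtains g where "content g = 1" "degree g > 0" "poly (of_int_poly g) \<beta> = 0"
    "\<And>r :: int poly. degree r < degree g \<Longrightarrow> poly (of_int_poly r) \<beta> = 0 \<Longrightarrow> r = 0"
proof -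
  let ?P = "\<lambda>g :: int poly. g \<noteq> 0 \<and> poly (of_int_poly g) \<beta> = 0"
  obtain g where g: "?P g" "\<And>r. ?P r \<Longrightarrow> degree g \<le> degree r"
    using exists_least_iff[of "\<lambda>d. \<exists>g. ?P g \<and> degree g = d"] assms
    by (metis linorder_not_le)
  let ?g = "primitive_part g"
  have g0: "g \<noteq> 0" using g by simp
  have "poly (of_int_poly g) \<beta> = of_int (content g) * poly (of_int_poly ?g) \<beta>"
    by (metis content_times_primitive_part of_int_hom.map_poly_hom_smult poly_smult)
  then have root: "poly (of_int_poly ?g) \<beta> = 0" using g g0 by simp
  have deg: "degree ?g = degree g" by simp
  have "degree ?g > 0"
  proof (rule ccontr)
    assume "\<not> degree ?g > 0"
    then have "degree ?g = 0" by blast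
    then obtain k where k: "?g = [:k:]" using degree_eq_zeroE by blast
    have "?g \<noteq> 0" using g0 by simp
    then have "k \<noteq> 0" using k by auto
    then show False using root by (simp add: k map_poly_pCons)
  qed
  moreover have "content ?g = 1" using g0 by simp
  ultimately show thesis
    using that[of ?g] root g(2) deg by (metis linorder_not_le)
qed

text \<open>Every algebraic number that is a common root of all members of the family accounts for an integer
  factor; splitting off such factors lowers the degree, so the process ends. The remaining family
  \<open>G\<close> is the one for which resultants with integer polynomials do not vanish identically.\<close>
lemma polyfam_content_factor:
  assumes "F \<in> polyfam m" "\<exists>x. F x \<noteq> 0"
  obtains g :: "int poly" and G where "g \<noteq> 0" "G \<in> polyfam m" "\<And>x. F x = of_int_poly g * G x"
    "\<And>\<beta> h. h \<noteq> (0 :: int poly) \<Longrightarrow> poly (of_int_poly h) \<beta> = 0 \<Longrightarrow> \<exists>x. poly (G x) \<beta> \<noteq> 0"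
proof -
  have "\<exists>g G. g \<noteq> (0 :: int poly) \<and> G \<in> polyfam m \<and> (\<forall>x. F x = of_int_poly g * G x) \<and>
    (\<forall>\<beta> h. h \<noteq> (0 :: int poly) \<longrightarrow> poly (of_int_poly h) \<beta> = 0 \<longrightarrow> (\<exists>x. poly (G x) \<beta> \<noteq> 0))"
    if "\<forall>x. degree (F x) \<le> d" "F \<in> polyfam m" "\<exists>x. F x \<noteq> 0" for d F
    using that
  proof (induction d arbitrary: F rule: less_induct)
    case (less d)
    show ?case
    proof (cases "\<exists>\<beta> h. h \<noteq> (0 :: int poly) \<and> poly (of_int_poly h) \<beta> = 0 \<and> (\<forall>x. poly (F x) \<beta> = 0)")
      case False
      then show ?thesis using less.prems by (intro exI[of _ "1 :: int poly"] exI[of _ F]) auto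
    next
      case True
      then obtain \<beta> h where \<beta>: "h \<noteq> (0 :: int poly)" "poly (of_int_poly h) \<beta> = 0" "\<And>x. poly (F x) \<beta> = 0"
        by blast
      obtain g where g: "content g = 1" "degree g > 0" "poly (of_int_poly g) \<beta> = 0"
        "\<And>r :: int poly. degree r < degree g \<Longrightarrow> poly (of_int_poly r) \<beta> = 0 \<Longrightarrow> r = 0"
        using min_int_poly_exists[OF \<beta>(1,2)] by blast
      obtain G where G: "G \<in> polyfam m" "\<forall>x. F x = of_int_poly g * G x"
        using polyfam_divide_min_poly[OF less.prems(2) \<beta>(3) g] by blast
      have g0: "of_int_poly g \<noteq> (0 :: complex poly)" using g(2) by auto
      have dg: "degree (of_int_poly g :: complex poly) = degree g" by simp
      have deg: "degree (F x) = degree g + degree (G x)" if "G x \<noteq> 0" for x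
        using G(2) degree_mult_eq[OF g0 that] dg by simp
      obtain x0 where x0: "F x0 \<noteq> 0" using less.prems(3) by blast
      then have "G x0 \<noteq> 0" using G(2) by auto
      then have d1: "d > 0" using deg[of x0] less.prems(1) g(2) by (metis add_gr_0 less_le_trans)
      have "\<forall>x. degree (G x) \<le> d - 1"
      proof
        fix x show "degree (G x) \<le> d - 1"
        proof (cases "G x = 0")
          case False
          have "degree (F x) \<le> d" using less.prems(1) by blast
          then show ?thesis using deg[OF False] g(2) by linarith
        qed simp
      qed
      then have "\<exists>g' G'. g' \<noteq> (0 :: int poly) \<and> G' \<in> polyfam m \<and> (\<forall>x. G x = of_int_poly g' * G' x) \<and>
        (\<forall>\<beta> h. h \<noteq> (0 :: int poly) \<longrightarrow> poly (of_int_poly h) \<beta> = 0 \<longrightarrow> (\<exists>x. poly (G' x) \<beta> \<noteq> 0))"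
        using d1 G(1) \<open>G x0 \<noteq> 0\<close> by (intro less.IH[of "d - 1" G]) auto
      then obtain g' G' where IH: "g' \<noteq> (0 :: int poly)" "G' \<in> polyfam m" "\<forall>x. G x = of_int_poly g' * G' x"
        "\<forall>\<beta> h. h \<noteq> (0 :: int poly) \<longrightarrow> poly (of_int_poly h) \<beta> = 0 \<longrightarrow> (\<exists>x. poly (G' x) \<beta> \<noteq> 0)"
        by blast
      have "g * g' \<noteq> 0" using IH(1) g(2) by auto
      moreover have "\<forall>x. F x = of_int_poly (g * g') * G' x"
        using G(2) IH(3) by (simp add: of_int_poly_hom.hom_mult mult.assoc)
      ultimately show ?thesis using IH by blast
    qed
  qed
  moreover obtain d where "\<forall>x. degree (F x) \<le> d" using assms(1) by (auto simp: polyfam_def)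
  ultimately show thesis using assms that by metis
qed

section \<open>Resultants and positivity in several variables\<close>

lemma newton_expand:
  fixes H :: "'a::idom poly"
  assumes "H = 0 \<or> degree H + k < n"
  shows "\<exists>c. newton_poly \<zeta> k * H = (\<Sum>l\<in>{k..<n}. smult (c l) (newton_poly \<zeta> l)) \<and> c k = poly H (\<zeta> k)"
  using assms
proof (induction "n - k" arbitrary: k H)
  case 0
  then have "H = 0" by linarith
  then show ?case using 0 by (intro exI[of _ "\<lambda>_. 0"]) simp
next
  case (Suc t)
  then have k: "k < n" by linarith
  let ?H' = "synthetic_div H (\<zeta> k)"
  have H: "H = [:- \<zeta> k, 1:] * ?H' + [:poly H (\<zeta> k):]"
    by (rule synthetic_div_correct'[symmetric])
  have step: "newton_poly \<zeta> k * H = newton_poly \<zeta> (Suc k) * ?H' + smult (poly H (\<zeta> k)) (newton_poly \<zeta> k)"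
    by (subst H) (simp add: newton_poly_def lessThan_Suc algebra_simps)
  have "?H' = 0 \<or> degree ?H' + Suc k < n"
  proof (cases "degree H = 0")
    case True
    then show ?thesis by (simp add: synthetic_div_eq_0_iff)
  next
    case False
    then have "H \<noteq> 0" by auto
    then show ?thesis using False Suc.prems by (simp add: degree_synthetic_div)
  qed
  moreover have "t = n - Suc k" using Suc.hyps(2) by linarith
  ultimately obtain c where c: "newton_poly \<zeta> (Suc k) * ?H' = (\<Sum>l\<in>{Suc k..<n}. smult (c l) (newton_poly \<zeta> l))"
    using Suc.hyps(1) by blast
  show ?case
    using k c step by (intro exI[of _ "c(k := poly H (\<zeta> k))"])
      (simp add: sum.atLeast_Suc_lessThan add.commute)
qed

text \<open>The Sylvester matrix for \<open>f\<close> of degree \<open>d\<close> and \<open>P\<close> of degree at most \<open>N\<close>, with formal degrees as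
  parameters so that the entries depend polynomially on the coefficients even where degrees drop.\<close>
definition sylvester :: "nat \<Rightarrow> nat \<Rightarrow> 'a::comm_ring_1 poly \<Rightarrow> 'a poly \<Rightarrow> 'a mat" where
  "sylvester d N f P = mat (d + N) (d + N)
     (\<lambda>(i, j). if i < d then coeff (monom 1 i * P) j else coeff (monom 1 (i - d) * f) j)"

lemma poly_as_sum_monoms_lessThan:
  assumes "degree p < n"
  shows "(\<Sum>k<n. monom (coeff p k) k) = p"
proof -
  obtain n' where "n = Suc n'" using assms by (cases n) auto
  then show ?thesis using assms poly_as_sum_of_monoms'[of p n'] by (simp add: lessThan_Suc_atMost)
qed

text \<open>The classical product formula for the resultant. Let \<open>b k\<close> be the Newton polynomials for the
  roots of \<open>f\<close>, continued by the node \<open>0\<close>. Replacing the rows \<open>x^i P\<close> by \<open>b i P\<close> is a unitriangular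
  operation, and so is expressing all rows in the basis \<open>b\<close>. In this basis the matrix is
  triangular: \<open>b i P\<close> starts with \<open>P(\<zeta> i) b i\<close>, and \<open>x^j f = c b (d + j)\<close>. Multiple roots need no
  separate treatment.\<close>
lemma det_sylvester:
  fixes P :: "'a::idom poly" and \<zeta> :: "nat \<Rightarrow> 'a"
  assumes P: "degree P \<le> N" and \<zeta>0: "\<And>t. t \<ge> d \<Longrightarrow> \<zeta> t = 0"
  shows "det (sylvester d N (smult c (newton_poly \<zeta> d)) P) = c ^ N * (\<Prod>t<d. poly P (\<zeta> t))"
proof -
  let ?n = "d + N" and ?b = "newton_poly \<zeta>"
  let ?S = "sylvester d N (smult c (newton_poly \<zeta> d)) P"
  have deg: "degree (?b k) = k" "coeff (?b k) k = 1" for k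
    by (simp_all add: newton_poly_degree newton_poly_monic)
  have b_shift: "?b (d + j) = monom 1 j * ?b d" for j
  proof (induction j)
    case (Suc j)
    have "?b (d + Suc j) = ?b (d + j) * [:0, 1:]" by (simp add: newton_poly_def \<zeta>0)
    also have "\<dots> = monom 1 (Suc j) * ?b d" unfolding Suc.IH by (simp add: monom_Suc)
    finally show ?case .
  qed simp
  have "\<forall>i\<in>{..<d}. \<exists>a. ?b i * P = (\<Sum>l\<in>{i..<?n}. smult (a l) (?b l)) \<and> a i = poly P (\<zeta> i)"
    using P by (intro ballI newton_expand) auto
  then obtain a where a: "\<And>i. i < d \<Longrightarrow> ?b i * P = (\<Sum>l\<in>{i..<?n}. smult (a i l) (?b l))"
    "\<And>i. i < d \<Longrightarrow> a i i = poly P (\<zeta> i)"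
    by (metis lessThan_iff)
  define R where "R = mat ?n ?n (\<lambda>(i, k). if i < d then coeff (?b i) k else if i = k then 1 else 0)"
  define B where "B = mat ?n ?n (\<lambda>(l, j). coeff (?b l) j)"
  define T where "T = mat ?n ?n (\<lambda>(i, l). if i < d then (if l < i then 0 else a i l) else if l = i then c else 0)"
  have car: "R \<in> carrier_mat ?n ?n" "B \<in> carrier_mat ?n ?n" "T \<in> carrier_mat ?n ?n" "?S \<in> carrier_mat ?n ?n"
    by (auto simp: R_def B_def T_def sylvester_def)
  have detR: "det R = 1"
  proof -
    have "det R = (\<Prod>i=0..<?n. R $$ (i, i))"
      using car(1) by (subst det_lower_triangular[OF _ car(1)])
        (auto simp: R_def coeff_eq_0 deg(1) prod_list_diag_prod)
    also have "\<dots> = 1" by (intro prod.neutral ballI) (auto simp: R_def deg(2))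
    finally show ?thesis .
  qed
  have detB: "det B = 1"
    by (subst det_lower_triangular[OF _ car(2)])
      (auto simp: B_def coeff_eq_0 deg prod_list_diag_prod)
  have detT: "det T = c ^ N * (\<Prod>t<d. poly P (\<zeta> t))"
  proof -
    have "upper_triangular T" by (intro upper_triangularI) (auto simp: T_def)
    then have "det T = (\<Prod>i=0..<?n. T $$ (i, i))"
      using det_upper_triangular[OF _ car(3)] car(3) by (simp add: prod_list_diag_prod)
    also have "\<dots> = (\<Prod>i=0..<?n. if i < d then poly P (\<zeta> i) else c)"
      by (intro prod.cong refl) (auto simp: T_def a)
    also have "{0..<?n} = {..<d} \<union> {d..<?n}" by auto
    also have "(\<Prod>i\<in>\<dots>. if i < d then poly P (\<zeta> i) else c) = (\<Prod>t<d. poly P (\<zeta> t)) * c ^ N"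
      by (subst prod.union_disjoint) auto
    finally show ?thesis by (simp add: mult.commute)
  qed
  have "R * ?S = T * B"
  proof (rule eq_matI)
    fix i j assume "i < dim_row (T * B)" "j < dim_col (T * B)"
    then have ij: "i < ?n" "j < ?n" using car by auto
    have L: "(R * ?S) $$ (i, j) = (\<Sum>k=0..<?n. R $$ (i, k) * ?S $$ (k, j))"
      using ij car by (simp add: scalar_prod_def)
    have Rr: "(T * B) $$ (i, j) = (\<Sum>l=0..<?n. T $$ (i, l) * B $$ (l, j))"
      using ij car by (simp add: scalar_prod_def)
    show "(R * ?S) $$ (i, j) = (T * B) $$ (i, j)"
    proof (cases "i < d")
      case True
      have "(R * ?S) $$ (i, j) = (\<Sum>k<?n. coeff (?b i) k * coeff (monom 1 k * P) j)"
        unfolding L atLeast0LessThan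
      proof (intro sum.cong refl)
        fix k assume "k \<in> {..<?n}"
        then show "R $$ (i, k) * ?S $$ (k, j) = coeff (?b i) k * coeff (monom 1 k * P) j"
          using True ij by (cases "k < d") (auto simp: R_def sylvester_def coeff_eq_0 deg)
      qed
      also have "\<dots> = coeff ((\<Sum>k<?n. monom (coeff (?b i) k) k) * P) j"
        by (auto simp: sum_distrib_right coeff_sum coeff_monom_mult intro!: sum.cong)
      also have "\<dots> = coeff (?b i * P) j"
        using ij by (subst poly_as_sum_monoms_lessThan) (auto simp: deg)
      also have "\<dots> = (\<Sum>l\<in>{i..<?n}. a i l * coeff (?b l) j)"
        unfolding a(1)[OF True] by (simp add: coeff_sum)
      also have "\<dots> = (T * B) $$ (i, j)"
        unfolding Rr using True ij
        by (intro sum.mono_neutral_cong_left) (auto simp: T_def B_def)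
      finally show ?thesis .
    next
      case False
      then have i: "i = d + (i - d)" by simp
      have "(R * ?S) $$ (i, j) = ?S $$ (i, j)"
        unfolding L using ij False by (subst sum.remove[of _ i]) (auto simp: R_def intro!: sum.neutral)
      also have "\<dots> = c * coeff (?b i) j"
        using ij False by (subst i, subst b_shift) (simp add: sylvester_def)
      also have "\<dots> = (T * B) $$ (i, j)"
        unfolding Rr using ij False by (subst sum.remove[of _ i]) (auto simp: T_def B_def intro!: sum.neutral)
      finally show ?thesis .
    qed
  qed (use car in auto)
  then have "det R * det ?S = det T * det B"
    using det_mult[OF car(1) car(4)] det_mult[OF car(3) car(2)] by simp
  then show ?thesis using detR detB detT by simp
qed

lemma polyfun_det:
  assumes "\<And>i j. i < n \<Longrightarrow> j < n \<Longrightarrow> (\<lambda>x. f x i j) \<in> polyfun \<int> m"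
  shows "(\<lambda>x. det (mat n n (\<lambda>(i, j). f x i j))) \<in> polyfun \<int> m"
proof -
  have "(\<lambda>x. \<Sum>p\<in>{p. p permutes {0..<n}}. signof p * (\<Prod>i\<in>{0..<n}. f x i (p i))) \<in> polyfun \<int> m"
  proof (intro polyfun_sum polyfun.mult polyfun.const polyfun_prod)
    fix p i assume "p \<in> {p. p permutes {0..<n}}" "i \<in> {0..<n}"
    then show "(\<lambda>x. f x i (p i)) \<in> polyfun \<int> m"
      using assms[of i "p i"] permutes_in_image[of p "{0..<n}" i] by simp
  qed (auto simp: sign_def)
  also have "(\<lambda>x. \<Sum>p\<in>{p. p permutes {0..<n}}. signof p * (\<Prod>i\<in>{0..<n}. f x i (p i)))
      = (\<lambda>x. det (mat n n (\<lambda>(i, j). f x i j)))"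
  proof
    fix x
    show "(\<Sum>p\<in>{p. p permutes {0..<n}}. signof p * (\<Prod>i\<in>{0..<n}. f x i (p i)))
      = det (mat n n (\<lambda>(i, j). f x i j))"
      by (subst det_def'[of _ n], simp)
        (auto intro!: sum.cong arg_cong2[where f = "(*)"] prod.cong dest: permutes_in_image[where x = "i" for i])
  qed
  finally show ?thesis .
qed

lemma polyfam_local:
  assumes "F \<in> polyfam m" "\<And>i. i < m \<Longrightarrow> x i = y i"
  shows "F x = F y"
  by (rule poly_eqI) (rule polyfun_local[OF polyfam_coeff[OF assms(1)] assms(2)])

context arithmetic_measure
begin

lemma polyfun_measurable: "f \<in> polyfun A m \<Longrightarrow> f \<in> borel_measurable (PM m)"
proof (induction rule: polyfun.induct)
  case (var i)
  have "(\<lambda>x. x i) \<in> measurable (PM m) \<mu>" using var by simp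
  then show ?case by (simp add: measurable_cong_sets[OF refl sets_mu])
qed (auto intro: borel_measurable_add borel_measurable_times)

lemma AE_PM_bound: "AE x in PM m. \<forall>i<m. cmod (x i) \<le> R"
proof -
  have "AE x in PM m. \<forall>i\<in>{..<m}. cmod (x i) \<le> R"
    by (intro AE_finite_allI finite_lessThan AE_PiM_component[where M = "\<lambda>_. \<mu>"] prob_space_axioms AE_bound)
  then show ?thesis by eventually_elim simp
qed

lemma prob_space_PM: "prob_space (PM m)"
  by (rule prob_space_PiM) (rule prob_space_axioms)

text \<open>The inequality that defines \<open>B_Sigma\<close>, for polynomials in \<open>m\<close> variables and the \<open>m\<close>-fold product
  of \<open>\<mu>\<close>. Nonvanishing almost everywhere is included because \<open>ln 0 = 0\<close> would
  make the integral meaningless.\<close>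
definition nonneg_mean :: "nat \<Rightarrow> bool" where
  "nonneg_mean m \<longleftrightarrow> (\<forall>f\<in>polyfun \<int> m. (\<exists>x. f x \<noteq> 0) \<longrightarrow>
     (AE x in PM m. f x \<noteq> 0) \<and> integrable (PM m) (\<lambda>x. ln (cmod (f x))) \<and>
     0 \<le> (\<integral>x. ln (cmod (f x)) \<partial>PM m))"

lemma nonneg_meanD:
  assumes "nonneg_mean m" "f \<in> polyfun \<int> m" "f x \<noteq> 0"
  shows "AE x in PM m. f x \<noteq> 0" "integrable (PM m) (\<lambda>x. ln (cmod (f x)))"
    "0 \<le> (\<integral>x. ln (cmod (f x)) \<partial>PM m)"
  using assms unfolding nonneg_mean_def by metis+

lemma polyfam_bounded:
  assumes "F \<in> polyfam m"
  obtains K where "K \<ge> 0" "\<And>x w. (\<And>i. i < m \<Longrightarrow> cmod (x i) \<le> R) \<Longrightarrow> cmod w \<le> R \<Longrightarrow> cmod (poly (F x) w) \<le> K"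
proof -
  obtain K where K: "K \<ge> 0" "\<And>x. (\<And>i. i < Suc m \<Longrightarrow> cmod (x i) \<le> R) \<Longrightarrow> cmod (poly (F x) (x m)) \<le> K"
    using polyfun_bounded[OF polyfam_eval[OF assms, of m "Suc m"]] by auto
  have "cmod (poly (F x) w) \<le> K" if x: "\<And>i. i < m \<Longrightarrow> cmod (x i) \<le> R" and w: "cmod w \<le> R" for x w
  proof -
    have "F (x(m := w)) = F x" by (rule polyfam_local[OF assms]) auto
    moreover have "cmod (poly (F (x(m := w))) ((x(m := w)) m)) \<le> K"
      using x w by (intro K(2)) (auto simp: less_Suc_eq)
    ultimately show ?thesis by simp
  qed
  with K(1) that show thesis by blast
qed

lemma AE_ln_poly_le:
  assumes "p \<noteq> 0" "\<And>w. cmod w \<le> R \<Longrightarrow> cmod (poly p w) \<le> K"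
  shows "AE w in \<mu>. ln (cmod (poly p w)) \<le> K"
  using AE_bound AE_poly_nonzero[OF assms(1)]
proof eventually_elim
  case (elim w)
  then have "ln (cmod (poly p w)) \<le> cmod (poly p w)"
    using ln_le_minus_one[of "cmod (poly p w)"] by simp
  with assms(2)[OF elim(1)] show ?case by linarith
qed

lemma mean_log_measurable:
  assumes "F \<in> polyfam m"
  shows "(\<lambda>x. mean_log (F x)) \<in> borel_measurable (PM m)"
proof -
  obtain d where d: "\<And>x. degree (F x) \<le> d" using assms by (auto simp: polyfam_def)
  have [measurable]: "(\<lambda>x. coeff (F x) i) \<in> borel_measurable (PM m)" for i
    by (rule polyfun_measurable[OF polyfam_coeff[OF assms]])
  have "(\<lambda>(x, w). ln (cmod (\<Sum>i\<le>d. coeff (F x) i * w ^ i))) \<in> borel_measurable (PM m \<Otimes>\<^sub>M \<mu>)"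
    by measurable
  then have "(\<lambda>x. \<integral>w. ln (cmod (\<Sum>i\<le>d. coeff (F x) i * w ^ i)) \<partial>\<mu>) \<in> borel_measurable (PM m)"
    by (intro borel_measurable_lebesgue_integral) auto
  then show ?thesis unfolding mean_log_def using poly_eq_sum_bound[OF d] by simp
qed

lemma polyfam_leading:
  assumes "G \<in> polyfam m" "\<exists>x. G x \<noteq> 0"
  obtains d x0 where "\<And>x. degree (G x) \<le> d" "coeff (G x0) d \<noteq> 0"
proof -
  obtain e where e: "\<And>x. degree (G x) \<le> e" using assms by (auto simp: polyfam_def)
  obtain x1 where x1: "G x1 \<noteq> 0" using assms by blast
  have "\<exists>x0. G x0 \<noteq> 0 \<and> (\<forall>y. G y \<noteq> 0 \<longrightarrow> degree (G y) \<le> degree (G x0))"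
    using ex_has_greatest_nat[of "\<lambda>x. G x \<noteq> 0" x1 "\<lambda>x. degree (G x)" "Suc e"] x1 e
    by (simp add: less_Suc_eq_le)
  then obtain x0 where x0: "G x0 \<noteq> 0" "\<And>y. G y \<noteq> 0 \<Longrightarrow> degree (G y) \<le> degree (G x0)" by blast
  show thesis
  proof (rule that)
    fix x show "degree (G x) \<le> degree (G x0)"
      using x0(2)[of x] by (cases "G x = 0") auto
  next
    show "coeff (G x0) (degree (G x0)) \<noteq> 0" using x0(1) by simp
  qed
qed

text \<open>On the support the polynomials are bounded, which bounds the mean from above; \<open>mean_log_ge\<close> bounds it
  from below in terms of the leading coefficient, to which the induction hypothesis applies.\<close>
lemma integrable_mean_log:
  assumes IH: "nonneg_mean m" and G: "G \<in> polyfam m" "\<exists>x. G x \<noteq> 0"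
  shows "AE x in PM m. G x \<noteq> 0" "integrable (PM m) (\<lambda>x. mean_log (G x))"
proof -
  interpret PN: prob_space "PM m" by (rule prob_space_PM)
  obtain d x0 where d: "\<And>x. degree (G x) \<le> d" "coeff (G x0) d \<noteq> 0"
    using polyfam_leading[OF G] by blast
  have c: "AE x in PM m. coeff (G x) d \<noteq> 0" "integrable (PM m) (\<lambda>x. ln (cmod (coeff (G x) d)))"
    using nonneg_meanD[OF IH polyfam_coeff[OF G(1), of d], where x = x0] d(2) by simp_all
  show "AE x in PM m. G x \<noteq> 0" using c(1) by eventually_elim auto
  obtain K where K: "K \<ge> 0" "\<And>x w. (\<And>i. i < m \<Longrightarrow> cmod (x i) \<le> R) \<Longrightarrow> cmod w \<le> R \<Longrightarrow> cmod (poly (G x) w) \<le> K"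
    using polyfam_bounded[OF G(1)] by blast
  show "integrable (PM m) (\<lambda>x. mean_log (G x))"
  proof (rule Bochner_Integration.integrable_bound)
    show "integrable (PM m) (\<lambda>x. \<bar>ln (cmod (coeff (G x) d))\<bar> + (K + real d * (C / a)))"
      by (intro Bochner_Integration.integrable_add integrable_abs c) auto
    show "(\<lambda>x. mean_log (G x)) \<in> borel_measurable (PM m)" by (rule mean_log_measurable[OF G(1)])
    show "AE x in PM m. norm (mean_log (G x)) \<le> norm (\<bar>ln (cmod (coeff (G x) d))\<bar> + (K + real d * (C / a)))"
      using c(1) AE_PM_bound[of m]
    proof eventually_elim
      case (elim x)
      then have "degree (G x) = d" "G x \<noteq> 0" using d(1)[of x] le_degree[of "G x" d] by (simp, force)
      then have 1: "mean_log (G x) \<ge> ln (cmod (coeff (G x) d)) - real d * (C / a)"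
        using mean_log_ge[of "G x"] by simp
      have "mean_log (G x) \<le> (\<integral>w. K \<partial>\<mu>)" unfolding mean_log_def
      proof (rule integral_mono_AE)
        show "AE w in \<mu>. ln (cmod (poly (G x) w)) \<le> K"
          using elim(2) by (intro AE_ln_poly_le K(2) \<open>G x \<noteq> 0\<close>) auto
      qed (use \<open>G x \<noteq> 0\<close> in \<open>auto intro: integrable_ln_poly\<close>)
      then have 2: "mean_log (G x) \<le> K" by simp
      have "real d * (C / a) \<ge> 0" using C a by simp
      then show ?case using 1 2 K(1) unfolding real_norm_def by linarith
    qed
  qed
qed

text \<open>By the product formula the logarithm of the resultant is \<open>N ln |c|\<close> plus the sum of \<open>ln |P(\<zeta>)|\<close> over
  the roots \<open>\<zeta>\<close> of \<open>f\<close>. The bound on \<open>P\<close> replaces each summand by \<open>N (U \<zeta> + \<epsilon>)\<close>, and \<open>ln |c|\<close> plus the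
  sum of the \<open>U \<zeta>\<close> is \<open>mean_log f\<close>.\<close>
lemma ln_sylvester_le:
  fixes P :: "int poly"
  assumes P: "degree P \<le> N" "\<And>z. cmod (poly (of_int_poly P) z) \<le> exp (real N * (U z + \<epsilon>))"
    and f: "f \<noteq> 0" "degree f = d"
  shows "(\<And>z. poly f z = 0 \<Longrightarrow> poly (of_int_poly P) z \<noteq> 0) \<Longrightarrow>
      det (sylvester d N f (of_int_poly P)) \<noteq> 0"
    "det (sylvester d N f (of_int_poly P)) \<noteq> 0 \<Longrightarrow>
      ln (cmod (det (sylvester d N f (of_int_poly P)))) \<le> real N * mean_log f + real d * (real N * \<epsilon>)"
proof -
  obtain zs where zs: "length zs = degree f" "f = smult (lead_coeff f) (\<Prod>\<zeta>\<leftarrow>zs. [:-\<zeta>, 1:])"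
    by (rule complex_poly_factor_list)
  define \<zeta> where "\<zeta> t = (if t < d then zs ! t else 0)" for t
  define c where "c = lead_coeff f"
  have c0: "c \<noteq> 0" unfolding c_def using f(1) by (simp only: leading_coeff_0_iff) simp
  have len: "length zs = d" using zs f by simp
  have "(\<Prod>\<zeta>\<leftarrow>zs. [:-\<zeta>, 1:]) = newton_poly \<zeta> d"
    unfolding newton_poly_def by (subst prod.list_conv_set_nth) (auto simp: \<zeta>_def len lessThan_atLeast0 intro!: prod.cong)
  then have fn: "f = smult c (newton_poly \<zeta> d)" using zs(2) by (simp add: c_def)
  have dP: "degree (of_int_poly P :: complex poly) \<le> N" using P(1) by simp
  have det: "det (sylvester d N f (of_int_poly P)) = c ^ N * (\<Prod>t<d. poly (of_int_poly P) (\<zeta> t))"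
    unfolding fn by (rule det_sylvester[OF dP]) (simp add: \<zeta>_def)
  have sumU: "(\<Sum>\<zeta>\<leftarrow>zs. U \<zeta>) = (\<Sum>t<d. U (\<zeta> t))"
    by (subst sum.list_conv_set_nth) (auto simp: \<zeta>_def len lessThan_atLeast0 intro!: sum.cong)
  have mean: "mean_log f = ln (cmod c) + (\<Sum>t<d. U (\<zeta> t))"
    using mean_log_factor[OF zs(2)] c0 unfolding c_def sumU by blast
  show "det (sylvester d N f (of_int_poly P)) \<noteq> 0"
    if "\<And>z. poly f z = 0 \<Longrightarrow> poly (of_int_poly P) z \<noteq> 0"
  proof -
    have "poly f (\<zeta> t) = 0" if "t < d" for t
      unfolding fn using that by (auto simp: poly_newton_poly)
    then show ?thesis unfolding det using c0 that by auto
  qed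
  show "ln (cmod (det (sylvester d N f (of_int_poly P)))) \<le> real N * mean_log f + real d * (real N * \<epsilon>)"
    if "det (sylvester d N f (of_int_poly P)) \<noteq> 0"
  proof -
    have P0: "poly (of_int_poly P) (\<zeta> t) \<noteq> 0" if "t < d" for t
      using \<open>det _ \<noteq> 0\<close> that unfolding det by auto
    have "ln (cmod (det (sylvester d N f (of_int_poly P))))
        = real N * ln (cmod c) + (\<Sum>t<d. ln (cmod (poly (of_int_poly P) (\<zeta> t))))"
    proof -
      have "ln (\<Prod>t<d. cmod (poly (of_int_poly P) (\<zeta> t))) = (\<Sum>t<d. ln (cmod (poly (of_int_poly P) (\<zeta> t))))"
        by (rule ln_prod) (use P0 in auto)
      moreover have "(\<Prod>t<d. cmod (poly (of_int_poly P) (\<zeta> t))) > 0"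
        using P0 by (intro prod_pos) auto
      ultimately show ?thesis
        unfolding det norm_mult norm_power prod_norm[symmetric]
        using c0 by (subst ln_mult_pos) (auto simp: ln_realpow)
    qed
    also have "(\<Sum>t<d. ln (cmod (poly (of_int_poly P) (\<zeta> t)))) \<le> (\<Sum>t<d. real N * (U (\<zeta> t) + \<epsilon>))"
    proof (intro sum_mono)
      fix t assume "t \<in> {..<d}"
      then have "ln (cmod (poly (of_int_poly P) (\<zeta> t))) \<le> ln (exp (real N * (U (\<zeta> t) + \<epsilon>)))"
        using P0 by (intro ln_mono P(2)) auto
      then show "ln (cmod (poly (of_int_poly P) (\<zeta> t))) \<le> real N * (U (\<zeta> t) + \<epsilon>)" by simp
    qed
    finally show ?thesis unfolding mean by (simp add: sum.distrib sum_distrib_left algebra_simps)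
  qed
qed

text \<open>The heart of the induction step: the induction hypothesis is applied to the resultant of \<open>G x\<close> with a
  small integer polynomial, which eliminates the last variable.\<close>
lemma integral_mean_log_nonneg:
  assumes IH: "nonneg_mean m" and G: "G \<in> polyfam m" "\<exists>x. G x \<noteq> 0"
    and bad: "\<And>\<beta> h. h \<noteq> (0 :: int poly) \<Longrightarrow> poly (of_int_poly h) \<beta> = 0 \<Longrightarrow> \<exists>x. poly (G x) \<beta> \<noteq> 0"
  shows "0 \<le> (\<integral>x. mean_log (G x) \<partial>PM m)"
proof -
  interpret PN: prob_space "PM m" by (rule prob_space_PM)
  obtain d x0 where d: "\<And>x. degree (G x) \<le> d" "coeff (G x0) d \<noteq> 0"
    using polyfam_leading[OF G] by blast
  have c: "AE x in PM m. coeff (G x) d \<noteq> 0"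
    using nonneg_meanD(1)[OF IH polyfam_coeff[OF G(1), of d], where x = x0] d(2) by simp
  have degd: "degree (G x) = d" "G x \<noteq> 0" if "coeff (G x) d \<noteq> 0" for x
    using that d(1)[of x] le_degree[of "G x" d] by (simp, force)
  note int = integrable_mean_log(2)[OF IH G]
  have key: "- (real d * \<epsilon>) \<le> (\<integral>x. mean_log (G x) \<partial>PM m)" if \<epsilon>: "\<epsilon> > 0" for \<epsilon>
  proof -
    obtain N :: nat and P :: "int poly" where P: "N \<ge> 1" "P \<noteq> 0" "degree P \<le> N"
      "\<And>z. cmod (poly (of_int_poly P) z) \<le> exp (real N * (U z + \<epsilon>))"
      using small_int_poly[OF \<epsilon>] by blast
    define s where "s x = det (sylvester d N (G x) (of_int_poly P))" for x
    have s: "s \<in> polyfun \<int> m"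
      unfolding s_def sylvester_def
    proof (intro polyfun_det)
      fix i j
      have "(\<lambda>x. coeff (monom 1 (i - d) * G x) j) \<in> polyfun \<int> m"
        using polyfun.const[of 0 "\<int>" m] polyfam_coeff[OF G(1), of "j - (i - d)"]
        by (cases "i - d \<le> j") (simp_all add: coeff_monom_mult)
      moreover have "coeff (monom 1 i * of_int_poly P) j \<in> (\<int> :: complex set)"
        by (simp add: coeff_monom_mult coeff_map_poly)
      ultimately show "(\<lambda>x. if i < d then coeff (monom 1 i * of_int_poly P) j
          else coeff (monom 1 (i - d) * G x) j) \<in> polyfun \<int> m"
        by (cases "i < d") (simp_all add: polyfun.const)
    qed
    have "\<exists>x. s x \<noteq> 0"
    proof -
      \<comment> \<open>\<open>None\<close> stands for the leading coefficient, \<open>Some \<beta>\<close> for the value at a root \<open>\<beta>\<close> of \<open>P\<close>.\<close>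
      let ?S = "insert None (Some ` {z. poly (of_int_poly P) z = (0 :: complex)})"
      define f where "f o' x = (case o' of None \<Rightarrow> coeff (G x) d | Some \<beta> \<Rightarrow> poly (G x) \<beta>)" for o' x
      have "\<exists>x. \<forall>i\<in>?S. f i x \<noteq> 0"
      proof (rule polyfun_prod_nonzero)
        show "finite ?S" using P(2) by (auto intro!: poly_roots_finite)
        show "f i \<in> polyfun UNIV m" if "i \<in> ?S" for i
          using polyfun_mono[OF polyfam_coeff[OF G(1), of d], of UNIV m] polyfam_eval_const[OF G(1)]
          by (cases i) (auto simp: f_def[abs_def])
        show "\<exists>x. f i x \<noteq> 0" if "i \<in> ?S" for i
          using that d(2) bad[OF P(2)] by (auto simp: f_def)
      qed
      then obtain x where x: "\<forall>i\<in>?S. f i x \<noteq> 0" by blast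
      then have "coeff (G x) d \<noteq> 0" by (auto simp: f_def)
      moreover have "poly (G x) \<beta> \<noteq> 0" if "poly (of_int_poly P) \<beta> = 0" for \<beta>
        using x that by (auto simp: f_def)
      ultimately have "s x \<noteq> 0"
        unfolding s_def using ln_sylvester_le(1)[OF P(3,4) degd(2,1)[of x]] by blast
      then show ?thesis by blast
    qed
    then obtain x1 where x1: "s x1 \<noteq> 0" ..
    have s2: "AE x in PM m. s x \<noteq> 0" "integrable (PM m) (\<lambda>x. ln (cmod (s x)))"
      "0 \<le> (\<integral>x. ln (cmod (s x)) \<partial>PM m)"
      using nonneg_meanD[OF IH s x1] by auto
    have "0 \<le> (\<integral>x. ln (cmod (s x)) \<partial>PM m)" by (rule s2(3))
    also have "\<dots> \<le> (\<integral>x. real N * mean_log (G x) + real d * (real N * \<epsilon>) \<partial>PM m)"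
    proof (rule integral_mono_AE)
      show "AE x in PM m. ln (cmod (s x)) \<le> real N * mean_log (G x) + real d * (real N * \<epsilon>)"
        using s2(1) c
      proof eventually_elim
        case (elim x)
        then show ?case
          using ln_sylvester_le(2)[OF P(3,4) degd(2,1)[of x]] unfolding s_def by blast
      qed
    qed (use s2 int in auto)
    also have "\<dots> = real N * (\<integral>x. mean_log (G x) \<partial>PM m) + real d * (real N * \<epsilon>)"
      using int by (simp add: PN.prob_space)
    finally have "0 \<le> real N * ((\<integral>x. mean_log (G x) \<partial>PM m) + real d * \<epsilon>)" by (simp add: algebra_simps)
    then show ?thesis using P(1) by (simp add: zero_le_mult_iff)
  qed
  show ?thesis
  proof (rule field_le_epsilon)
    fix e :: real assume e: "e > 0"
    have "- e \<le> - (real d * (e / (real d + 1)))"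
      using e by (simp add: field_simps)
    also have "\<dots> \<le> (\<integral>x. mean_log (G x) \<partial>PM m)" using e by (intro key) simp
    finally show "0 \<le> (\<integral>x. mean_log (G x) \<partial>PM m) + e" by simp
  qed
qed

text \<open>The content has nonnegative mean by hypothesis on \<open>\<mu>\<close> and the rest by the previous lemma. Passing from
  the iterated to the product integral requires joint integrability, which follows from Tonelli's theorem
  since the integrand is bounded above on the support.\<close>
lemma nonneg_mean_Suc:
  assumes IH: "nonneg_mean m"
  shows "nonneg_mean (Suc m)"
  unfolding nonneg_mean_def
proof (intro ballI impI)
  fix f assume f: "f \<in> polyfun \<int> (Suc m)" and "\<exists>x. f x \<noteq> 0"
  obtain F where F: "F \<in> polyfam m" "\<And>x. f x = poly (F x) (x m)"
    using polyfun_Suc_polyfam[OF f] by blast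
  have F0: "\<exists>x. F x \<noteq> 0" using \<open>\<exists>x. f x \<noteq> 0\<close> F(2) by (metis poly_0)
  obtain g :: "int poly" and G where g: "g \<noteq> 0" "G \<in> polyfam m" "\<And>x. F x = of_int_poly g * G x"
    "\<And>\<beta> h. h \<noteq> (0 :: int poly) \<Longrightarrow> poly (of_int_poly h) \<beta> = 0 \<Longrightarrow> \<exists>x. poly (G x) \<beta> \<noteq> 0"
    using polyfam_content_factor[OF F(1) F0] by blast
  have G0: "\<exists>x. G x \<noteq> 0" using F0 g(3) by auto
  interpret PN: prob_space "PM m" by (rule prob_space_PM)
  interpret PS: product_sigma_finite "\<lambda>_::nat. \<mu>" by unfold_locales
  note F1 = integrable_mean_log[OF IH F(1) F0]
  note G1 = integrable_mean_log[OF IH g(2) G0]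
  have "(\<integral>x. mean_log (F x) \<partial>PM m) = (\<integral>x. mean_log (of_int_poly g) + mean_log (G x) \<partial>PM m)"
  proof (rule integral_cong_AE)
    show "AE x in PM m. mean_log (F x) = mean_log (of_int_poly g) + mean_log (G x)"
      using G1(1) by eventually_elim (use g in \<open>auto simp: mean_log_mult\<close>)
  qed (use mean_log_measurable[OF F(1)] mean_log_measurable[OF g(2)] in auto)
  also have "\<dots> = mean_log (of_int_poly g) + (\<integral>x. mean_log (G x) \<partial>PM m)"
    using G1(2) by (simp add: PN.prob_space)
  also have "\<dots> \<ge> 0"
    using int_poly_nonneg[OF g(1)] integral_mean_log_nonneg[OF IH g(2) G0 g(4)] by simp
  finally have nn: "0 \<le> (\<integral>x. mean_log (F x) \<partial>PM m)" .
  obtain K where K: "K \<ge> 0" "\<And>x w. (\<And>i. i < m \<Longrightarrow> cmod (x i) \<le> R) \<Longrightarrow> cmod w \<le> R \<Longrightarrow> cmod (poly (F x) w) \<le> K"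
    using polyfam_bounded[OF F(1)] by blast
  have ins: "{..<Suc m} = insert m {..<m}" by auto
  have fF: "f (x(m := y)) = poly (F x) y" for x y
    using F(2)[of "x(m := y)"] polyfam_local[OF F(1), of "x(m := y)" x] by simp
  \<comment> \<open>The value \<open>\<infinity>\<close> at zeros lets a single finite integral yield both nonvanishing and integrability.\<close>
  define h where "h x = (if f x = 0 then \<infinity> else ennreal \<bar>ln (cmod (f x))\<bar>)" for x
  have [measurable]: "f \<in> borel_measurable (PM (Suc m))" by (rule polyfun_measurable[OF f])
  have hm: "h \<in> borel_measurable (PM (Suc m))" unfolding h_def[abs_def] by measurable
  have "(\<integral>\<^sup>+x. h x \<partial>PM (Suc m)) = (\<integral>\<^sup>+x. (\<integral>\<^sup>+y. h (x(m := y)) \<partial>\<mu>) \<partial>PM m)"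
    using hm unfolding ins by (intro PS.product_nn_integral_insert) auto
  also have "\<dots> \<le> (\<integral>\<^sup>+x. ennreal (2 * K - mean_log (F x)) \<partial>PM m)"
  proof (rule nn_integral_mono_AE)
    show "AE x in PM m. (\<integral>\<^sup>+y. h (x(m := y)) \<partial>\<mu>) \<le> ennreal (2 * K - mean_log (F x))"
      using F1(1) AE_PM_bound[of m]
    proof eventually_elim
      case (elim x)
      have le: "AE y in \<mu>. ln (cmod (poly (F x) y)) \<le> K"
        using elim by (intro AE_ln_poly_le K(2)) auto
      have "(\<integral>\<^sup>+y. h (x(m := y)) \<partial>\<mu>) \<le> (\<integral>\<^sup>+y. ennreal (2 * K - ln (cmod (poly (F x) y))) \<partial>\<mu>)"
      proof (rule nn_integral_mono_AE)
        show "AE y in \<mu>. h (x(m := y)) \<le> ennreal (2 * K - ln (cmod (poly (F x) y)))"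
          using le AE_poly_nonzero[OF elim(1)]
        proof eventually_elim
          case (elim y)
          then have "\<bar>ln (cmod (poly (F x) y))\<bar> \<le> 2 * K - ln (cmod (poly (F x) y))"
            using K(1) by linarith
          then show ?case using elim by (auto simp: h_def fF intro: ennreal_leI)
        qed
      qed
      also have "\<dots> = ennreal (\<integral>y. 2 * K - ln (cmod (poly (F x) y)) \<partial>\<mu>)"
      proof (rule nn_integral_eq_integral)
        show "integrable \<mu> (\<lambda>y. 2 * K - ln (cmod (poly (F x) y)))"
          by (intro Bochner_Integration.integrable_diff integrable_ln_poly elim) auto
        show "AE y in \<mu>. 0 \<le> 2 * K - ln (cmod (poly (F x) y))"
          using le by eventually_elim (use K(1) in linarith)
      qed
      also have "(\<integral>y. 2 * K - ln (cmod (poly (F x) y)) \<partial>\<mu>) = 2 * K - mean_log (F x)"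
        unfolding mean_log_def using elim
        by (subst Bochner_Integration.integral_diff) (auto intro: integrable_ln_poly)
      finally show ?case .
    qed
  qed
  also have "\<dots> < \<infinity>"
  proof -
    have "integrable (PM m) (\<lambda>x. 2 * K - mean_log (F x))"
      by (intro Bochner_Integration.integrable_diff F1) auto
    then show ?thesis using integrableD(2) by (auto simp: real_integrable_def less_top)
  qed
  finally have fin: "(\<integral>\<^sup>+x. h x \<partial>PM (Suc m)) < \<infinity>" .
  then have "AE x in PM (Suc m). h x \<noteq> \<infinity>" using hm by (intro nn_integral_PInf_AE) auto
  then have AE: "AE x in PM (Suc m). f x \<noteq> 0" by eventually_elim (auto simp: h_def)
  have int: "integrable (PM (Suc m)) (\<lambda>x. ln (cmod (f x)))"
  proof (rule integrableI_bounded)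
    have "(\<integral>\<^sup>+x. ennreal (norm (ln (cmod (f x)))) \<partial>PM (Suc m)) \<le> (\<integral>\<^sup>+x. h x \<partial>PM (Suc m))"
      by (intro nn_integral_mono) (auto simp: h_def)
    with fin show "(\<integral>\<^sup>+x. ennreal (norm (ln (cmod (f x)))) \<partial>PM (Suc m)) < \<infinity>" by (rule le_less_trans[rotated])
  qed measurable
  have "(\<integral>x. ln (cmod (f x)) \<partial>PM (Suc m)) = (\<integral>x. (\<integral>y. ln (cmod (f (x(m := y)))) \<partial>\<mu>) \<partial>PM m)"
    using int unfolding ins by (intro PS.product_integral_insert) auto
  also have "\<dots> = (\<integral>x. mean_log (F x) \<partial>PM m)" unfolding fF mean_log_def ..
  finally show "(AE x in PM (Suc m). f x \<noteq> 0) \<and> integrable (PM (Suc m)) (\<lambda>x. ln (cmod (f x))) \<and>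
     0 \<le> (\<integral>x. ln (cmod (f x)) \<partial>PM (Suc m))"
    using AE int nn by simp
qed

lemma polyfun_0_const:
  assumes "f \<in> polyfun A 0"
  obtains c where "f = (\<lambda>_. c)"
proof -
  have "f x = f (\<lambda>_. 0)" for x by (rule polyfun_local[OF assms]) auto
  then show thesis using that[of "f (\<lambda>_. 0)"] by blast
qed

theorem nonneg_mean: "nonneg_mean m"
proof (induction m)
  case 0
  interpret PN: prob_space "PM 0" by (rule prob_space_PM)
  show ?case unfolding nonneg_mean_def
  proof (intro ballI impI)
    fix f assume f: "f \<in> polyfun \<int> 0" and "\<exists>x. f x \<noteq> 0"
    obtain c where c: "f = (\<lambda>_. c)" using polyfun_0_const[OF f] by blast
    then have c0: "c \<noteq> 0" using \<open>\<exists>x. f x \<noteq> 0\<close> by simp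
    have "c \<in> \<int>" using polyfun_int_values[OF f, of "\<lambda>_. 0"] c by simp
    then obtain k :: int where k: "c = of_int k" by (auto elim: Ints_cases)
    then have "cmod c = of_int \<bar>k\<bar>" by simp
    moreover have "\<bar>k\<bar> \<ge> 1" using k c0 by auto
    ultimately have "cmod c \<ge> 1" by (metis of_int_1_le_iff)
    then show "(AE x in PM 0. f x \<noteq> 0) \<and> integrable (PM 0) (\<lambda>x. ln (cmod (f x))) \<and>
       0 \<le> (\<integral>x. ln (cmod (f x)) \<partial>PM 0)"
      using c0 by (simp add: c del: lessThan_0)
  qed
qed (rule nonneg_mean_Suc)

end

section \<open>Divided differences and the determinant bound\<close>

text \<open>Repeated synthetic division by \<open>X - x 0\<close>, \<open>X - x 1\<close>, and so on. The value of \<open>div_diff p x j\<close> at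
  \<open>x j\<close> is the divided difference of \<open>p\<close> at \<open>x 0, \<dots>, x j\<close>.\<close>
fun div_diff :: "'a::comm_ring_1 poly \<Rightarrow> (nat \<Rightarrow> 'a) \<Rightarrow> nat \<Rightarrow> 'a poly" where
  "div_diff p x 0 = p"
| "div_diff p x (Suc j) = synthetic_div (div_diff p x j) (x j)"

lemma div_diff_newton:
  "p = (\<Sum>l<j. smult (poly (div_diff p x l) (x l)) (newton_poly x l)) + newton_poly x j * div_diff p x j"
proof (induction j)
  case 0
  then show ?case by (simp add: newton_poly_def)
next
  case (Suc j)
  let ?q = "div_diff p x j"
  have "?q = [:- x j, 1:] * synthetic_div ?q (x j) + [:poly ?q (x j):]"
    by (rule synthetic_div_correct'[symmetric])
  then have "newton_poly x j * ?q = newton_poly x j * ([:- x j, 1:] * synthetic_div ?q (x j) + [:poly ?q (x j):])"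
    by simp
  also have "\<dots> = newton_poly x (Suc j) * div_diff p x (Suc j) + smult (poly ?q (x j)) (newton_poly x j)"
    by (simp add: newton_poly_def lessThan_Suc algebra_simps)
  finally show ?case using Suc.IH by (simp add: algebra_simps)
qed

lemma poly_div_diff:
  assumes "k < m"
  shows "poly p (x k) = (\<Sum>l<m. poly (div_diff p x l) (x l) * (\<Prod>t<l. x k - x t))"
proof -
  have "poly (newton_poly x m) (x k) = 0"
    unfolding poly_newton_poly using assms by (intro prod_zero bexI[of _ k]) auto
  then show ?thesis
    by (subst div_diff_newton[of p x m]) (simp add: poly_sum poly_newton_poly)
qed

text \<open>The coefficients of the quotient are computed from the top by Horner's recursion, without
  division; so they are integer polynomials in the coefficients and the node.\<close>
lemma polyfam_synthetic_div:
  assumes F: "F \<in> polyfam m" and i: "i < m"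
  shows "(\<lambda>x. synthetic_div (F x) (x i)) \<in> polyfam m"
proof -
  obtain d where d: "\<And>x. degree (F x) \<le> d" using F by (auto simp: polyfam_def)
  have ds: "degree (synthetic_div (F x) (x i)) \<le> d" for x
    using d[of x] by (simp add: degree_synthetic_div)
  have rec: "coeff (synthetic_div (F x) (x i)) k
      = coeff (F x) (Suc k) + x i * coeff (synthetic_div (F x) (x i)) (Suc k)" for x k
  proof -
    have "coeff (F x) (Suc k) = coeff ([:- x i, 1:] * synthetic_div (F x) (x i) + [:poly (F x) (x i):]) (Suc k)"
      by (simp only: synthetic_div_correct')
    then show ?thesis by simp
  qed
  have "(\<lambda>x. coeff (synthetic_div (F x) (x i)) k) \<in> polyfun \<int> m" for k
  proof (induction "Suc d - k" arbitrary: k)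
    case 0
    then have "coeff (synthetic_div (F x) (x i)) k = 0" for x
      using ds[of x] by (intro coeff_eq_0) linarith
    then show ?case by (simp add: polyfun.const)
  next
    case (Suc t)
    then have S: "(\<lambda>x. coeff (synthetic_div (F x) (x i)) (Suc k)) \<in> polyfun \<int> m"
      by (intro Suc.hyps(1)) linarith
    have "(\<lambda>x. coeff (F x) (Suc k) + x i * coeff (synthetic_div (F x) (x i)) (Suc k)) \<in> polyfun \<int> m"
      by (rule polyfun.add[OF polyfam_coeff[OF F] polyfun.mult[OF polyfun.var[OF i] S]])
    moreover have "(\<lambda>x. coeff (synthetic_div (F x) (x i)) k)
        = (\<lambda>x. coeff (F x) (Suc k) + x i * coeff (synthetic_div (F x) (x i)) (Suc k))"
      by (rule ext) (rule rec)
    ultimately show ?case by simp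
  qed
  with ds show ?thesis by (intro polyfamI[of _ d]) auto
qed

lemma polyfam_div_diff:
  "j \<le> m \<Longrightarrow> (\<lambda>x. div_diff (of_int_poly (p :: int poly)) x j) \<in> polyfam m"
  by (induction j) (auto intro: polyfam_const polyfam_synthetic_div)

text \<open>Newton interpolation writes the matrix of values as the matrix of divided differences times an
  upper triangular matrix whose determinant is the Vandermonde product.\<close>
lemma det_eval_div_diff:
  fixes p :: "nat \<Rightarrow> 'a::idom poly"
  shows "det (mat m m (\<lambda>(i, k). poly (p i) (x k)))
    = det (mat m m (\<lambda>(i, l). poly (div_diff (p i) x l) (x l))) * (\<Prod>k<m. \<Prod>t<k. x k - x t)"
proof -
  let ?D = "mat m m (\<lambda>(i, k). poly (p i) (x k))"
  let ?M = "mat m m (\<lambda>(i, l). poly (div_diff (p i) x l) (x l))"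
  let ?V = "mat m m (\<lambda>(l, k). \<Prod>t<l. x k - x t)"
  have "?D = ?M * ?V"
    by (rule eq_matI) (auto simp: scalar_prod_def poly_div_diff[of _ m _ x] atLeast0LessThan)
  moreover have "det ?V = (\<Prod>k<m. \<Prod>t<k. x k - x t)"
  proof -
    have "upper_triangular ?V"
    proof (rule upper_triangularI)
      fix l k assume "k < l" "l < dim_row ?V"
      then have "(\<Prod>t<l. x k - x t) = 0" by (intro prod_zero bexI[of _ k]) auto
      then show "?V $$ (l, k) = 0" using \<open>k < l\<close> \<open>l < dim_row ?V\<close> by simp
    qed
    then have "det ?V = (\<Prod>i=0..<m. ?V $$ (i, i))"
      by (subst det_upper_triangular[of ?V m]) (auto simp: prod_list_diag_prod)
    then show ?thesis by (simp add: atLeast0LessThan)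
  qed
  ultimately show ?thesis by (simp add: det_mult[of ?M m ?V])
qed

lemma det_norm_le:
  fixes A :: "complex mat"
  assumes A: "A \<in> carrier_mat m m" and bd: "\<And>i k. i < m \<Longrightarrow> k < m \<Longrightarrow> cmod (A $$ (i, k)) \<le> l i * e k"
  shows "cmod (det A) \<le> fact m * ((\<Prod>i<m. l i) * (\<Prod>k<m. e k))"
proof -
  have "cmod (det A) \<le> (\<Sum>p | p permutes {0..<m}. cmod (signof p * (\<Prod>i=0..<m. A $$ (i, p i))))"
    unfolding det_def'[OF A] by (rule norm_sum)
  also have "\<dots> \<le> (\<Sum>p | p permutes {0..<m}. (\<Prod>i<m. l i) * (\<Prod>k<m. e k))"
  proof (rule sum_mono)
    fix p assume "p \<in> {p. p permutes {0..<m}}"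
    then have p: "p permutes {0..<m}" by simp
    have "cmod (signof p * (\<Prod>i=0..<m. A $$ (i, p i))) = (\<Prod>i=0..<m. cmod (A $$ (i, p i)))"
      by (simp add: norm_mult prod_norm sign_def)
    also have "\<dots> \<le> (\<Prod>i=0..<m. l i * e (p i))"
      using permutes_in_image[OF p] by (intro prod_mono conjI bd) auto
    also have "\<dots> = (\<Prod>i<m. l i) * (\<Prod>i=0..<m. e (p i))" by (simp add: prod.distrib atLeast0LessThan)
    also have "(\<Prod>i=0..<m. e (p i)) = (\<Prod>k<m. e k)"
      using prod.permute[OF p, of e] by (simp add: o_def atLeast0LessThan)
    finally show "cmod (signof p * (\<Prod>i=0..<m. A $$ (i, p i))) \<le> (\<Prod>i<m. l i) * (\<Prod>k<m. e k)" .
  qed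
  also have "\<dots> = fact m * ((\<Prod>i<m. l i) * (\<Prod>k<m. e k))"
    by (simp add: card_permutations[of "{0..<m}" m])
  finally show ?thesis .
qed

text \<open>Laplace expansion along the column of a new point \<open>y\<close> writes the determinant as a linear combination
  of the values \<open>q i y\<close>, in which \<open>q m\<close> has a nonzero coefficient by induction. If it vanished
  for all \<open>y\<close>, then \<open>q m\<close> would be a combination of its predecessors.\<close>
lemma det_eval_nonzero:
  fixes q :: "nat \<Rightarrow> 'a::field_char_0 poly"
  assumes indep: "\<And>j c. j < m \<Longrightarrow> q j \<noteq> (\<Sum>i<j. smult (c i) (q i))"
  shows "\<exists>x. det (mat m m (\<lambda>(i, k). poly (q i) (x k))) \<noteq> 0"
  using assms
proof (induction m)
  case 0
  show ?case by (simp add: det_dim_zero)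
next
  case (Suc m)
  then obtain x where x: "det (mat m m (\<lambda>(i, k). poly (q i) (x k))) \<noteq> 0"
    using less_Suc_eq by blast
  let ?A = "\<lambda>y. mat (Suc m) (Suc m) (\<lambda>(i, k). poly (q i) ((x(m := y)) k))"
  show ?case
  proof (rule ccontr)
    assume "\<not> ?thesis"
    then have zero: "det (?A y) = 0" for y by blast
    define c where "c i = cofactor (?A 0) i m" for i
    have cof: "cofactor (?A y) i m = c i" if "i < Suc m" for i y
    proof -
      have "mat_delete (?A y) i m = mat_delete (?A 0) i m"
        by (rule eq_matI) (auto simp: mat_delete_def)
      then show ?thesis by (simp add: c_def cofactor_def)
    qed
    have "(\<Sum>i<Suc m. poly (q i) y * c i) = 0" for y
    proof -
      have "det (?A y) = (\<Sum>i<Suc m. ?A y $$ (i, m) * cofactor (?A y) i m)"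
        by (rule laplace_expansion_column) auto
      also have "\<dots> = (\<Sum>i<Suc m. poly (q i) y * c i)"
        using cof by (intro sum.cong) auto
      finally show ?thesis using zero by simp
    qed
    then have "poly (\<Sum>i<Suc m. smult (c i) (q i)) y = 0" for y
      by (simp add: poly_sum mult.commute)
    then have rel: "(\<Sum>i<Suc m. smult (c i) (q i)) = 0"
      by (simp add: poly_all_0_iff_0[symmetric])
    have "mat_delete (?A 0) m m = mat m m (\<lambda>(i, k). poly (q i) (x k))"
      by (rule eq_matI) (auto simp: mat_delete_def)
    then have cm: "c m \<noteq> 0" using x by (simp add: c_def cofactor_def)
    have "smult (c m) (q m) = - (\<Sum>i<m. smult (c i) (q i))"
      using rel by (simp add: add_eq_0_iff)
    then have "smult (1 / c m) (smult (c m) (q m)) = (\<Sum>i<m. smult (- c i / c m) (q i))"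
      by (simp add: smult_sum2 sum_negf)
    then have "q m = (\<Sum>i<m. smult (- c i / c m) (q i))" using cm by simp
    then show False using Suc.prems[of m "\<lambda>i. - c i / c m"] by simp
  qed
qed

lemma sum_pairs_const: "(\<Sum>k<m. \<Sum>t<k. c :: real) = real m * (real m - 1) / 2 * c"
  by (induction m) (auto simp: field_simps)

context arithmetic_measure
begin

text \<open>Compare both sides of \<open>det_eval_div_diff\<close> in the mean: the left-hand side is bounded by Leibniz' formula,
  the determinant of divided differences has nonnegative mean, and the logarithm of the
  Vandermonde product has mean \<open>m (m - 1) / 2\<close> times the energy.\<close>
theorem small_family_bound:
  fixes p :: "nat \<Rightarrow> int poly"
  assumes l: "\<And>i. i < m \<Longrightarrow> l i > 0"
    and bd: "\<And>i z. i < m \<Longrightarrow> cmod (poly (of_int_poly (p i)) z) \<le> l i * exp (real n * U z)"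
    and indep: "\<exists>x. det (mat m m (\<lambda>(i, k). poly (of_int_poly (p i)) (x k))) \<noteq> (0 :: complex)"
  shows "1 / fact m * exp ((- (real n * real m) + (real m - 1) * real m / 2) * log_energy) \<le> (\<Prod>i<m. l i)"
proof -
  interpret PN: prob_space "PM m" by (rule prob_space_PM)
  let ?p = "\<lambda>i. of_int_poly (p i) :: complex poly"
  define D where "D x = det (mat m m (\<lambda>(i, k). poly (?p i) (x k)))" for x
  define Q where "Q x = det (mat m m (\<lambda>(i, l). poly (div_diff (?p i) x l) (x l)))" for x
  have DQ: "D x = Q x * (\<Prod>k<m. \<Prod>t<k. x k - x t)" for x
    unfolding D_def Q_def by (rule det_eval_div_diff)
  have Q: "Q \<in> polyfun \<int> m"
    unfolding Q_def by (intro polyfun_det polyfam_eval polyfam_div_diff) auto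
  obtain x0 where "D x0 \<noteq> 0" using indep by (auto simp: D_def)
  then have "Q x0 \<noteq> 0" using DQ by auto
  note Q3 = nonneg_meanD[OF nonneg_mean Q this]
  have AE_ne: "AE x in PM m. \<forall>k\<in>{..<m}. \<forall>t\<in>{..<k}. x k \<noteq> x t"
  proof (intro AE_finite_allI finite_lessThan)
    fix k t assume kt: "k \<in> {..<m}" "t \<in> {..<k}"
    have "(\<lambda>x. x k - x t) \<in> polyfun \<int> m"
      using kt by (intro polyfun_diff polyfun.var) auto
    then have "AE x in PM m. x k - x t \<noteq> 0"
      by (rule nonneg_meanD(1)[OF nonneg_mean, where x = "\<lambda>i. if i = k then 1 else 0"]) (use kt in auto)
    then show "AE x in PM m. x k \<noteq> x t" by eventually_elim simp
  qed
  define W where "W x = ln (fact m) + (\<Sum>i<m. ln (l i)) + real n * (\<Sum>k<m. U (x k))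
      - (\<Sum>k<m. \<Sum>t<k. ln (cmod (x k - x t)))" for x
  have U_int: "integrable (PM m) (\<lambda>x. U (x k))" "(\<integral>x. U (x k) \<partial>PM m) = log_energy" if "k < m" for k
    using integral_PM_component[OF that integrable_U] by (auto simp: log_energy_def)
  have L_int: "integrable (PM m) (\<lambda>x. ln (cmod (x k - x t)))" "(\<integral>x. ln (cmod (x k - x t)) \<partial>PM m) = log_energy"
    if "k < m" "t < k" for k t
    using integral_PM_pair[of k m t, OF _ _ _ integrable_pair_ln] that by (auto simp: log_energy_def U_def)
  have S_int: "integrable (PM m) (\<lambda>x. \<Sum>k<m. U (x k))"
    "integrable (PM m) (\<lambda>x. \<Sum>k<m. \<Sum>t<k. ln (cmod (x k - x t)))"
    using U_int L_int by (auto intro!: Bochner_Integration.integrable_sum)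
  have W_int: "integrable (PM m) W"
    unfolding W_def using S_int by (intro Bochner_Integration.integrable_diff Bochner_Integration.integrable_add) auto
  have "0 \<le> (\<integral>x. ln (cmod (Q x)) \<partial>PM m)" by (rule Q3(3))
  also have "\<dots> \<le> (\<integral>x. W x \<partial>PM m)"
  proof (rule integral_mono_AE[OF Q3(2) W_int])
    show "AE x in PM m. ln (cmod (Q x)) \<le> W x"
      using Q3(1) AE_ne
    proof eventually_elim
      case (elim x)
      have ne: "cmod (x k - x t) \<noteq> 0" if "k < m" "t < k" for k t using elim that by auto
      have pp: "(\<Prod>t<k. cmod (x k - x t)) > 0" if "k < m" for k
        using ne[OF that] by (intro prod_pos) auto
      have V: "(\<Prod>k<m. \<Prod>t<k. cmod (x k - x t)) > 0"
      proof (rule prod_pos)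
        show "(\<Prod>t<k. cmod (x k - x t)) > 0" if "k \<in> {..<m}" for k using that by (intro pp) simp
      qed
      have lnV: "ln (\<Prod>k<m. \<Prod>t<k. cmod (x k - x t)) = (\<Sum>k<m. \<Sum>t<k. ln (cmod (x k - x t)))"
      proof -
        have "ln (\<Prod>k<m. \<Prod>t<k. cmod (x k - x t)) = (\<Sum>k<m. ln (\<Prod>t<k. cmod (x k - x t)))"
        proof (rule ln_prod)
          show "(\<Prod>t<k. cmod (x k - x t)) \<noteq> 0" if "k \<in> {..<m}" for k using pp[of k] that by (metis less_irrefl lessThan_iff)
        qed simp
        also have "\<dots> = (\<Sum>k<m. \<Sum>t<k. ln (cmod (x k - x t)))"
        proof (intro sum.cong refl ln_prod)
          show "cmod (x k - x t) \<noteq> 0" if "k \<in> {..<m}" "t \<in> {..<k}" for k t using ne that by simp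
        qed simp
        finally show ?thesis .
      qed
      have "cmod (D x) = cmod (Q x) * (\<Prod>k<m. \<Prod>t<k. cmod (x k - x t))"
        unfolding DQ by (simp add: norm_mult prod_norm)
      moreover have "cmod (D x) \<le> fact m * ((\<Prod>i<m. l i) * (\<Prod>k<m. exp (real n * U (x k))))"
        unfolding D_def by (rule det_norm_le) (auto intro: bd)
      ultimately have "ln (cmod (Q x) * (\<Prod>k<m. \<Prod>t<k. cmod (x k - x t)))
          \<le> ln (fact m * ((\<Prod>i<m. l i) * (\<Prod>k<m. exp (real n * U (x k)))))"
        using mult_pos_pos[of "cmod (Q x)", OF _ V] elim(1) by (intro ln_mono) simp_all
      also have "ln (fact m * ((\<Prod>i<m. l i) * (\<Prod>k<m. exp (real n * U (x k)))))
          = ln (fact m) + ((\<Sum>i<m. ln (l i)) + real n * (\<Sum>k<m. U (x k)))"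
      proof -
        have "ln (\<Prod>i<m. l i) = (\<Sum>i<m. ln (l i))"
        proof (rule ln_prod)
          show "l i \<noteq> 0" if "i \<in> {..<m}" for i using l[of i] that by simp
        qed simp
        moreover have "(\<Prod>i<m. l i) > 0" using l by (intro prod_pos) auto
        moreover have "(\<Prod>k<m. exp (real n * U (x k))) = exp (real n * (\<Sum>k<m. U (x k)))"
          by (simp add: exp_sum sum_distrib_left)
        ultimately show ?thesis by (simp add: ln_mult_pos)
      qed
      also have "ln (cmod (Q x) * (\<Prod>k<m. \<Prod>t<k. cmod (x k - x t)))
          = ln (cmod (Q x)) + (\<Sum>k<m. \<Sum>t<k. ln (cmod (x k - x t)))"
        using ln_mult_pos[of "cmod (Q x)", OF _ V] elim(1) by (simp only: lnV zero_less_norm_iff not_False_eq_True simp_thms)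
      finally show ?case unfolding W_def by linarith
    qed
  qed
  also have "(\<integral>x. W x \<partial>PM m) = ln (fact m) + (\<Sum>i<m. ln (l i)) + real n * (real m * log_energy)
      - real m * (real m - 1) / 2 * log_energy"
  proof -
    have "(\<integral>x. (\<Sum>k<m. U (x k)) \<partial>PM m) = real m * log_energy"
      using U_int by (simp add: Bochner_Integration.integral_sum)
    moreover have "(\<integral>x. (\<Sum>k<m. \<Sum>t<k. ln (cmod (x k - x t))) \<partial>PM m) = (\<Sum>k<m. \<Sum>t<k. log_energy)"
      using L_int by (subst Bochner_Integration.integral_sum)
        (auto intro!: Bochner_Integration.integrable_sum sum.cong simp: Bochner_Integration.integral_sum)
    ultimately show ?thesis
      unfolding W_def using S_int sum_pairs_const[where c = log_energy and m = m]
      by (simp add: PN.prob_space)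
  qed
  finally have "(- (real n * real m) + (real m - 1) * real m / 2) * log_energy \<le> ln (fact m) + (\<Sum>i<m. ln (l i))"
    by (simp add: algebra_simps)
  then have "exp ((- (real n * real m) + (real m - 1) * real m / 2) * log_energy) \<le> exp (ln (fact m) + (\<Sum>i<m. ln (l i)))"
    by simp
  also have "\<dots> = fact m * (\<Prod>i<m. l i)"
    using l by (simp add: exp_add exp_sum)
  finally show ?thesis by (simp add: field_simps)
qed

end

section \<open>Successive minima\<close>

lemma eintegral_cong_AE:
  assumes "AE x in M. f x = g x"
  shows "eintegral M f = eintegral M g"
proof -
  have "(\<integral>\<^sup>+x. e2ennreal (f x) \<partial>M) = (\<integral>\<^sup>+x. e2ennreal (g x) \<partial>M)"
    "(\<integral>\<^sup>+x. e2ennreal (- f x) \<partial>M) = (\<integral>\<^sup>+x. e2ennreal (- g x) \<partial>M)"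
    using assms by (auto intro!: nn_integral_cong_AE elim!: eventually_mono)
  then show ?thesis by (simp add: eintegral_def)
qed

lemma elog_nonzero: "x \<noteq> 0 \<Longrightarrow> elog x = ereal (ln x)"
  by (simp add: elog_def)

lemma elog_div_le_iff:
  assumes "x \<ge> 0" "n > 0"
  shows "elog x / ereal (real n) \<le> ereal u \<longleftrightarrow> x \<le> exp (real n * u)"
proof (cases "x = 0")
  case True
  then show ?thesis using assms by (simp add: elog_def)
next
  case False
  then have "elog x / ereal (real n) \<le> ereal u \<longleftrightarrow> ln x \<le> real n * u"
    using assms by (simp add: elog_nonzero field_simps)
  also have "\<dots> \<longleftrightarrow> x \<le> exp (real n * u)"
    using False assms by (metis exp_le_cancel_iff exp_ln order_le_less)
  finally show ?thesis .
qed

context log_measure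
begin

lemma eintegral_elog_poly:
  assumes "p \<noteq> 0"
  shows "eintegral \<mu> (\<lambda>x. elog (cmod (poly p x))) = ereal (mean_log p)"
proof -
  have "eintegral \<mu> (\<lambda>x. elog (cmod (poly p x))) = eintegral \<mu> (\<lambda>x. ereal (ln (cmod (poly p x))))"
    using AE_poly_nonzero[OF assms] by (intro eintegral_cong_AE) (auto simp: elog_nonzero elim!: eventually_mono)
  then show ?thesis
    unfolding mean_log_def by (simp add: eintegral_ereal[OF integrable_ln_poly[OF assms]])
qed

lemma potential_eq: "potential \<mu> z = ereal (U z)"
proof -
  have "potential \<mu> z = eintegral \<mu> (\<lambda>w. ereal (ln (cmod (z - w))))"
    unfolding potential_def using AE_neq[of z]
    by (intro eintegral_cong_AE) (auto simp: elog_nonzero elim!: eventually_mono)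
  then show ?thesis unfolding U_def by (simp add: eintegral_ereal[OF integrable_ln_dist])
qed

lemma energy_eq: "energy \<mu> = ereal log_energy"
proof -
  have "energy \<mu> = eintegral \<mu> (\<lambda>z. ereal (U z))"
    unfolding energy_def using potential_eq by (simp add: potential_def)
  then show ?thesis unfolding log_energy_def by (simp add: eintegral_ereal[OF integrable_U])
qed

lemma K_body_iff:
  assumes "n > 0"
  shows "p \<in> K_body \<mu> n \<longleftrightarrow> degree p \<le> n \<and>
    (\<forall>z. cmod (poly (map_poly complex_of_real p) z) \<le> exp (real n * U z))"
  unfolding K_body_def potential_eq using assms by (simp add: elog_div_le_iff)

text \<open>A multiple of \<open>K_body\<close> contains all monomials, which shows that the sets whose infima are the
  successive minima are not empty.\<close>
lemma monom_in_K_body: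
  assumes "n > 0"
  shows "\<exists>l>0. \<forall>i\<le>n. monom 1 i \<in> smult l ` K_body \<mu> n"
proof -
  obtain c where c: "c > 0" "\<And>z. exp (U z) \<ge> c * (1 + cmod z)" using exp_U_ge by blast
  show ?thesis
  proof (intro exI[of _ "1 / c ^ n"] conjI allI impI)
    show "1 / c ^ n > 0" using c by simp
    fix i assume i: "i \<le> n"
    have "monom (c ^ n) i \<in> K_body \<mu> n"
      unfolding K_body_iff[OF assms]
    proof (intro conjI allI)
      show "degree (monom (c ^ n) i) \<le> n" using i degree_monom_le[of "c ^ n" i] by linarith
      fix z
      have "cmod (poly (map_poly complex_of_real (monom (c ^ n) i)) z) = c ^ n * cmod z ^ i"
        using c by (simp add: map_poly_monom poly_monom norm_mult norm_power)
      also have "\<dots> \<le> c ^ n * (1 + cmod z) ^ n"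
      proof (intro mult_left_mono)
        have "cmod z ^ i \<le> (1 + cmod z) ^ i" by (intro power_mono) auto
        also have "\<dots> \<le> (1 + cmod z) ^ n" using i by (intro power_increasing) auto
        finally show "cmod z ^ i \<le> (1 + cmod z) ^ n" .
      qed (use c in auto)
      also have "\<dots> = (c * (1 + cmod z)) ^ n" by (simp add: power_mult_distrib)
      also have "\<dots> \<le> exp (U z) ^ n" using c(1) c(2)[of z] by (intro power_mono) auto
      finally show "cmod (poly (map_poly complex_of_real (monom (c ^ n) i)) z) \<le> exp (real n * U z)"
        by (simp add: exp_of_nat_mult)
    qed
    moreover have "monom 1 i = smult (1 / c ^ n) (monom (c ^ n) i)"
      using c by (simp add: smult_monom)
    ultimately show "monom 1 i \<in> smult (1 / c ^ n) ` K_body \<mu> n" by blast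
  qed
qed

end

lemma independent_monoms: "\<not> module.dependent smult ((\<lambda>i. monom 1 i :: real poly) ` {..k})"
proof -
  interpret vector_space "smult :: real \<Rightarrow> real poly \<Rightarrow> real poly" by (rule vector_space_smult)
  have inj: "inj_on (\<lambda>i. monom 1 i :: real poly) {..k}"
    by (rule inj_onI) (metis degree_monom_eq zero_neq_one)
  show ?thesis
    unfolding dependent_finite[OF finite_imageI[OF finite_atMost]]
  proof (intro notI, elim exE conjE bexE)
    fix u :: "real poly \<Rightarrow> real" and v assume v: "v \<in> (\<lambda>i. monom 1 i) ` {..k}" "u v \<noteq> 0"
      and s: "(\<Sum>v\<in>(\<lambda>i. monom 1 i) ` {..k}. smult (u v) v) = 0"
    then obtain i where i: "v = monom 1 i" "i \<le> k" by auto
    have "(\<Sum>j\<le>k. smult (u (monom 1 j)) (monom 1 j)) = 0"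
      using sum.reindex[OF inj, of "\<lambda>v. smult (u v) v"] s by (simp add: o_def)
    then have "coeff (\<Sum>j\<le>k. smult (u (monom 1 j)) (monom 1 j)) i = 0" by simp
    then have "u (monom 1 i) = 0"
      using i(2) by (simp add: coeff_sum if_distrib[of "\<lambda>x. _ * x"] sum.delta cong: if_cong)
    with v(2) i(1) show False by simp
  qed
qed

text \<open>Successive minima provide a separate independent set for each index. As in Steinitz' exchange lemma, a
  set of \<open>i + 1\<close> independent vectors is not contained in the span of \<open>i\<close> vectors chosen before.\<close>
lemma independent_transversal:
  fixes S :: "nat \<Rightarrow> real poly set"
  assumes "\<And>i. i < m \<Longrightarrow> card (S i) = i + 1 \<and> \<not> module.dependent smult (S i)"
  shows "\<exists>q. \<forall>i<m. q i \<in> S i \<and> q i \<notin> module.span smult (q ` {..<i})"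
  using assms
proof (induction m)
  case (Suc m)
  interpret vector_space "smult :: real \<Rightarrow> real poly \<Rightarrow> real poly" by (rule vector_space_smult)
  have "\<exists>q. \<forall>i<m. q i \<in> S i \<and> q i \<notin> span (q ` {..<i})"
    using Suc.prems by (intro Suc.IH) simp
  then obtain q where q: "\<forall>i<m. q i \<in> S i \<and> q i \<notin> span (q ` {..<i})" by blast
  have "\<not> S m \<subseteq> span (q ` {..<m})"
  proof
    assume "S m \<subseteq> span (q ` {..<m})"
    then have "card (S m) \<le> card (q ` {..<m})"
      using independent_span_bound[of "q ` {..<m}" "S m"] Suc.prems[of m] by simp
    also have "\<dots> \<le> m" using card_image_le[of "{..<m}" q] by simp
    finally show False using Suc.prems[of m] by simp
  qed
  then obtain v where v: "v \<in> S m" "v \<notin> span (q ` {..<m})" by blast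
  have im: "(q(m := v)) ` {..<i} = q ` {..<i}" if "i \<le> m" for i using that by auto
  show ?case
  proof (intro exI[of _ "q(m := v)"] allI impI)
    fix i assume "i < Suc m"
    then consider "i < m" | "i = m" by linarith
    then show "(q(m := v)) i \<in> S i \<and> (q(m := v)) i \<notin> span ((q(m := v)) ` {..<i})"
    proof cases
      case 1
      then show ?thesis using q im[of i] by (simp del: fun_upd_image)
    next
      case 2
      then show ?thesis using v im[of i] by (simp del: fun_upd_image)
    qed
  qed
qed simp

text \<open>Taking real parts of the coefficients turns a complex linear relation between real polynomials
  into a real one.\<close>
lemma complex_combination_real:
  fixes q :: "nat \<Rightarrow> real poly"
  assumes "map_poly complex_of_real (q j) = (\<Sum>i<j. smult (c i) (map_poly complex_of_real (q i)))"
  shows "q j \<in> module.span smult (q ` {..<j})"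
proof -
  interpret vector_space "smult :: real \<Rightarrow> real poly \<Rightarrow> real poly" by (rule vector_space_smult)
  have "q j = (\<Sum>i<j. smult (Re (c i)) (q i))"
  proof (rule poly_eqI)
    fix k
    have "complex_of_real (coeff (q j) k) = (\<Sum>i<j. c i * complex_of_real (coeff (q i) k))"
      using arg_cong[OF assms, of "\<lambda>p. coeff p k"] by (simp add: coeff_map_poly coeff_sum)
    then have "coeff (q j) k = Re (\<Sum>i<j. c i * complex_of_real (coeff (q i) k))"
      by (metis Re_complex_of_real)
    then show "coeff (q j) k = coeff (\<Sum>i<j. smult (Re (c i)) (q i)) k"
      by (simp add: coeff_sum)
  qed
  also have "\<dots> \<in> span (q ` {..<j})" by (intro span_sum span_scale span_base) auto
  finally show ?thesis .
qed

context arithmetic_measure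
begin

lemma successive_min_approx:
  assumes "n > 0" "k \<le> n" "\<epsilon> > 0"
  obtains l S where "l > 0" "l < successive_min (K_body \<mu> n) (Gamma_lattice n) k + \<epsilon>"
    "S \<subseteq> smult l ` K_body \<mu> n \<inter> Gamma_lattice n" "card S = k + 1" "\<not> module.dependent smult S"
proof -
  let ?A = "{l. l > 0 \<and> (\<exists>S. S \<subseteq> smult l ` K_body \<mu> n \<inter> Gamma_lattice n \<and> card S = k + 1 \<and> \<not> module.dependent smult S)}"
  obtain l where l: "l > 0" "\<And>i. i \<le> n \<Longrightarrow> monom 1 i \<in> smult l ` K_body \<mu> n"
    using monom_in_K_body[OF assms(1)] by auto
  have "l \<in> ?A"
  proof (intro CollectI conjI exI[of _ "(\<lambda>i. monom 1 i) ` {..k}"])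
    show "(\<lambda>i. monom 1 i) ` {..k} \<subseteq> smult l ` K_body \<mu> n \<inter> Gamma_lattice n"
      using l(2) assms(2) by (auto simp: Gamma_lattice_def degree_monom_eq)
    have "inj_on (\<lambda>i. monom 1 i :: real poly) {..k}"
      by (rule inj_onI) (metis degree_monom_eq zero_neq_one)
    then show "card ((\<lambda>i. monom 1 i :: real poly) ` {..k}) = k + 1" by (simp add: card_image)
  qed (use l independent_monoms in auto)
  then have "?A \<noteq> {}" by blast
  moreover have "Inf ?A < successive_min (K_body \<mu> n) (Gamma_lattice n) k + \<epsilon>"
    unfolding successive_min_def using assms(3) by simp
  ultimately obtain l' where "l' \<in> ?A" "l' < successive_min (K_body \<mu> n) (Gamma_lattice n) k + \<epsilon>"
    using cInf_lessD by meson
  then show thesis using that by blast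
qed

lemma Gamma_lattice_int:
  assumes "q \<in> Gamma_lattice n"
  obtains p :: "int poly" where "q = of_int_poly p"
proof
  show "q = of_int_poly (map_poly floor q)"
  proof (rule poly_eqI)
    fix i
    have "coeff q i \<in> \<int>" using assms by (simp add: Gamma_lattice_def)
    then have "of_int \<lfloor>coeff q i\<rfloor> = coeff q i" by (metis Ints_cases floor_of_int)
    then show "coeff q i = coeff (of_int_poly (map_poly floor q)) i"
      by (simp add: coeff_map_poly del: of_int_floor_cancel)
  qed
qed

text \<open>The infima need not be attained, so the bound is proved for numbers \<open>l i\<close> slightly larger than the
  successive minima and the excess \<open>\<epsilon>\<close> is then sent to \<open>0\<close>.\<close>
theorem successive_min_prod_ge:
  assumes n: "n > 0" and m: "m \<le> n + 1"
  shows "1 / fact m * exp ((- (real n * real m) + (real m - 1) * real m / 2) * log_energy)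
    \<le> (\<Prod>i<m. successive_min (K_body \<mu> n) (Gamma_lattice n) i)"
proof -
  let ?lam = "successive_min (K_body \<mu> n) (Gamma_lattice n)"
  let ?c = "1 / fact m * exp ((- (real n * real m) + (real m - 1) * real m / 2) * log_energy)"
  have "?c \<le> (\<Prod>i<m. ?lam i + \<epsilon>)" if \<epsilon>: "\<epsilon> > 0" for \<epsilon>
  proof -
    have "\<forall>i\<in>{..<m}. \<exists>l S. l > 0 \<and> l < ?lam i + \<epsilon> \<and> S \<subseteq> smult l ` K_body \<mu> n \<inter> Gamma_lattice n
        \<and> card S = i + 1 \<and> \<not> module.dependent smult S"
    proof
      fix i assume "i \<in> {..<m}"
      then have "i \<le> n" using m by simp
      then show "\<exists>l S. l > 0 \<and> l < ?lam i + \<epsilon> \<and> S \<subseteq> smult l ` K_body \<mu> n \<inter> Gamma_lattice n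
        \<and> card S = i + 1 \<and> \<not> module.dependent smult S"
        using successive_min_approx[OF n _ \<epsilon>] by metis
    qed
    then obtain l S where lS: "\<And>i. i < m \<Longrightarrow> l i > 0 \<and> l i < ?lam i + \<epsilon> \<and>
        S i \<subseteq> smult (l i) ` K_body \<mu> n \<inter> Gamma_lattice n \<and> card (S i) = i + 1 \<and> \<not> module.dependent smult (S i)"
      by (metis lessThan_iff)
    have "\<exists>q. \<forall>i<m. q i \<in> S i \<and> q i \<notin> module.span smult (q ` {..<i})"
      using lS by (intro independent_transversal) auto
    then obtain q where q: "\<And>i. i < m \<Longrightarrow> q i \<in> S i" "\<And>i. i < m \<Longrightarrow> q i \<notin> module.span smult (q ` {..<i})"
      by blast
    have qG: "q i \<in> smult (l i) ` K_body \<mu> n" "q i \<in> Gamma_lattice n" if "i < m" for i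
      using lS[OF that] q(1)[OF that] by auto
    have "\<forall>i\<in>{..<m}. \<exists>p :: int poly. q i = of_int_poly p"
      using qG(2) Gamma_lattice_int by (metis lessThan_iff)
    then obtain p :: "nat \<Rightarrow> int poly" where p: "\<And>i. i < m \<Longrightarrow> q i = of_int_poly (p i)"
      by (metis lessThan_iff)
    have pc: "map_poly complex_of_real (q i) = of_int_poly (p i)" if "i < m" for i
      unfolding p[OF that] by (rule poly_eqI) (simp add: coeff_map_poly)
    have bd: "cmod (poly (of_int_poly (p i)) z) \<le> l i * exp (real n * U z)" if i: "i < m" for i z
    proof -
      obtain r where r: "q i = smult (l i) r" "r \<in> K_body \<mu> n" using qG(1)[OF i] by blast
      have "map_poly complex_of_real (q i) = smult (of_real (l i)) (map_poly complex_of_real r)"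
        unfolding r(1) by (rule poly_eqI) (simp add: coeff_map_poly)
      then have "cmod (poly (of_int_poly (p i)) z) = l i * cmod (poly (map_poly complex_of_real r) z)"
        using lS[OF i] unfolding pc[OF i, symmetric] by (simp add: norm_mult)
      also have "\<dots> \<le> l i * exp (real n * U z)"
        using r(2) lS[OF i] unfolding K_body_iff[OF n] by (intro mult_left_mono) auto
      finally show ?thesis .
    qed
    have "?c \<le> (\<Prod>i<m. l i)"
    proof (rule small_family_bound[OF _ bd])
      show "\<exists>x. det (mat m m (\<lambda>(i, k). poly (of_int_poly (p i)) (x k))) \<noteq> (0 :: complex)"
      proof (rule det_eval_nonzero)
        fix j c assume j: "j < m"
        show "of_int_poly (p j) \<noteq> (\<Sum>i<j. smult (c i) (map_poly complex_of_int (p i)))"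
        proof
          assume *: "of_int_poly (p j) = (\<Sum>i<j. smult (c i) (map_poly complex_of_int (p i)))"
          have "map_poly complex_of_real (q j) = (\<Sum>i<j. smult (c i) (map_poly complex_of_real (q i)))"
            using j by (simp add: pc *)
          then show False using complex_combination_real q(2)[OF j] by blast
        qed
      qed
    qed (use lS in auto)
    also have "\<dots> \<le> (\<Prod>i<m. ?lam i + \<epsilon>)"
      using lS by (intro prod_mono) (auto intro: less_imp_le)
    finally show ?thesis .
  qed
  then have "\<forall>\<^sub>F \<epsilon> in at_right 0. ?c \<le> (\<Prod>i<m. ?lam i + \<epsilon>)"
    by (auto simp: eventually_at_filter)
  moreover have "((\<lambda>\<epsilon>. \<Prod>i<m. ?lam i + \<epsilon>) \<longlongrightarrow> (\<Prod>i<m. ?lam i + 0)) (at_right 0)"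
    by (intro tendsto_intros)
  ultimately have "?c \<le> (\<Prod>i<m. ?lam i + 0)"
    by (intro tendsto_lowerbound) auto
  then show ?thesis by simp
qed

end

text \<open>The constant \<open>R\<close> is the radius of a disc around \<open>\<Sigma>\<close>; the other two come from the Hoelder condition.\<close>
lemma B_Sigma_arithmetic_measure:
  assumes "compact \<Sigma>" "\<mu> \<in> B_Sigma \<Sigma>" "holder_measure \<mu>"
  obtains a C R where "arithmetic_measure \<mu> a C R"
proof -
  have B: "sets \<mu> = sets borel" "prob_space \<mu>" "emeasure \<mu> (- \<Sigma>) = 0" "distr \<mu> borel cnj = \<mu>"
    "\<And>Q :: int poly. Q \<noteq> 0 \<Longrightarrow> 0 \<le> eintegral \<mu> (\<lambda>x. elog (cmod (poly (of_int_poly Q) x)))"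
    using assms(2) by (auto simp: B_Sigma_def)
  obtain a C where aC: "0 < a" "a \<le> 1" "0 \<le> C"
    "\<And>z. (\<integral>\<^sup>+w. ennreal (cmod (z - w) powr (-a)) \<partial>\<mu>) \<le> ennreal C" "\<And>z. measure \<mu> {z} = 0"
    using holder_measure_moment[OF B(1,2) assms(3)] by metis
  obtain R0 where R0: "\<And>z. z \<in> \<Sigma> \<Longrightarrow> cmod z \<le> R0"
    using compact_imp_bounded[OF assms(1)] by (auto simp: bounded_iff)
  define R where "R = max 1 R0"
  have AE_R: "AE w in \<mu>. cmod w \<le> R"
  proof (rule AE_I')
    have "- \<Sigma> \<in> sets \<mu>" unfolding B(1) using compact_imp_closed[OF assms(1)] by auto
    then show "- \<Sigma> \<in> null_sets \<mu>" using B(3) by (simp add: null_setsI)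
    show "{w \<in> space \<mu>. \<not> cmod w \<le> R} \<subseteq> - \<Sigma>" using R0 by (auto simp: R_def le_max_iff_disj)
  qed
  have "log_measure \<mu> a C R"
    by (intro log_measure.intro log_measure_axioms.intro B(1,2) aC AE_R) (simp add: R_def)
  then interpret log_measure \<mu> a C R .
  have "arithmetic_measure \<mu> a C R"
  proof
    fix Q :: "int poly" assume "Q \<noteq> 0"
    then have "map_poly complex_of_int Q \<noteq> 0" by simp
    then show "0 \<le> mean_log (of_int_poly Q)"
      using B(5)[OF \<open>Q \<noteq> 0\<close>] by (simp add: eintegral_elog_poly)
  qed (rule B(4))
  then show thesis by (rule that)
qed

theorem proposition2p13:
  fixes \<Sigma> :: "complex set" and \<mu> :: "complex measure" and n m :: nat
  assumes "compact \<Sigma>"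
    and "\<mu> \<in> B_Sigma \<Sigma>"
    and "holder_measure \<mu>"
    and "n \<ge> 1"
    and "1 \<le> m" and "m \<le> n + 1"
  shows "(\<Prod>i = 0..m - 1. successive_min (K_body \<mu> n) (Gamma_lattice n) i)
    \<ge> 1 / fact m * exp ((- (real n * real m) + (real m - 1) * real m / 2)
                          * real_of_ereal (energy \<mu>))"
proof -
  obtain a C R where "arithmetic_measure \<mu> a C R"
    using B_Sigma_arithmetic_measure[OF assms(1-3)] by blast
  then interpret arithmetic_measure \<mu> a C R .
  have "{0..m - 1} = {..<m}" using assms(5) by auto
  then show ?thesis
    using successive_min_prod_ge[of n m] assms(4,6) by (simp add: energy_eq)
qed

end
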